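(* Let $A$ be a finitely generated $2$-Calabi-Yau $k$-algebra and let $F_\bullet$ be a resolution of $A$ by finitely generated projective (left) $A^e$-modules. Suppose that the functions $$c^i:\mathrm{Rep}^n_A(k)\longrightarrow\mathbb{N},\qquad M\longmapsto c^i_M:=\dim_k\mathrm{Hom}_{A^e}(F_i,\mathrm{End}_k(M))$$ are locally constant for $i=0,1,2$. Then on each irreducible component of $\mathrm{Rep}^n_A(k)$ the dimension of the tangent space $T_M\mathrm{Rep}^n_A$ is a (strictly) increasing function of $\dim_k\mathrm{End}_A(M)$.
   Context: $k$ is an algebraically closed field of characteristic zero, $A^e=A\otimes_kA^{\mathrm{op}}$. An algebra $A$ is homologically smooth if it has a finite resolution by finitely generated projective left $A^e$-modules; it is $2$-Calabi-Yau if it is homologically smooth and $\mathrm{Ext}^2_{A^e}(A,A^e)\cong A$ as $A^e$-modules while $\mathrm{Ext}^i_{A^e}(A,A^e)=0$ for $i\neq2$. $\mathrm{Rep}^n_A$ is the affine $k$-scheme representing $B\mapsto\mathrm{Hom}_{k\text{-alg}}(A,\mathrm{Mat}_n(B))$ on commutative $k$-algebras. A point of $\mathrm{Rep}^n_A(k)$ is identified with the corresponding $A$-module structure $M$ on $k^n$, and $\mathrm{End}_k(M)$ is then an $A^e$-module (an $A$-bimodule). *)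

theory Defs
  imports
    "HOL-Analysis.Analysis"
    "HOL-Algebra.Module"
    "HOL-Algebra.QuotRing"
    "HOL-Algebra.Ideal_Product"
    "HOL-Library.Poly_Mapping"
    "HOL-Library.Function_Algebras"
begin

section \<open>Algebras over a field\<close>

text \<open>
  The ground field is a type \<open>'k\<close>, a \<open>'k\<close>-algebra is a type \<open>'a\<close> together with its scalar
  multiplication. The sort \<open>{ring, monoid_mult}\<close> means associative and unital; unlike \<open>ring_1\<close>
  it does not exclude the zero ring.
\<close>

locale k_algebra = vector_space sc
  for sc :: "'k::field \<Rightarrow> 'a::{ring,monoid_mult} \<Rightarrow> 'a" +
  assumes scale_mult_left: "sc c a * b = sc c (a * b)"
    and scale_mult_right: "a * sc c b = sc c (a * b)"

inductive_set generated_subalgebra ::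
  "('k \<Rightarrow> 'a::{ring,monoid_mult} \<Rightarrow> 'a) \<Rightarrow> 'a set \<Rightarrow> 'a set"
  for sc :: "'k \<Rightarrow> 'a \<Rightarrow> 'a" and S :: "'a set" where
  gen: "a \<in> S \<Longrightarrow> a \<in> generated_subalgebra sc S"
| one: "1 \<in> generated_subalgebra sc S"
| add: "\<lbrakk>a \<in> generated_subalgebra sc S; b \<in> generated_subalgebra sc S\<rbrakk>
          \<Longrightarrow> a + b \<in> generated_subalgebra sc S"
| mult: "\<lbrakk>a \<in> generated_subalgebra sc S; b \<in> generated_subalgebra sc S\<rbrakk>
          \<Longrightarrow> a * b \<in> generated_subalgebra sc S"
| scalar: "a \<in> generated_subalgebra sc S \<Longrightarrow> sc c a \<in> generated_subalgebra sc S"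

definition finitely_generated_algebra :: "('k \<Rightarrow> 'a::{ring,monoid_mult} \<Rightarrow> 'a) \<Rightarrow> bool" where
  "finitely_generated_algebra sc \<longleftrightarrow>
     (\<exists>S. finite S \<and> generated_subalgebra sc S = UNIV)"

text \<open>The linear extension of \<open>f\<close> to the vector space \<open>'x \<Rightarrow>\<^sub>0 'k\<close> with basis \<open>'x\<close>.\<close>

definition lin_ext :: "('k::zero \<Rightarrow> 'v::comm_monoid_add \<Rightarrow> 'v) \<Rightarrow> ('x \<Rightarrow> 'v) \<Rightarrow> ('x \<Rightarrow>\<^sub>0 'k) \<Rightarrow> 'v" where
  "lin_ext sc f p = (\<Sum>x\<in>Poly_Mapping.keys p. sc (Poly_Mapping.lookup p x) (f x))"

abbreviation pm_scale :: "'k::field \<Rightarrow> ('x \<Rightarrow>\<^sub>0 'k) \<Rightarrow> ('x \<Rightarrow>\<^sub>0 'k)" where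
  "pm_scale c \<equiv> Poly_Mapping.map ((*) c)"


section \<open>Left modules over a not necessarily commutative ring\<close>

text \<open>
  Modules are \<open>module\<close> records of HOL-Algebra; the fields \<open>mult\<close> and \<open>one\<close> of such a record are
  irrelevant.
\<close>

locale left_module = R?: ring R + M?: abelian_group M
  for R :: "('r, 's) ring_scheme" (structure) and M :: "('r, 'm, 't) module_scheme" (structure) +
  assumes smult_closed:
      "\<lbrakk>a \<in> carrier R; x \<in> carrier M\<rbrakk> \<Longrightarrow> a \<odot>\<^bsub>M\<^esub> x \<in> carrier M"
    and smult_l_distr:
      "\<lbrakk>a \<in> carrier R; b \<in> carrier R; x \<in> carrier M\<rbrakk> \<Longrightarrow>
         (a \<oplus>\<^bsub>R\<^esub> b) \<odot>\<^bsub>M\<^esub> x = a \<odot>\<^bsub>M\<^esub> x \<oplus>\<^bsub>M\<^esub> b \<odot>\<^bsub>M\<^esub> x"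
    and smult_r_distr:
      "\<lbrakk>a \<in> carrier R; x \<in> carrier M; y \<in> carrier M\<rbrakk> \<Longrightarrow>
         a \<odot>\<^bsub>M\<^esub> (x \<oplus>\<^bsub>M\<^esub> y) = a \<odot>\<^bsub>M\<^esub> x \<oplus>\<^bsub>M\<^esub> a \<odot>\<^bsub>M\<^esub> y"
    and smult_assoc:
      "\<lbrakk>a \<in> carrier R; b \<in> carrier R; x \<in> carrier M\<rbrakk> \<Longrightarrow>
         (a \<otimes>\<^bsub>R\<^esub> b) \<odot>\<^bsub>M\<^esub> x = a \<odot>\<^bsub>M\<^esub> (b \<odot>\<^bsub>M\<^esub> x)"
    and smult_one:
      "x \<in> carrier M \<Longrightarrow> \<one>\<^bsub>R\<^esub> \<odot>\<^bsub>M\<^esub> x = x"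

text \<open>
  A homomorphism is represented by the function that is zero outside the carrier, so that each
  homomorphism has exactly one representative and these are closed under pointwise operations.
\<close>

definition lmod_hom ::
  "('r, 's) ring_scheme \<Rightarrow> ('r, 'm, 't) module_scheme \<Rightarrow> ('r, 'n, 'u) module_scheme
     \<Rightarrow> ('m \<Rightarrow> 'n) set" where
  "lmod_hom R M N =
     {f. f \<in> carrier M \<rightarrow> carrier N \<and>
         (\<forall>x\<in>carrier M. \<forall>y\<in>carrier M. f (x \<oplus>\<^bsub>M\<^esub> y) = f x \<oplus>\<^bsub>N\<^esub> f y) \<and>
         (\<forall>a\<in>carrier R. \<forall>x\<in>carrier M. f (a \<odot>\<^bsub>M\<^esub> x) = a \<odot>\<^bsub>N\<^esub> f x) \<and>
         (\<forall>x. x \<notin> carrier M \<longrightarrow> f x = \<zero>\<^bsub>N\<^esub>)}"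

definition lmod_iso ::
  "('r, 's) ring_scheme \<Rightarrow> ('r, 'm, 't) module_scheme \<Rightarrow> ('r, 'n, 'u) module_scheme \<Rightarrow> bool" where
  "lmod_iso R M N \<longleftrightarrow> (\<exists>f\<in>lmod_hom R M N. bij_betw f (carrier M) (carrier N))"

definition regular_lmod :: "('r, 's) ring_scheme \<Rightarrow> ('r, 'r) module" where
  "regular_lmod R =
     \<lparr>carrier = carrier R, monoid.mult = undefined, one = undefined,
      ring.zero = \<zero>\<^bsub>R\<^esub>, add = add R, smult = monoid.mult R\<rparr>"

definition free_lmod :: "('r, 's) ring_scheme \<Rightarrow> 'x set \<Rightarrow> ('r, 'x \<Rightarrow> 'r) module" where
  "free_lmod R Y =
     \<lparr>carrier = {f. (\<forall>x\<in>Y. f x \<in> carrier R) \<and> (\<forall>x. x \<notin> Y \<longrightarrow> f x = \<zero>\<^bsub>R\<^esub>) \<and>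
                    finite {x. f x \<noteq> \<zero>\<^bsub>R\<^esub>}},
      monoid.mult = undefined, one = undefined,
      ring.zero = (\<lambda>x. \<zero>\<^bsub>R\<^esub>), add = (\<lambda>f g x. f x \<oplus>\<^bsub>R\<^esub> g x),
      smult = (\<lambda>a f x. a \<otimes>\<^bsub>R\<^esub> f x)\<rparr>"

text \<open>
  Projective means direct summand of a free module. Basis sets contained in the type of the
  module suffice, because a projective module is a summand of the free module on its own
  underlying set.
\<close>

definition projective_lmod :: "('r, 's) ring_scheme \<Rightarrow> ('r, 'm, 't) module_scheme \<Rightarrow> bool" where
  "projective_lmod R P \<longleftrightarrow> left_module R P \<and>
     (\<exists>Y :: 'm set. \<exists>i\<in>lmod_hom R P (free_lmod R Y). \<exists>p\<in>lmod_hom R (free_lmod R Y) P.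
        \<forall>x\<in>carrier P. p (i x) = x)"

definition fin_gen_lmod :: "('r, 's) ring_scheme \<Rightarrow> ('r, 'm, 't) module_scheme \<Rightarrow> bool" where
  "fin_gen_lmod R M \<longleftrightarrow>
     (\<exists>S. finite S \<and> S \<subseteq> carrier M \<and>
        (\<forall>x\<in>carrier M. \<exists>c\<in>S \<rightarrow> carrier R. x = (\<Oplus>\<^bsub>M\<^esub>s\<in>S. c s \<odot>\<^bsub>M\<^esub> s)))"

text \<open>
  \<open>\<dots> \<rightarrow> F 2 \<rightarrow> F 1 \<rightarrow> F 0 \<rightarrow> M \<rightarrow> 0\<close> exact, with differentials
  \<open>d i : F (Suc i) \<rightarrow> F i\<close> and augmentation \<open>e : F 0 \<rightarrow> M\<close>.
\<close>

definition fg_projective_resolution ::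
  "('r, 's) ring_scheme \<Rightarrow> ('r, 'm, 't) module_scheme \<Rightarrow> (nat \<Rightarrow> ('r, 'f, 'u) module_scheme)
     \<Rightarrow> (nat \<Rightarrow> 'f \<Rightarrow> 'f) \<Rightarrow> ('f \<Rightarrow> 'm) \<Rightarrow> bool" where
  "fg_projective_resolution R M F d e \<longleftrightarrow>
     (\<forall>i. projective_lmod R (F i) \<and> fin_gen_lmod R (F i)) \<and>
     (\<forall>i. d i \<in> lmod_hom R (F (Suc i)) (F i)) \<and>
     e \<in> lmod_hom R (F 0) M \<and>
     e ` carrier (F 0) = carrier M \<and>
     {x \<in> carrier (F 0). e x = \<zero>\<^bsub>M\<^esub>} = d 0 ` carrier (F 1) \<and>
     (\<forall>i. {x \<in> carrier (F (Suc i)). d i x = \<zero>\<^bsub>F i\<^esub>} = d (Suc i) ` carrier (F (Suc (Suc i))))"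

definition finite_length :: "(nat \<Rightarrow> ('r, 'f, 'u) module_scheme) \<Rightarrow> bool" where
  "finite_length F \<longleftrightarrow> (\<exists>N. \<forall>i>N. carrier (F i) = {\<zero>\<^bsub>F i\<^esub>})"

definition quot_lmod ::
  "('r, 'm, 't) module_scheme \<Rightarrow> 'm set \<Rightarrow> 'm set \<Rightarrow> ('r, 'm set) module" where
  "quot_lmod M Z B =
     \<lparr>carrier = (\<lambda>x. B +>\<^bsub>M\<^esub> x) ` Z,
      monoid.mult = undefined, one = undefined,
      ring.zero = B, add = set_add M,
      smult = (\<lambda>a Y. \<Union>x\<in>Y. B +>\<^bsub>M\<^esub> (a \<odot>\<^bsub>M\<^esub> x))\<rparr>"


section \<open>The enveloping algebra\<close>

text \<open>
  \<open>A \<otimes> A\<^sup>o\<^sup>p\<close> is the quotient of the vector space with basis \<open>A \<times> A\<close>, with the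
  multiplication \<open>(a, b) (c, d) = (a c, d b)\<close>, by the span of the bilinearity relations.
\<close>

definition pure :: "'a \<Rightarrow> 'b \<Rightarrow> ('a \<times> 'b \<Rightarrow>\<^sub>0 'k::field)" where
  "pure a b = Poly_Mapping.single (a, b) 1"

definition pre_env :: "('a::{ring,monoid_mult} \<times> 'a \<Rightarrow>\<^sub>0 'k::field) ring" where
  "pre_env =
     \<lparr>carrier = UNIV,
      monoid.mult = (\<lambda>p q. lin_ext pm_scale
                (\<lambda>(a, b). lin_ext pm_scale (\<lambda>(c, d). pure (a * c) (d * b)) q) p),
      one = pure 1 1, ring.zero = 0, add = (+)\<rparr>"

definition bilin_relations ::
  "('k::field \<Rightarrow> 'a::{ring,monoid_mult} \<Rightarrow> 'a) \<Rightarrow> ('a \<times> 'a \<Rightarrow>\<^sub>0 'k) set" where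
  "bilin_relations sc = Modules.module.span pm_scale
     ({pure (a + a') b - pure a b - pure a' b | a a' b. True} \<union>
      {pure a (b + b') - pure a b - pure a b' | a b b'. True} \<union>
      {pure (sc c a) b - pm_scale c (pure a b) | c a b. True} \<union>
      {pure a (sc c b) - pm_scale c (pure a b) | c a b. True})"

definition env_alg ::
  "('k::field \<Rightarrow> 'a::{ring,monoid_mult} \<Rightarrow> 'a) \<Rightarrow> ('a \<times> 'a \<Rightarrow>\<^sub>0 'k) set ring" where
  "env_alg sc = pre_env Quot bilin_relations sc"

text \<open>
  The anti-automorphism \<open>a \<otimes> b \<mapsto> b \<otimes> a\<close>, which turns right modules over the
  enveloping algebra into left ones.
\<close>

definition env_flip :: "('a \<times> 'a \<Rightarrow>\<^sub>0 'k::field) set \<Rightarrow> ('a \<times> 'a \<Rightarrow>\<^sub>0 'k) set" where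
  "env_flip Y = Poly_Mapping.map_key prod.swap ` Y"

text \<open>
  A bimodule as a left module over the enveloping algebra, \<open>(a \<otimes> b) \<cdot> x = a x b\<close>, where
  \<open>act a x b\<close> stands for \<open>a x b\<close>. The value does not depend on the representative \<open>p\<close> of the
  coset \<open>t\<close>.
\<close>

definition bimod ::
  "('k::field \<Rightarrow> 'v::ab_group_add \<Rightarrow> 'v) \<Rightarrow> ('a \<Rightarrow> 'v \<Rightarrow> 'a \<Rightarrow> 'v)
     \<Rightarrow> (('a \<times> 'a \<Rightarrow>\<^sub>0 'k) set, 'v) module" where
  "bimod sc act =
     \<lparr>carrier = UNIV, monoid.mult = undefined, one = undefined, ring.zero = 0, add = (+),
      smult = (\<lambda>t x. let p = (SOME p. p \<in> t) in lin_ext sc (\<lambda>(a, b). act a x b) p)\<rparr>"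

definition diagonal_bimod ::
  "('k::field \<Rightarrow> 'a::{ring,monoid_mult} \<Rightarrow> 'a) \<Rightarrow> (('a \<times> 'a \<Rightarrow>\<^sub>0 'k) set, 'a) module" where
  "diagonal_bimod sc = bimod sc (\<lambda>a x b. a * x * b)"


section \<open>Homological smoothness and the Calabi-Yau property\<close>

text \<open>
  A finitely generated projective module is isomorphic to a submodule of a free module with
  finite basis, hence every finitely generated projective resolution is isomorphic to one
  whose modules live in the type \<open>nat \<Rightarrow> 'r\<close>, where \<open>'r\<close> is the type of the ring.
\<close>

definition homologically_smooth :: "('k::field \<Rightarrow> 'a::{ring,monoid_mult} \<Rightarrow> 'a) \<Rightarrow> bool" where
  "homologically_smooth sc \<longleftrightarrow>
     (\<exists>(P :: nat \<Rightarrow> (('a \<times> 'a \<Rightarrow>\<^sub>0 'k) set, nat \<Rightarrow> ('a \<times> 'a \<Rightarrow>\<^sub>0 'k) set) module) d e.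
        fg_projective_resolution (env_alg sc) (diagonal_bimod sc) P d e \<and> finite_length P)"

text \<open>
  \<open>Hom(P, A\<^sup>e)\<close> for a left module \<open>P\<close>; its module structure comes from the right multiplication
  of \<open>A\<^sup>e\<close> on itself.
\<close>

definition hom_env ::
  "('k::field \<Rightarrow> 'a::{ring,monoid_mult} \<Rightarrow> 'a) \<Rightarrow> (('a \<times> 'a \<Rightarrow>\<^sub>0 'k) set, 'f, 'u) module_scheme
     \<Rightarrow> (('a \<times> 'a \<Rightarrow>\<^sub>0 'k) set, 'f \<Rightarrow> ('a \<times> 'a \<Rightarrow>\<^sub>0 'k) set) module" where
  "hom_env sc P =
     (let E = env_alg sc in
     \<lparr>carrier = lmod_hom E P (regular_lmod E),
      monoid.mult = undefined, one = undefined,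
      ring.zero = (\<lambda>x. \<zero>\<^bsub>E\<^esub>), add = (\<lambda>f g x. f x \<oplus>\<^bsub>E\<^esub> g x),
      smult = (\<lambda>t f x. f x \<otimes>\<^bsub>E\<^esub> env_flip t)\<rparr>)"

text \<open>
  \<open>Ext\<^sup>i(A, A\<^sup>e)\<close> as the \<open>i\<close>-th cohomology of \<open>Hom(P, A\<^sup>e)\<close>, computed from the projective
  resolution \<open>P\<close> of \<open>A\<close> with differential \<open>d\<close>.
\<close>

definition cocycles ::
  "('k::field \<Rightarrow> 'a::{ring,monoid_mult} \<Rightarrow> 'a)
     \<Rightarrow> (nat \<Rightarrow> (('a \<times> 'a \<Rightarrow>\<^sub>0 'k) set, 'f, 'u) module_scheme) \<Rightarrow> (nat \<Rightarrow> 'f \<Rightarrow> 'f) \<Rightarrow> nat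
     \<Rightarrow> ('f \<Rightarrow> ('a \<times> 'a \<Rightarrow>\<^sub>0 'k) set) set" where
  "cocycles sc P d i =
     {f \<in> carrier (hom_env sc (P i)). \<forall>x\<in>carrier (P (Suc i)). f (d i x) = \<zero>\<^bsub>env_alg sc\<^esub>}"

definition coboundaries ::
  "('k::field \<Rightarrow> 'a::{ring,monoid_mult} \<Rightarrow> 'a)
     \<Rightarrow> (nat \<Rightarrow> (('a \<times> 'a \<Rightarrow>\<^sub>0 'k) set, 'f, 'u) module_scheme) \<Rightarrow> (nat \<Rightarrow> 'f \<Rightarrow> 'f) \<Rightarrow> nat
     \<Rightarrow> ('f \<Rightarrow> ('a \<times> 'a \<Rightarrow>\<^sub>0 'k) set) set" where
  "coboundaries sc P d i =
     (case i of 0 \<Rightarrow> {\<lambda>x. \<zero>\<^bsub>env_alg sc\<^esub>}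
      | Suc j \<Rightarrow> (\<lambda>f x. f (d j x)) ` carrier (hom_env sc (P j)))"

definition Ext_env ::
  "('k::field \<Rightarrow> 'a::{ring,monoid_mult} \<Rightarrow> 'a)
     \<Rightarrow> (nat \<Rightarrow> (('a \<times> 'a \<Rightarrow>\<^sub>0 'k) set, 'f, 'u) module_scheme) \<Rightarrow> (nat \<Rightarrow> 'f \<Rightarrow> 'f) \<Rightarrow> nat
     \<Rightarrow> (('a \<times> 'a \<Rightarrow>\<^sub>0 'k) set, ('f \<Rightarrow> ('a \<times> 'a \<Rightarrow>\<^sub>0 'k) set) set) module" where
  "Ext_env sc P d i =
     quot_lmod (hom_env sc (P i)) (cocycles sc P d i) (coboundaries sc P d i)"

text \<open>
  \<open>Ext\<close> does not depend on the projective resolution up to isomorphism of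
  \<open>A\<^sup>e\<close>-modules, so it makes no difference which one is used to compute it.
\<close>

definition calabi_yau_2 :: "('k::field \<Rightarrow> 'a::{ring,monoid_mult} \<Rightarrow> 'a) \<Rightarrow> bool" where
  "calabi_yau_2 sc \<longleftrightarrow>
     homologically_smooth sc \<and>
     (\<exists>(P :: nat \<Rightarrow> (('a \<times> 'a \<Rightarrow>\<^sub>0 'k) set, nat \<Rightarrow> ('a \<times> 'a \<Rightarrow>\<^sub>0 'k) set) module) d e.
        fg_projective_resolution (env_alg sc) (diagonal_bimod sc) P d e \<and>
        lmod_iso (env_alg sc) (Ext_env sc P d 2) (diagonal_bimod sc) \<and>
        (\<forall>i. i \<noteq> 2 \<longrightarrow> carrier (Ext_env sc P d i) = {\<zero>\<^bsub>Ext_env sc P d i\<^esub>}))"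


section \<open>Representation schemes\<close>

definition mat_scale :: "('k \<Rightarrow> 'b \<Rightarrow> 'b) \<Rightarrow> 'k \<Rightarrow> 'b^'n^'n \<Rightarrow> 'b^'n^'n" where
  "mat_scale t c Y = (\<chi> i j. t c (Y $ i $ j))"

text \<open>
  The functor of points \<open>B \<mapsto> Hom(A, Mat\<^sub>n(B))\<close>, where \<open>n = CARD('n)\<close> and \<open>t\<close> is the scalar
  multiplication of \<open>B\<close>. The \<open>'k\<close>-points are those for \<open>t = (*)\<close>.
\<close>

definition rep_points ::
  "('k::field \<Rightarrow> 'a::{ring,monoid_mult} \<Rightarrow> 'a) \<Rightarrow> ('k \<Rightarrow> 'b::comm_ring_1 \<Rightarrow> 'b)
     \<Rightarrow> ('a \<Rightarrow> 'b^'n::finite^'n) set" where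
  "rep_points sc t =
     {M. (\<forall>a b. M (a + b) = M a + M b) \<and>
         (\<forall>c a. M (sc c a) = mat_scale t c (M a)) \<and>
         (\<forall>a b. M (a * b) = M a ** M b) \<and>
         M 1 = mat 1}"

text \<open>
  The coordinate ring: polynomials in the matrix entries \<open>entry a i j\<close> of the universal
  representation, modulo the relations that make \<open>a \<mapsto> (entry a i j)\<^sub>i\<^sub>j\<close> an algebra
  homomorphism.
\<close>

type_synonym ('a, 'n, 'k) rep_poly = "(('a \<times> 'n \<times> 'n) \<Rightarrow>\<^sub>0 nat) \<Rightarrow>\<^sub>0 'k"

definition entry :: "'a \<Rightarrow> 'n \<Rightarrow> 'n \<Rightarrow> ('a, 'n, 'k::field) rep_poly" where
  "entry a i j = Poly_Mapping.single (Poly_Mapping.single (a, i, j) 1) 1"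

definition const_poly :: "'k \<Rightarrow> ('a, 'n, 'k::field) rep_poly" where
  "const_poly c = Poly_Mapping.single 0 c"

definition rep_poly_ring :: "('a, 'n, 'k::field) rep_poly ring" where
  "rep_poly_ring =
     \<lparr>carrier = UNIV, monoid.mult = (*), one = 1, ring.zero = 0, add = (+)\<rparr>"

definition rep_ideal ::
  "('k::field \<Rightarrow> 'a::{ring,monoid_mult} \<Rightarrow> 'a) \<Rightarrow> ('a, 'n::finite, 'k) rep_poly set" where
  "rep_ideal sc = Idl\<^bsub>rep_poly_ring\<^esub>
     ({entry (a + b) i j - entry a i j - entry b i j | a b i j. True} \<union>
      {entry (sc c a) i j - const_poly c * entry a i j | c a i j. True} \<union>
      {entry (a * b) i j - (\<Sum>l\<in>UNIV. entry a i l * entry b l j) | a b i j. True} \<union>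
      {entry 1 i j - (if i = j then 1 else 0) | i j. True})"

definition coord_ring ::
  "('k::field \<Rightarrow> 'a::{ring,monoid_mult} \<Rightarrow> 'a) \<Rightarrow> ('a, 'n::finite, 'k) rep_poly set ring" where
  "coord_ring sc = rep_poly_ring Quot rep_ideal sc"

definition eval_poly ::
  "('k::field \<Rightarrow> 'b::comm_ring_1 \<Rightarrow> 'b) \<Rightarrow> ('a \<Rightarrow> 'b^'n^'n) \<Rightarrow> ('a, 'n, 'k) rep_poly \<Rightarrow> 'b" where
  "eval_poly t M p =
     lin_ext t (\<lambda>m. \<Prod>v\<in>Poly_Mapping.keys m.
                  (case v of (a, i, j) \<Rightarrow> M a $ i $ j) ^ Poly_Mapping.lookup m v) p"

text \<open>The value at a point \<open>M\<close> is the same for all representatives of the coset \<open>f\<close>.\<close>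

definition eval_at ::
  "('k::field \<Rightarrow> 'b::comm_ring_1 \<Rightarrow> 'b) \<Rightarrow> ('a \<Rightarrow> 'b^'n^'n) \<Rightarrow> ('a, 'n, 'k) rep_poly set \<Rightarrow> 'b" where
  "eval_at t M f = eval_poly t M (SOME p. p \<in> f)"

definition rep_topology ::
  "('k::field \<Rightarrow> 'a::{ring,monoid_mult} \<Rightarrow> 'a) \<Rightarrow> ('a \<Rightarrow> 'k^'n::finite^'n) topology" where
  "rep_topology sc = topology_generated_by
     ((\<lambda>f. {M \<in> rep_points sc (*). eval_at (*) M f \<noteq> 0}) ` carrier (coord_ring sc))"

definition max_ideal_at ::
  "('k::field \<Rightarrow> 'a::{ring,monoid_mult} \<Rightarrow> 'a) \<Rightarrow> ('a \<Rightarrow> 'k^'n::finite^'n)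
     \<Rightarrow> ('a, 'n, 'k) rep_poly set set" where
  "max_ideal_at sc M = {f \<in> carrier (coord_ring sc). eval_at (*) M f = 0}"

text \<open>
  The Zariski tangent space, dual of \<open>m/m\<^sup>2\<close>: linear forms on \<open>m\<close> that vanish on \<open>m\<^sup>2\<close>,
  extended by zero outside \<open>m\<close>.
\<close>

definition tangent_space ::
  "('k::field \<Rightarrow> 'a::{ring,monoid_mult} \<Rightarrow> 'a) \<Rightarrow> ('a \<Rightarrow> 'k^'n::finite^'n)
     \<Rightarrow> (('a, 'n, 'k) rep_poly set \<Rightarrow> 'k) set" where
  "tangent_space sc M =
     (let R = coord_ring sc; m = max_ideal_at sc M in
      {\<phi>. (\<forall>f\<in>m. \<forall>g\<in>m. \<phi> (f \<oplus>\<^bsub>R\<^esub> g) = \<phi> f + \<phi> g) \<and>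
          (\<forall>c. \<forall>f\<in>m. \<phi> ((rep_ideal sc +>\<^bsub>rep_poly_ring\<^esub> const_poly c) \<otimes>\<^bsub>R\<^esub> f) = c * \<phi> f) \<and>
          (\<forall>f\<in>ideal_prod R m m. \<phi> f = 0) \<and>
          (\<forall>f. f \<notin> m \<longrightarrow> \<phi> f = 0)})"

definition tangent_dim ::
  "('k::field \<Rightarrow> 'a::{ring,monoid_mult} \<Rightarrow> 'a) \<Rightarrow> ('a \<Rightarrow> 'k^'n::finite^'n) \<Rightarrow> nat" where
  "tangent_dim sc M = vector_space.dim (\<lambda>c \<phi> f. c * \<phi> f) (tangent_space sc M)"


section \<open>The bimodule \<open>End\<^sub>k(M)\<close> and endomorphisms\<close>

definition End_bimod ::
  "('a \<Rightarrow> 'k::field^'n::finite^'n) \<Rightarrow> (('a \<times> 'a \<Rightarrow>\<^sub>0 'k) set, 'k^'n^'n) module" where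
  "End_bimod M = bimod (mat_scale (*)) (\<lambda>a Y b. M a ** Y ** M b)"

definition hom_End_dim ::
  "('k::field \<Rightarrow> 'a::{ring,monoid_mult} \<Rightarrow> 'a) \<Rightarrow> (('a \<times> 'a \<Rightarrow>\<^sub>0 'k) set, 'f, 'u) module_scheme
     \<Rightarrow> ('a \<Rightarrow> 'k^'n::finite^'n) \<Rightarrow> nat" where
  "hom_End_dim sc P M =
     vector_space.dim (\<lambda>c \<phi> x. mat_scale (*) c (\<phi> x)) (lmod_hom (env_alg sc) P (End_bimod M))"

definition End_dim :: "('a \<Rightarrow> 'k::field^'n::finite^'n) \<Rightarrow> nat" where
  "End_dim M = vector_space.dim (mat_scale (*)) {Y. \<forall>a. Y ** M a = M a ** Y}"


section \<open>Topological notions\<close>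

definition locally_constant :: "'x topology \<Rightarrow> ('x \<Rightarrow> 'y) \<Rightarrow> bool" where
  "locally_constant T f \<longleftrightarrow>
     (\<forall>x\<in>topspace T. \<exists>U. openin T U \<and> x \<in> U \<and> (\<forall>y\<in>U. f y = f x))"

definition irreducible_in :: "'x topology \<Rightarrow> 'x set \<Rightarrow> bool" where
  "irreducible_in T S \<longleftrightarrow> S \<subseteq> topspace T \<and> S \<noteq> {} \<and>
     (\<forall>C D. closedin T C \<and> closedin T D \<and> S \<subseteq> C \<union> D \<longrightarrow> S \<subseteq> C \<or> S \<subseteq> D)"

definition irreducible_component :: "'x topology \<Rightarrow> 'x set \<Rightarrow> bool" where
  "irreducible_component T S \<longleftrightarrow>
     irreducible_in T S \<and> (\<forall>S'. irreducible_in T S' \<and> S \<subseteq> S' \<longrightarrow> S' = S)"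

end

theory Submission
  imports Defs
begin

text \<open>
  For a point \<open>M\<close> of the representation scheme let \<open>V = End(M)\<close>, and let \<open>P\<close> be a resolution of
  \<open>A\<close> by finitely generated projective bimodules. The proof shows that
  \<open>dim T\<^sub>M = n\<^sup>2 - \<chi> + dim End\<^sub>A(M)\<close>, where \<open>\<chi>\<close> is constant on every irreducible set of points.
  So on an irreducible component the dimension of the tangent space is a translate of
  \<open>dim End\<^sub>A(M)\<close>.

  The tangent space consists of the derivations \<open>A \<rightarrow> V\<close> (\<open>tangent_dim_eq_derivations\<close>): a
  derivation \<open>D\<close> is the same as a representation \<open>M + \<epsilon> D\<close> over the dual numbers. Schanuel's lemma,
  applied to the syzygies of \<open>A\<close> for the multiplication \<open>A \<otimes> A\<^sup>o\<^sup>p \<rightarrow> A\<close> and for \<open>P 0 \<rightarrow> A\<close>, gives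
  \<open>dim Der(A, V) + c\<^sub>0 = z\<^sub>1 + n\<^sup>2\<close> (\<open>dim_derivations\<close>), with \<open>c\<^sub>i\<close> and \<open>z\<^sub>i\<close> the dimensions of the
  \<open>i\<close>-cochains \<open>Hom(P i, V)\<close> and of the \<open>i\<close>-cocycles. By rank-nullity \<open>c\<^sub>1 = z\<^sub>1 + b\<^sub>2\<close>,
  with \<open>b\<^sub>2\<close> the dimension of the two-coboundaries.

  The Calabi-Yau property enters twice. First, \<open>Ext\<^sup>i(A, A\<^sup>e) = 0\<close> for \<open>i > 2\<close> and homological
  smoothness together imply that the second syzygy of \<open>P\<close> is projective
  (\<open>calabi_yau_2_resolution\<close>): the projection onto a projective syzygy is a cocycle, and if it is a
  coboundary, then the preceding syzygy is a direct summand too. Hence two-cocycles are the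
  homomorphisms from a projective module, and \<open>H\<^sup>2\<close> is right exact in the coefficients.
  Secondly, \<open>Ext\<^sup>2(A, A\<^sup>e)\<close> is isomorphic to \<open>A\<close>, so \<open>H\<^sup>2(V)\<close> is \<open>V\<close> modulo commutators
  with \<open>A\<close> (\<open>second_cohomology\<close>). The trace form makes this quotient dual to
  \<open>End\<^sub>A(M)\<close> (\<open>coinvariants_dual\<close>), whence \<open>z\<^sub>2 = b\<^sub>2 + dim End\<^sub>A(M)\<close>. Adding up,
  \<open>\<chi> = c\<^sub>0 - c\<^sub>1 + z\<^sub>2\<close> (\<open>dimension_formula\<close>).

  Finally, \<open>c\<^sub>0\<close>, \<open>c\<^sub>1\<close> and \<open>z\<^sub>2\<close> are dimensions of spaces of homomorphisms from finitely generated
  projective bimodules to \<open>V\<close>. In characteristic zero such a dimension equals the trace of an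
  idempotent, and this trace is a polynomial in the traces of the operators \<open>M a\<close>. It is thus a
  regular function of \<open>M\<close> with finitely many values, hence constant on irreducible sets
  (\<open>bounded_regular_function_constant\<close>). The same principle, that a dimension is a trace
  (\<open>dim_eq_frame_trace\<close>), also serves as the linear algebra for spaces of functions, whose ambient
  spaces are infinite-dimensional.
\<close>

section \<open>Dimensions as traces\<close>

definition finite_dimensional :: "('k::field \<Rightarrow> 'v::ab_group_add \<Rightarrow> 'v) \<Rightarrow> 'v set \<Rightarrow> bool" where
  "finite_dimensional s W \<longleftrightarrow> (\<exists>S. finite S \<and> W \<subseteq> module.span s S)"

text \<open>
  A spanning family together with coordinate functionals. The vectors may be linearly dependent;
  unlike bases, such families pass to kernels and images by composition with linear maps, and they
  suffice to compute the dimension as a trace.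
\<close>

definition frame :: "('k::field \<Rightarrow> 'v::ab_group_add \<Rightarrow> 'v) \<Rightarrow> 'v set \<Rightarrow> 'i set \<Rightarrow> ('i \<Rightarrow> 'v)
    \<Rightarrow> ('i \<Rightarrow> 'v \<Rightarrow> 'k) \<Rightarrow> bool" where
  "frame s W I w \<phi> \<longleftrightarrow> finite I \<and> module.subspace s W \<and>
     (\<forall>l\<in>I. w l \<in> W \<and> Vector_Spaces.linear s (*) (\<phi> l)) \<and>
     (\<forall>x\<in>W. x = (\<Sum>l\<in>I. s (\<phi> l x) (w l)))"

context
  fixes s :: "'k::field \<Rightarrow> 'v::ab_group_add \<Rightarrow> 'v"
  assumes vs: "vector_space s"
begin

interpretation V: vector_space s by (fact vs)
interpretation K: vector_space "(*) :: 'k \<Rightarrow> 'k \<Rightarrow> 'k"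
  by unfold_locales (auto simp: algebra_simps)
interpretation VK: vector_space_pair s "(*) :: 'k \<Rightarrow> 'k \<Rightarrow> 'k" ..

lemma finite_dimensional_subset:
  "finite_dimensional s W \<Longrightarrow> U \<subseteq> W \<Longrightarrow> finite_dimensional s U"
  unfolding finite_dimensional_def by blast

lemma frame_expand:
  "frame s W I w \<phi> \<Longrightarrow> x \<in> W \<Longrightarrow> (\<Sum>l\<in>I. s (\<phi> l x) (w l)) = x"
  unfolding frame_def by metis

lemma frame_mem: "frame s W I w \<phi> \<Longrightarrow> l \<in> I \<Longrightarrow> w l \<in> W"
  unfolding frame_def by blast

lemma frame_linear: "frame s W I w \<phi> \<Longrightarrow> l \<in> I \<Longrightarrow> Vector_Spaces.linear s (*) (\<phi> l)"
  unfolding frame_def by blast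

lemma frame_finite: "frame s W I w \<phi> \<Longrightarrow> finite I"
  unfolding frame_def by blast

lemma frame_subset_span:
  assumes "frame s W I w \<phi>"
  shows "W \<subseteq> V.span (w ` I)"
proof
  fix x assume "x \<in> W"
  have "(\<Sum>l\<in>I. s (\<phi> l x) (w l)) \<in> V.span (w ` I)"
    by (intro V.span_sum V.span_scale V.span_base) simp
  then show "x \<in> V.span (w ` I)"
    by (simp only: frame_expand[OF assms \<open>x \<in> W\<close>])
qed

lemma frame_finite_dimensional:
  assumes "frame s W I w \<phi>"
  shows "finite_dimensional s W"
  unfolding finite_dimensional_def
  using frame_subset_span[OF assms] frame_finite[OF assms] by blast

lemma frame_dim_le:
  assumes "frame s W I w \<phi>"
  shows "V.dim W \<le> card I"
proof -
  have "V.dim W \<le> card (w ` I)"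
    using frame_subset_span[OF assms] frame_finite[OF assms] by (intro V.dim_le_card) simp_all
  also have "\<dots> \<le> card I" using frame_finite[OF assms] by (intro card_image_le)
  finally show ?thesis .
qed

lemma linear_functional_simps:
  assumes "Vector_Spaces.linear s (*) f"
  shows "f (x + y) = f x + f y" "f (s c x) = c * f x" "f 0 = 0" "f (x - y) = f x - f y"
    "f (sum h A) = (\<Sum>a\<in>A. f (h a))"
proof -
  interpret Vector_Spaces.linear s "(*)" f by fact
  show "f (x + y) = f x + f y" "f (s c x) = c * f x" "f 0 = 0" "f (x - y) = f x - f y"
    "f (sum h A) = (\<Sum>a\<in>A. f (h a))"
    by (simp_all add: add scale zero diff sum)
qed

lemma frame_of_basis:
  assumes W: "V.subspace W" and B: "B \<subseteq> W" "V.independent B" "W \<subseteq> V.span B" "finite B"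
  shows "\<exists>\<phi>. frame s W B (\<lambda>b. b) \<phi> \<and> (\<forall>b\<in>B. \<forall>b'\<in>B. \<phi> b b' = (if b = b' then 1 else 0))"
proof -
  have "\<exists>g. Vector_Spaces.linear s (*) g \<and> (\<forall>x\<in>B. g x = (if b = x then 1 else 0))" for b
    by (rule VK.linear_independent_extend[OF B(2)])
  then obtain \<phi> where \<phi>: "\<And>b. Vector_Spaces.linear s (*) (\<phi> b)"
    "\<And>b x. x \<in> B \<Longrightarrow> \<phi> b x = (if b = x then 1 else 0)"
    by metis
  have "x = (\<Sum>l\<in>B. s (\<phi> l x) l)" if "x \<in> W" for x
  proof -
    obtain u where u: "x = (\<Sum>v\<in>B. s (u v) v)"
      using B \<open>x \<in> W\<close> V.span_finite[OF B(4)] by auto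
    have "\<phi> l x = u l" if "l \<in> B" for l
    proof -
      have "\<phi> l x = (\<Sum>v\<in>B. u v * \<phi> l v)"
        by (simp add: u linear_functional_simps[OF \<phi>(1)])
      also have "\<dots> = (\<Sum>v\<in>B. if v = l then u l else 0)"
        by (rule sum.cong) (auto simp: \<phi>(2))
      finally show ?thesis using B(4) that by simp
    qed
    then show ?thesis by (subst u) (auto intro: sum.cong)
  qed
  then have "frame s W B (\<lambda>b. b) \<phi>"
    using \<phi> B W by (auto simp: frame_def)
  then show ?thesis using \<phi> by auto
qed

lemma finite_dimensional_basis:
  assumes "finite_dimensional s W"
  obtains B where "B \<subseteq> W" "V.independent B" "W \<subseteq> V.span B" "finite B" "card B = V.dim W"
proof -
  obtain S where S: "finite S" "W \<subseteq> V.span S" using assms by (auto simp: finite_dimensional_def)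
  obtain B where B: "B \<subseteq> W" "V.independent B" "W \<subseteq> V.span B" "card B = V.dim W"
    by (rule V.basis_exists)
  have "finite B" using V.independent_span_bound[OF S(1) B(2)] B(1) S(2) by auto
  then show ?thesis using B that by auto
qed

text \<open>
  The sum is the trace of the identity of \<open>W\<close>. Independence of the frame is seen by expanding
  the frame vectors in a basis of \<open>W\<close> and exchanging the two summations.
\<close>

lemma dim_eq_frame_trace:
  assumes fr: "frame s W I w \<phi>"
  shows "of_nat (V.dim W) = (\<Sum>l\<in>I. \<phi> l (w l))"
proof -
  obtain B where B: "B \<subseteq> W" "V.independent B" "W \<subseteq> V.span B" "finite B" "card B = V.dim W"
    using finite_dimensional_basis[OF frame_finite_dimensional[OF fr]] by blast
  have W: "V.subspace W" using fr by (simp add: frame_def)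
  obtain \<psi> where \<psi>: "frame s W B (\<lambda>b. b) \<psi>"
    "\<And>b b'. b \<in> B \<Longrightarrow> b' \<in> B \<Longrightarrow> \<psi> b b' = (if b = b' then 1 else 0)"
    using frame_of_basis[OF W B(1,2,3,4)] by blast
  note lin = frame_linear[OF fr] frame_mem[OF fr]
  note lin' = frame_linear[OF \<psi>(1)]
  have "\<phi> l (w l) = (\<Sum>b\<in>B. \<psi> b (w l) * \<phi> l b)" if "l \<in> I" for l
  proof -
    have "w l = (\<Sum>b\<in>B. s (\<psi> b (w l)) b)"
      using frame_expand[OF \<psi>(1) lin(2)[OF that]] by simp
    then have "\<phi> l (w l) = \<phi> l (\<Sum>b\<in>B. s (\<psi> b (w l)) b)" by simp
    then show ?thesis by (simp add: linear_functional_simps[OF lin(1)[OF that]])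
  qed
  then have "(\<Sum>l\<in>I. \<phi> l (w l)) = (\<Sum>l\<in>I. \<Sum>b\<in>B. \<psi> b (w l) * \<phi> l b)"
    by simp
  also have "\<dots> = (\<Sum>b\<in>B. \<Sum>l\<in>I. \<phi> l b * \<psi> b (w l))"
    by (subst sum.swap) (simp add: mult.commute)
  also have "\<dots> = (\<Sum>b\<in>B. 1)"
  proof (rule sum.cong)
    fix b assume b: "b \<in> B"
    then have "b = (\<Sum>l\<in>I. s (\<phi> l b) (w l))"
      using frame_expand[OF fr, of b] B(1) by auto
    then have "\<psi> b b = \<psi> b (\<Sum>l\<in>I. s (\<phi> l b) (w l))" by simp
    then show "(\<Sum>l\<in>I. \<phi> l b * \<psi> b (w l)) = 1"
      using \<psi>(2)[OF b b] by (simp add: linear_functional_simps[OF lin'[OF b]])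
  qed simp
  also have "\<dots> = of_nat (card B)" by simp
  finally show ?thesis using B(5) by simp
qed

lemma frame_exists:
  assumes "finite_dimensional s W" "V.subspace W"
  shows "\<exists>I (w::'v \<Rightarrow> 'v) \<phi>. frame s W I w \<phi>"
proof -
  obtain B where B: "B \<subseteq> W" "V.independent B" "W \<subseteq> V.span B" "finite B" "card B = V.dim W"
    using finite_dimensional_basis[OF assms(1)] by blast
  show ?thesis using frame_of_basis[OF assms(2) B(1,2,3,4)] by blast
qed

lemma separating_functional:
  assumes "V.subspace C" "v \<notin> C"
  shows "\<exists>f. Vector_Spaces.linear s (*) f \<and> (\<forall>x\<in>C. f x = 0) \<and> f v = 1"
proof -
  obtain B where B: "B \<subseteq> C" "V.independent B" "C \<subseteq> V.span B"
    by (rule V.basis_exists[of C])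
  have "V.span B = C" using B assms(1) by (meson V.span_subspace)
  then have v: "v \<notin> V.span B" using assms(2) by simp
  then have "V.independent (insert v B)" using B(2) by (simp add: V.independent_insert)
  then obtain f where f: "Vector_Spaces.linear s (*) f" "\<forall>x\<in>insert v B. f x = (if x = v then 1
      else 0)"
    using VK.linear_independent_extend[of "insert v B" "\<lambda>x. if x = v then 1 else 0"] by blast
  have "f x = 0" if "x \<in> C" for x
  proof -
    have *: "f x = 0" if "x \<in> B" for x using f(2) v that V.span_base by (metis insertI2)
    have x: "x \<in> V.span B" using that B(3) by blast
    show "f x = 0"
      using x
    proof (induction rule: V.span_induct_alt)
      case base then show ?case using linear_functional_simps(3)[OF f(1)] by simp
    next
      case (step c x y) then show ?case using * by (simp add: linear_functional_simps[OF f(1)])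
    qed
  qed
  then show ?thesis using f by (intro exI[of _ f]) auto
qed

end

text \<open>
  With a linear section \<open>g\<close> of \<open>f\<close> over the image, a frame of \<open>W\<close> induces one of the kernel and
  one of the image, and the two traces add up to the trace for \<open>W\<close>.
\<close>

lemma rank_nullity:
  fixes s1 :: "'k::field_char_0 \<Rightarrow> 'v::ab_group_add \<Rightarrow> 'v"
    and s2 :: "'k \<Rightarrow> 'w::ab_group_add \<Rightarrow> 'w"
  assumes f: "Vector_Spaces.linear s1 s2 f"
    and W: "module.subspace s1 W" "finite_dimensional s1 W"
  shows "vector_space.dim s1 W =
      vector_space.dim s1 {x \<in> W. f x = 0} + vector_space.dim s2 (f ` W)"
    and "finite_dimensional s2 (f ` W)"
proof -
  have vs1: "vector_space s1" and vs2: "vector_space s2"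
    using f by (auto simp: Vector_Spaces.linear_iff)
  interpret V1: vector_space s1 by fact
  interpret V2: vector_space s2 by fact
  interpret f: Vector_Spaces.linear s1 s2 f by fact
  interpret vector_space_pair s1 s2 by unfold_locales
  obtain I and w :: "'v \<Rightarrow> 'v" and \<phi> where fr: "frame s1 W I w \<phi>"
    using frame_exists[OF vs1 W(2,1)] by blast
  obtain g where g: "g ` UNIV \<subseteq> W" "Vector_Spaces.linear s2 s1 g" "\<And>v. v \<in> f ` W \<Longrightarrow> f (g v) = v"
    using linear_exists_right_inverse_on[OF f W(1)] by blast
  interpret g: Vector_Spaces.linear s2 s1 g by fact
  note lin = frame_linear[OF vs1 fr] frame_mem[OF vs1 fr]
  note expand = frame_expand[OF vs1 fr, symmetric]
  have sub: "V1.subspace {x \<in> W. f x = 0}"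
    using W(1) by (auto simp: V1.subspace_def f.add f.scale f.zero)
  have fgf: "f (g (f x)) = f x" if "x \<in> W" for x using g(3) that by blast
  have ker: "frame s1 {x \<in> W. f x = 0} I (\<lambda>l. w l - g (f (w l))) \<phi>"
    unfolding frame_def
  proof (intro conjI ballI)
    show "finite I" using fr by (simp add: frame_def)
    show "V1.subspace {x \<in> W. f x = 0}" by (fact sub)
    fix l assume l: "l \<in> I"
    show "w l - g (f (w l)) \<in> {x \<in> W. f x = 0}"
      using lin(2)[OF l] fgf[OF lin(2)[OF l]] g(1) W(1) by (auto simp: f.diff intro!:
          V1.subspace_diff)
    show "Vector_Spaces.linear s1 (*) (\<phi> l)" by (rule lin(1)[OF l])
  next
    fix x assume x: "x \<in> {x \<in> W. f x = 0}"
    have "x = x - g (f x)" using x by (simp add: g.zero)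
    also have "\<dots> = (\<Sum>l\<in>I. s1 (\<phi> l x) (w l)) - g (f (\<Sum>l\<in>I. s1 (\<phi> l x) (w l)))"
      using expand[of x] x by auto
    also have "\<dots> = (\<Sum>l\<in>I. s1 (\<phi> l x) (w l - g (f (w l))))"
      by (simp add: f.sum g.sum f.scale g.scale V1.scale_right_diff_distrib sum_subtractf)
    finally show "x = (\<Sum>l\<in>I. s1 (\<phi> l x) (w l - g (f (w l))))" .
  qed
  have img: "frame s2 (f ` W) I (\<lambda>l. f (w l)) (\<lambda>l y. \<phi> l (g y))"
    unfolding frame_def
  proof (intro conjI ballI)
    show "finite I" using fr by (simp add: frame_def)
    show "V2.subspace (f ` W)" using W(1) by (rule f.subspace_image)
    fix l assume l: "l \<in> I"
    show "f (w l) \<in> f ` W" using lin(2)[OF l] by simp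
    show "Vector_Spaces.linear s2 (*) (\<lambda>y. \<phi> l (g y))"
      using Vector_Spaces.linear_compose[OF g(2) lin(1)[OF l]] by (simp add: comp_def)
  next
    fix y assume y: "y \<in> f ` W"
    have "y = f (g y)" using g(3)[OF y] by simp
    also have "\<dots> = f (\<Sum>l\<in>I. s1 (\<phi> l (g y)) (w l))"
      using arg_cong[where f = f, OF expand[of "g y"]] g(1) by blast
    also have "\<dots> = (\<Sum>l\<in>I. s2 (\<phi> l (g y)) (f (w l)))"
      by (simp add: f.sum f.scale)
    finally show "y = (\<Sum>l\<in>I. s2 (\<phi> l (g y)) (f (w l)))" .
  qed
  show "finite_dimensional s2 (f ` W)" by (rule frame_finite_dimensional[OF vs2 img])
  have "(of_nat (V1.dim W) :: 'k) = (\<Sum>l\<in>I. \<phi> l (w l))"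
    by (rule dim_eq_frame_trace[OF vs1 fr])
  also have "\<dots> = (\<Sum>l\<in>I. \<phi> l (w l - g (f (w l))) + \<phi> l (g (f (w l))))"
    by (rule sum.cong) (auto simp: linear_functional_simps[OF vs1 lin(1)])
  also have "\<dots> = of_nat (V1.dim {x \<in> W. f x = 0} + V2.dim (f ` W))"
    by (simp add: dim_eq_frame_trace[OF vs1 ker] dim_eq_frame_trace[OF vs2 img] sum.distrib)
  finally show "V1.dim W = V1.dim {x \<in> W. f x = 0} + V2.dim (f ` W)"
    using of_nat_eq_iff by blast
qed

section \<open>Homomorphisms of modules and dual bases\<close>

lemma lmod_homI:
  assumes "\<And>x. x \<in> carrier M \<Longrightarrow> f x \<in> carrier N"
    and "\<And>x y. x \<in> carrier M \<Longrightarrow> y \<in> carrier M \<Longrightarrow> f (x \<oplus>\<^bsub>M\<^esub> y) = f x \<oplus>\<^bsub>N\<^esub> f y"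
    and "\<And>a x. a \<in> carrier R \<Longrightarrow> x \<in> carrier M \<Longrightarrow> f (a \<odot>\<^bsub>M\<^esub> x) = a \<odot>\<^bsub>N\<^esub> f x"
    and "\<And>x. x \<notin> carrier M \<Longrightarrow> f x = \<zero>\<^bsub>N\<^esub>"
  shows "f \<in> lmod_hom R M N"
  using assms by (auto simp: lmod_hom_def)

lemma lmod_homD:
  assumes "f \<in> lmod_hom R M N"
  shows "x \<in> carrier M \<Longrightarrow> f x \<in> carrier N"
    and "x \<in> carrier M \<Longrightarrow> y \<in> carrier M \<Longrightarrow> f (x \<oplus>\<^bsub>M\<^esub> y) = f x \<oplus>\<^bsub>N\<^esub> f y"
    and "a \<in> carrier R \<Longrightarrow> x \<in> carrier M \<Longrightarrow> f (a \<odot>\<^bsub>M\<^esub> x) = a \<odot>\<^bsub>N\<^esub> f x"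
    and "x \<notin> carrier M \<Longrightarrow> f x = \<zero>\<^bsub>N\<^esub>"
  using assms by (auto simp: lmod_hom_def)

lemma left_module_is_group: "left_module R M \<Longrightarrow> abelian_group M"
  by (simp add: left_module_def)

lemma lmod_hom_range:
  assumes "left_module R N" "f \<in> lmod_hom R M N"
  shows "f x \<in> carrier N"
proof -
  interpret N: abelian_group N using assms(1) by (rule left_module_is_group)
  show ?thesis using lmod_homD(1,4)[OF assms(2)] by (cases "x \<in> carrier M") auto
qed

context left_module
begin

lemma smult_zero_left: "x \<in> carrier M \<Longrightarrow> \<zero>\<^bsub>R\<^esub> \<odot>\<^bsub>M\<^esub> x = \<zero>\<^bsub>M\<^esub>"
proof -
  assume x: "x \<in> carrier M"
  have c: "\<zero>\<^bsub>R\<^esub> \<odot>\<^bsub>M\<^esub> x \<in> carrier M" using x by (simp add: smult_closed)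
  have "\<zero>\<^bsub>R\<^esub> \<odot>\<^bsub>M\<^esub> x = \<zero>\<^bsub>R\<^esub> \<odot>\<^bsub>M\<^esub> x \<oplus>\<^bsub>M\<^esub> \<zero>\<^bsub>R\<^esub> \<odot>\<^bsub>M\<^esub> x"
    using smult_l_distr[of "\<zero>\<^bsub>R\<^esub>" "\<zero>\<^bsub>R\<^esub>" x] x by simp
  then show ?thesis using c by (metis M.add.r_cancel_one')
qed

lemma smult_zero_right: "a \<in> carrier R \<Longrightarrow> a \<odot>\<^bsub>M\<^esub> \<zero>\<^bsub>M\<^esub> = \<zero>\<^bsub>M\<^esub>"
proof -
  assume a: "a \<in> carrier R"
  have c: "a \<odot>\<^bsub>M\<^esub> \<zero>\<^bsub>M\<^esub> \<in> carrier M" using a by (simp add: smult_closed)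
  have "a \<odot>\<^bsub>M\<^esub> \<zero>\<^bsub>M\<^esub> = a \<odot>\<^bsub>M\<^esub> \<zero>\<^bsub>M\<^esub> \<oplus>\<^bsub>M\<^esub> a \<odot>\<^bsub>M\<^esub> \<zero>\<^bsub>M\<^esub>"
    using smult_r_distr[of a "\<zero>\<^bsub>M\<^esub>" "\<zero>\<^bsub>M\<^esub>"] a by simp
  then show ?thesis using c by (metis M.add.r_cancel_one')
qed

lemma smult_neg: "a \<in> carrier R \<Longrightarrow> x \<in> carrier M \<Longrightarrow> a \<odot>\<^bsub>M\<^esub> (\<ominus>\<^bsub>M\<^esub> x) = \<ominus>\<^bsub>M\<^esub> (a \<odot>\<^bsub>M\<^esub> x)"
proof -
  assume a: "a \<in> carrier R" and x: "x \<in> carrier M"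
  have "a \<odot>\<^bsub>M\<^esub> (\<ominus>\<^bsub>M\<^esub> x) \<oplus>\<^bsub>M\<^esub> a \<odot>\<^bsub>M\<^esub> x = \<zero>\<^bsub>M\<^esub>"
    using smult_r_distr[of a "\<ominus>\<^bsub>M\<^esub> x" x] a x by (simp add: M.l_neg smult_zero_right)
  then show ?thesis using a x by (simp add: M.minus_equality smult_closed)
qed

end

lemma lmod_hom_zero:
  assumes "left_module R M" "left_module R N" "f \<in> lmod_hom R M N"
  shows "f \<zero>\<^bsub>M\<^esub> = \<zero>\<^bsub>N\<^esub>"
proof -
  interpret M: abelian_group M using assms(1) by (rule left_module_is_group)
  interpret N: abelian_group N using assms(2) by (rule left_module_is_group)
  have "f \<zero>\<^bsub>M\<^esub> = f \<zero>\<^bsub>M\<^esub> \<oplus>\<^bsub>N\<^esub> f \<zero>\<^bsub>M\<^esub>"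
    using lmod_homD(2)[OF assms(3), of "\<zero>\<^bsub>M\<^esub>" "\<zero>\<^bsub>M\<^esub>"] by simp
  moreover have "f \<zero>\<^bsub>M\<^esub> \<in> carrier N" using lmod_homD(1)[OF assms(3)] by simp
  ultimately show ?thesis by (metis N.add.r_cancel_one')
qed

lemma lmod_hom_neg_arg:
  assumes "left_module R M" "left_module R N" "f \<in> lmod_hom R M N" "x \<in> carrier M"
  shows "f (\<ominus>\<^bsub>M\<^esub> x) = \<ominus>\<^bsub>N\<^esub> f x"
proof -
  interpret M: abelian_group M using assms(1) by (rule left_module_is_group)
  interpret N: abelian_group N using assms(2) by (rule left_module_is_group)
  have "f (\<ominus>\<^bsub>M\<^esub> x) \<oplus>\<^bsub>N\<^esub> f x = \<zero>\<^bsub>N\<^esub>"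
    using lmod_homD(2)[OF assms(3), of "\<ominus>\<^bsub>M\<^esub> x" x] assms(4)
    by (simp add: M.l_neg lmod_hom_zero[OF assms(1,2,3)])
  then show ?thesis using assms(4) lmod_homD(1)[OF assms(3)] by (simp add: N.minus_equality)
qed

lemma lmod_hom_minus_arg:
  assumes "left_module R M" "left_module R N" "f \<in> lmod_hom R M N" "x \<in> carrier M" "y \<in> carrier M"
  shows "f (x \<ominus>\<^bsub>M\<^esub> y) = f x \<ominus>\<^bsub>N\<^esub> f y"
proof -
  interpret M: abelian_group M using assms(1) by (rule left_module_is_group)
  show ?thesis using assms lmod_homD(2)[OF assms(3), of x "\<ominus>\<^bsub>M\<^esub> y"]
    by (simp add: a_minus_def lmod_hom_neg_arg[OF assms(1,2,3)])
qed

lemma lmod_hom_add: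
  assumes "left_module R N" "f \<in> lmod_hom R M N" "g \<in> lmod_hom R M N"
  shows "(\<lambda>x. f x \<oplus>\<^bsub>N\<^esub> g x) \<in> lmod_hom R M N"
proof -
  interpret N: left_module R N by fact
  show ?thesis
    using assms(2,3)
    by (intro lmod_homI) (auto simp: lmod_hom_def Pi_def N.M.a_ac N.smult_r_distr)
qed

lemma lmod_hom_neg:
  assumes "left_module R N" "f \<in> lmod_hom R M N"
  shows "(\<lambda>x. \<ominus>\<^bsub>N\<^esub> f x) \<in> lmod_hom R M N"
proof -
  interpret N: left_module R N by fact
  show ?thesis
    using assms(2)
    by (intro lmod_homI) (auto simp: lmod_hom_def Pi_def N.M.minus_add N.smult_neg)
qed

lemma lmod_hom_minus:
  assumes "left_module R N" "f \<in> lmod_hom R M N" "g \<in> lmod_hom R M N"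
  shows "(\<lambda>x. f x \<ominus>\<^bsub>N\<^esub> g x) \<in> lmod_hom R M N"
  unfolding a_minus_def by (intro lmod_hom_add lmod_hom_neg assms)

lemma lmod_hom_comp:
  assumes "left_module R N" "left_module R L" "f \<in> lmod_hom R M N" "g \<in> lmod_hom R N L"
  shows "(\<lambda>x. g (f x)) \<in> lmod_hom R M L"
  by (rule lmod_homI)
     (simp_all add: lmod_homD[OF assms(3)] lmod_homD[OF assms(4)] lmod_hom_zero[OF assms(1,2,4)])

lemma lmod_hom_id:
  assumes "left_module R M"
  shows "(\<lambda>x. if x \<in> carrier M then x else \<zero>\<^bsub>M\<^esub>) \<in> lmod_hom R M M"
proof -
  interpret M: left_module R M by fact
  show ?thesis by (rule lmod_homI) (auto simp: M.smult_closed)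
qed

lemma lmod_hom_const_zero:
  assumes "left_module R N"
  shows "(\<lambda>x. \<zero>\<^bsub>N\<^esub>) \<in> lmod_hom R M N"
proof -
  interpret N: left_module R N by fact
  show ?thesis by (rule lmod_homI) (auto simp: N.smult_zero_right)
qed

lemma lmod_hom_finsum:
  assumes "left_module R N" "finite I" "\<And>i. i \<in> I \<Longrightarrow> g i \<in> lmod_hom R M N"
  shows "(\<lambda>x. \<Oplus>\<^bsub>N\<^esub>i\<in>I. g i x) \<in> lmod_hom R M N"
  using assms(2,3)
proof (induction I rule: finite_induct)
  interpret N: left_module R N by fact
  {
    case empty
    then show ?case using lmod_hom_const_zero[OF assms(1)] by simp
  next
    case (insert i I)
    have "(\<Oplus>\<^bsub>N\<^esub>j\<in>insert i I. g j x) = g i x \<oplus>\<^bsub>N\<^esub> (\<Oplus>\<^bsub>N\<^esub>j\<in>I. g j x)" for x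
      using insert.hyps lmod_hom_range[OF assms(1) insert.prems] by (intro N.M.finsum_insert) auto
    then show ?case using insert by (simp add: lmod_hom_add[OF assms(1)])
  }
qed

lemma lmod_hom_finsum_arg:
  assumes "left_module R M" "left_module R N" "f \<in> lmod_hom R M N" "finite I"
    and "\<And>i. i \<in> I \<Longrightarrow> x i \<in> carrier M"
  shows "f (\<Oplus>\<^bsub>M\<^esub>i\<in>I. x i) = (\<Oplus>\<^bsub>N\<^esub>i\<in>I. f (x i))"
  using assms(4,5)
proof (induction I rule: finite_induct)
  interpret M: left_module R M by fact
  interpret N: left_module R N by fact
  {
    case empty
    then show ?case using lmod_hom_zero[OF assms(1,2,3)] by simp
  next
    case (insert i I)
    have "(\<Oplus>\<^bsub>M\<^esub>j\<in>insert i I. x j) = x i \<oplus>\<^bsub>M\<^esub> (\<Oplus>\<^bsub>M\<^esub>j\<in>I. x j)"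
      using insert.hyps insert.prems by (intro M.M.finsum_insert) auto
    moreover have "(\<Oplus>\<^bsub>N\<^esub>j\<in>insert i I. f (x j)) = f (x i) \<oplus>\<^bsub>N\<^esub> (\<Oplus>\<^bsub>N\<^esub>j\<in>I. f (x j))"
      using insert.hyps insert.prems lmod_homD(1)[OF assms(3)] by (intro N.M.finsum_insert) auto
    moreover have "(\<Oplus>\<^bsub>M\<^esub>j\<in>I. x j) \<in> carrier M"
      using insert.prems by (intro M.M.finsum_closed) auto
    ultimately show ?case using insert by (simp add: lmod_homD[OF assms(3)])
  }
qed

lemma regular_lmod_simps [simp]:
  "carrier (regular_lmod R) = carrier R" "\<zero>\<^bsub>regular_lmod R\<^esub> = \<zero>\<^bsub>R\<^esub>"
  "x \<oplus>\<^bsub>regular_lmod R\<^esub> y = x \<oplus>\<^bsub>R\<^esub> y" "a \<odot>\<^bsub>regular_lmod R\<^esub> x = a \<otimes>\<^bsub>R\<^esub> x"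
  by (simp_all add: regular_lmod_def)

lemma regular_lmod_left_module:
  assumes "ring R"
  shows "left_module R (regular_lmod R)"
proof -
  interpret ring R by fact
  have "abelian_group (regular_lmod R)"
  proof (rule abelian_groupI)
    fix x assume "x \<in> carrier (regular_lmod R)"
    then show "\<exists>y\<in>carrier (regular_lmod R). y \<oplus>\<^bsub>regular_lmod R\<^esub> x = \<zero>\<^bsub>regular_lmod R\<^esub>"
      by (intro bexI[of _ "\<ominus>\<^bsub>R\<^esub> x"]) (auto simp: l_neg)
  qed (auto simp: a_ac)
  then show ?thesis
    using assms by (auto simp: left_module_def left_module_axioms_def m_assoc l_distr r_distr)
qed

lemma lmod_hom_smult_right:
  assumes "left_module R M" "m \<in> carrier M" "f \<in> lmod_hom R P (regular_lmod R)"
  shows "(\<lambda>x. f x \<odot>\<^bsub>M\<^esub> m) \<in> lmod_hom R P M"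
proof -
  interpret M: left_module R M by fact
  note f = lmod_homD[OF assms(3), simplified]
  show ?thesis
    by (rule lmod_homI)
      (use assms(2) in \<open>simp_all add: f M.smult_closed M.smult_l_distr M.smult_assoc
          M.smult_zero_left\<close>)
qed

text \<open>
  A finitely generated module is projective if and only if it has a dual basis: the elements \<open>b i\<close>
  generate, with coefficients that are given by linear forms \<open>f i\<close>.
\<close>

definition dual_basis ::
  "('r, 's) ring_scheme \<Rightarrow> ('r, 'm, 't) module_scheme \<Rightarrow> 'i set \<Rightarrow> ('i \<Rightarrow> 'm) \<Rightarrow> ('i \<Rightarrow> 'm \<Rightarrow> 'r) \<Rightarrow> bool"
  where
  "dual_basis R P I b f \<longleftrightarrow> left_module R P \<and> finite I \<and>
     (\<forall>i\<in>I. b i \<in> carrier P \<and> f i \<in> lmod_hom R P (regular_lmod R)) \<and>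
     (\<forall>x\<in>carrier P. (\<Oplus>\<^bsub>P\<^esub>i\<in>I. f i x \<odot>\<^bsub>P\<^esub> b i) = x)"

lemma dual_basisD:
  assumes "dual_basis R P I b f"
  shows "left_module R P" "finite I" "i \<in> I \<Longrightarrow> b i \<in> carrier P"
    "i \<in> I \<Longrightarrow> f i \<in> lmod_hom R P (regular_lmod R)"
    "x \<in> carrier P \<Longrightarrow> (\<Oplus>\<^bsub>P\<^esub>i\<in>I. f i x \<odot>\<^bsub>P\<^esub> b i) = x"
  using assms by (auto simp: dual_basis_def)

lemma dual_basis_hom:
  assumes "dual_basis R P I b f" "left_module R M" "\<And>i. i \<in> I \<Longrightarrow> m i \<in> carrier M"
  shows "(\<lambda>x. \<Oplus>\<^bsub>M\<^esub>i\<in>I. f i x \<odot>\<^bsub>M\<^esub> m i) \<in> lmod_hom R P M"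
  by (intro lmod_hom_finsum lmod_hom_smult_right assms dual_basisD[OF assms(1)])

lemma dual_basis_expand_hom:
  assumes "dual_basis R P I b f" "left_module R M" "\<phi> \<in> lmod_hom R P M" "x \<in> carrier P"
  shows "\<phi> x = (\<Oplus>\<^bsub>M\<^esub>i\<in>I. f i x \<odot>\<^bsub>M\<^esub> \<phi> (b i))"
proof -
  note D = dual_basisD[OF assms(1)]
  interpret P: left_module R P by (rule D(1))
  interpret M: left_module R M by fact
  have f: "f i x \<in> carrier R" if "i \<in> I" for i
    using lmod_homD(1)[OF D(4)[OF that] assms(4)] by simp
  have "\<phi> x = \<phi> (\<Oplus>\<^bsub>P\<^esub>i\<in>I. f i x \<odot>\<^bsub>P\<^esub> b i)" using D(5)[OF assms(4)] by simp
  also have "\<dots> = (\<Oplus>\<^bsub>M\<^esub>i\<in>I. \<phi> (f i x \<odot>\<^bsub>P\<^esub> b i))"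
    by (rule lmod_hom_finsum_arg[OF D(1) assms(2,3) D(2)]) (simp add: P.smult_closed f D(3))
  also have "\<dots> = (\<Oplus>\<^bsub>M\<^esub>i\<in>I. f i x \<odot>\<^bsub>M\<^esub> \<phi> (b i))"
    by (rule M.M.finsum_cong')
       (auto simp: lmod_homD[OF assms(3)] f D(3) M.smult_closed)
  finally show ?thesis .
qed

text \<open>The lifting property: choose preimages of the images of the basis vectors.\<close>

lemma projective_lift:
  assumes "dual_basis R P I b f" "left_module R M" "left_module R N"
    and \<phi>: "\<phi> \<in> lmod_hom R P N" and g: "g \<in> lmod_hom R M N"
    and sub: "\<And>x. x \<in> carrier P \<Longrightarrow> \<phi> x \<in> g ` carrier M"
  shows "\<exists>\<psi>\<in>lmod_hom R P M. \<forall>x\<in>carrier P. g (\<psi> x) = \<phi> x"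
proof -
  note D = dual_basisD[OF assms(1)]
  interpret M: left_module R M by fact
  interpret N: left_module R N by fact
  have "\<forall>i\<in>I. \<exists>m\<in>carrier M. g m = \<phi> (b i)" using sub D(3) by (metis image_iff)
  then obtain m where m: "\<And>i. i \<in> I \<Longrightarrow> m i \<in> carrier M" "\<And>i. i \<in> I \<Longrightarrow> g (m i) = \<phi> (b i)"
    by metis
  have f: "f i x \<in> carrier R" if "i \<in> I" "x \<in> carrier P" for i x
    using lmod_homD(1)[OF D(4)[OF that(1)] that(2)] by simp
  let ?\<psi> = "\<lambda>x. \<Oplus>\<^bsub>M\<^esub>i\<in>I. f i x \<odot>\<^bsub>M\<^esub> m i"
  have "g (?\<psi> x) = \<phi> x" if x: "x \<in> carrier P" for x
  proof -
    have "g (?\<psi> x) = (\<Oplus>\<^bsub>N\<^esub>i\<in>I. g (f i x \<odot>\<^bsub>M\<^esub> m i))"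
      by (rule lmod_hom_finsum_arg[OF assms(2,3) g D(2)]) (simp add: M.smult_closed f m x)
    also have "\<dots> = (\<Oplus>\<^bsub>N\<^esub>i\<in>I. f i x \<odot>\<^bsub>N\<^esub> \<phi> (b i))"
      by (rule N.M.finsum_cong')
         (auto simp: lmod_homD[OF g] lmod_homD[OF \<phi>] f m D(3) x N.smult_closed)
    also have "\<dots> = \<phi> x" by (rule dual_basis_expand_hom[OF assms(1,3) \<phi> x, symmetric])
    finally show ?thesis .
  qed
  then show ?thesis by (intro bexI[OF _ dual_basis_hom[OF assms(1,2) m(1)]] ballI)
qed

text \<open>
  A finitely generated summand of a free module meets only finitely many of the coordinates, and
  those coordinate functions together with the images of the basis vectors form a dual basis.
\<close>

lemma dual_basis_exists:
  assumes "projective_lmod R P" "fin_gen_lmod R P"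
  shows "\<exists>(I :: 'm set) (b :: 'm \<Rightarrow> 'm) f. dual_basis R (P :: ('r, 'm, 't) module_scheme) I b f"
proof -
  from assms(1) obtain Y :: "'m set" and i p where P: "left_module R P"
    and i: "i \<in> lmod_hom R P (free_lmod R Y)" and p: "p \<in> lmod_hom R (free_lmod R Y) P"
    and pi: "\<And>x. x \<in> carrier P \<Longrightarrow> p (i x) = x"
    by (auto simp: projective_lmod_def)
  from assms(2) obtain S where S: "finite S" "S \<subseteq> carrier P"
    and gen: "\<And>x. x \<in> carrier P \<Longrightarrow> \<exists>c\<in>S \<rightarrow> carrier R. x = (\<Oplus>\<^bsub>P\<^esub>s\<in>S. c s \<odot>\<^bsub>P\<^esub> s)"
    by (auto simp: fin_gen_lmod_def)
  interpret P: left_module R P by fact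
  let ?F = "free_lmod R Y"
  have Fs: "x \<oplus>\<^bsub>?F\<^esub> y = (\<lambda>t. x t \<oplus>\<^bsub>R\<^esub> y t)" "a \<odot>\<^bsub>?F\<^esub> x = (\<lambda>t. a \<otimes>\<^bsub>R\<^esub> x t)"
    "\<zero>\<^bsub>?F\<^esub> = (\<lambda>t. \<zero>\<^bsub>R\<^esub>)" for x y a
    by (simp_all add: free_lmod_def)
  have Fc: "x \<in> carrier ?F \<longleftrightarrow> (\<forall>t\<in>Y. x t \<in> carrier R) \<and> (\<forall>t. t \<notin> Y \<longrightarrow> x t = \<zero>\<^bsub>R\<^esub>) \<and>
                    finite {t. x t \<noteq> \<zero>\<^bsub>R\<^esub>}" for x
    by (simp add: free_lmod_def)
  have Fr: "x t \<in> carrier R" if "x \<in> carrier ?F" for x t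
    using that by (cases "t \<in> Y") (auto simp: Fc)
  have f: "(\<lambda>x. i x t) \<in> lmod_hom R P (regular_lmod R)" for t
    by (rule lmod_homI) (simp_all add: lmod_homD[OF i] Fs Fr)
  define I where "I = (\<Union>s\<in>S. {t. i s t \<noteq> \<zero>\<^bsub>R\<^esub>})"
  have finI: "finite I" using S lmod_homD(1)[OF i] by (auto simp: I_def Fc)
  have IY: "I \<subseteq> Y" using S lmod_homD(1)[OF i] by (auto simp: I_def Fc)
  have supp: "i x t = \<zero>\<^bsub>R\<^esub>" if x: "x \<in> carrier P" and t: "t \<notin> I" for x t
  proof -
    obtain c where c: "c \<in> S \<rightarrow> carrier R" "x = (\<Oplus>\<^bsub>P\<^esub>s\<in>S. c s \<odot>\<^bsub>P\<^esub> s)" using gen[OF x] by blast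
    interpret RR: left_module R "regular_lmod R" by (rule regular_lmod_left_module) unfold_locales
    have "i x t = (\<Oplus>\<^bsub>regular_lmod R\<^esub>s\<in>S. i (c s \<odot>\<^bsub>P\<^esub> s) t)"
      unfolding c(2)
    proof (rule lmod_hom_finsum_arg[OF P RR.left_module_axioms f S(1)])
      show "c s \<odot>\<^bsub>P\<^esub> s \<in> carrier P" if "s \<in> S" for s
        using that c(1) S(2) by (intro P.smult_closed) auto
    qed
    also have "\<dots> = (\<Oplus>\<^bsub>regular_lmod R\<^esub>s\<in>S. \<zero>\<^bsub>regular_lmod R\<^esub>)"
    proof (rule RR.M.finsum_cong')
      fix s assume s: "s \<in> S"
      have "i s t = \<zero>\<^bsub>R\<^esub>" using s t by (auto simp: I_def)
      moreover have "c s \<in> carrier R" "s \<in> carrier P" using c(1) s S(2) by auto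
      ultimately show "i (c s \<odot>\<^bsub>P\<^esub> s) t = \<zero>\<^bsub>regular_lmod R\<^esub>"
        by (simp add: lmod_homD(3)[OF i] Fs)
    qed auto
    finally show ?thesis using RR.M.finsum_zero[of S] by simp
  qed
  define e where "e t = (\<lambda>u. if u = t then \<one>\<^bsub>R\<^esub> else \<zero>\<^bsub>R\<^esub>)" for t :: 'm
  have e: "e t \<in> carrier ?F" if "t \<in> I" for t
    using that IY by (auto simp: Fc e_def)
  have F_sum: "p (\<lambda>u. if u \<in> J then x u else \<zero>\<^bsub>R\<^esub>) = (\<Oplus>\<^bsub>P\<^esub>t\<in>J. x t \<odot>\<^bsub>P\<^esub> p (e t))"
    if "finite J" "J \<subseteq> I" "\<And>t. x t \<in> carrier R" for J x
    using that(1,2)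
  proof (induction J rule: finite_induct)
    case empty
    have "p (\<lambda>u. \<zero>\<^bsub>R\<^esub>) = \<zero>\<^bsub>R\<^esub> \<odot>\<^bsub>P\<^esub> p (\<lambda>u. \<zero>\<^bsub>R\<^esub>)"
      using lmod_homD(3)[OF p, of "\<zero>\<^bsub>R\<^esub>" "\<lambda>u. \<zero>\<^bsub>R\<^esub>"] by (simp add: Fs Fc)
    also have "\<dots> = \<zero>\<^bsub>P\<^esub>"
      by (rule P.smult_zero_left) (rule lmod_homD(1)[OF p], simp add: Fc)
    finally show ?case by simp
  next
    case (insert t J)
    let ?r = "\<lambda>u. if u \<in> J then x u else \<zero>\<^bsub>R\<^esub>"
    have r: "?r \<in> carrier ?F" using insert.hyps insert.prems IY that(3) by (auto simp: Fc)
    have xe: "x t \<odot>\<^bsub>?F\<^esub> e t \<in> carrier ?F"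
      using insert.prems IY that(3) by (auto simp: Fc Fs e_def)
    have eq: "(\<lambda>u. if u \<in> insert t J then x u else \<zero>\<^bsub>R\<^esub>) = (x t \<odot>\<^bsub>?F\<^esub> e t) \<oplus>\<^bsub>?F\<^esub> ?r"
      using insert.hyps that(3) by (auto simp: Fs e_def fun_eq_iff)
    have "p (\<lambda>u. if u \<in> insert t J then x u else \<zero>\<^bsub>R\<^esub>) = x t \<odot>\<^bsub>P\<^esub> p (e t) \<oplus>\<^bsub>P\<^esub> p ?r"
      unfolding eq lmod_homD(2)[OF p xe r] using insert.prems e that(3) by (simp add:
          lmod_homD(3)[OF p])
    also have "\<dots> = (\<Oplus>\<^bsub>P\<^esub>t\<in>insert t J. x t \<odot>\<^bsub>P\<^esub> p (e t))"
      using insert e that(3) lmod_homD(1)[OF p]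
      by (subst P.M.finsum_insert) (auto simp: P.smult_closed subset_iff)
    finally show ?case .
  qed
  have "dual_basis R P I (\<lambda>t. p (e t)) (\<lambda>t x. i x t)"
    unfolding dual_basis_def
  proof (intro conjI ballI)
    show "left_module R P" "finite I" by fact+
    show "p (e t) \<in> carrier P" if "t \<in> I" for t using lmod_homD(1)[OF p e[OF that]] .
    show "(\<lambda>x. i x t) \<in> lmod_hom R P (regular_lmod R)" for t by (rule f)
    fix x assume x: "x \<in> carrier P"
    have "i x = (\<lambda>u. if u \<in> I then i x u else \<zero>\<^bsub>R\<^esub>)" using supp[OF x] by auto
    then have "x = p (\<lambda>u. if u \<in> I then i x u else \<zero>\<^bsub>R\<^esub>)" using pi[OF x] by simp
    also have "\<dots> = (\<Oplus>\<^bsub>P\<^esub>t\<in>I. i x t \<odot>\<^bsub>P\<^esub> p (e t))"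
      by (rule F_sum[OF finI subset_refl]) (rule Fr[OF lmod_homD(1)[OF i x]])
    finally show "(\<Oplus>\<^bsub>P\<^esub>t\<in>I. i x t \<odot>\<^bsub>P\<^esub> p (e t)) = x" by simp
  qed
  then show ?thesis by blast
qed

section \<open>Comparison of projective resolutions\<close>

definition syzygy :: "(nat \<Rightarrow> ('r, 'f, 'u) module_scheme) \<Rightarrow> (nat \<Rightarrow> 'f \<Rightarrow> 'f) \<Rightarrow> nat \<Rightarrow> 'f set" where
  "syzygy P d i = d i ` carrier (P (Suc i))"

lemma resolutionD:
  assumes "fg_projective_resolution R M P d e"
  shows "left_module R (P i)" "\<exists>(I :: 'f set) (b :: 'f \<Rightarrow> 'f) f. dual_basis R (P i :: ('r, 'f, 'u)
      module_scheme) I b f"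
    "d i \<in> lmod_hom R (P (Suc i)) (P i)" "e \<in> lmod_hom R (P 0) M" "e ` carrier (P 0) = carrier M"
    "syzygy P d 0 = {x \<in> carrier (P 0). e x = \<zero>\<^bsub>M\<^esub>}"
    "syzygy P d (Suc i) = {x \<in> carrier (P (Suc i)). d i x = \<zero>\<^bsub>P i\<^esub>}"
  using assms dual_basis_exists[of R "P i"]
  by (auto simp: fg_projective_resolution_def projective_lmod_def syzygy_def)

lemma syzygy_closed:
  assumes "fg_projective_resolution R M P d e" "x \<in> syzygy P d i"
  shows "x \<in> carrier (P i)"
  using assms resolutionD(6,7)[OF assms(1)] by (cases i) auto

text \<open>
  The classical comparison: \<open>\<alpha>\<close> and \<open>\<beta>\<close> are components of chain maps over the identity of
  \<open>M\<close>, and \<open>h\<close> is a component of a homotopy between \<open>\<beta> \<alpha>\<close> and the identity. Only the effect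
  on the syzygies is recorded, because that is all that the next step of the induction needs.
\<close>

lemma resolution_comparison:
  fixes P :: "nat \<Rightarrow> ('r, 'f, 'u) module_scheme" and Q :: "nat \<Rightarrow> ('r, 'g, 'v) module_scheme"
  assumes M: "left_module R M"
    and P: "fg_projective_resolution R M P d e" and Q: "fg_projective_resolution R M Q \<delta> \<epsilon>"
  shows "\<exists>\<alpha>\<in>lmod_hom R (P i) (Q i). \<exists>\<beta>\<in>lmod_hom R (Q i) (P i). \<exists>h\<in>lmod_hom R (P i) (P (Suc i)).
      (\<forall>x\<in>syzygy P d i. \<alpha> x \<in> syzygy Q \<delta> i) \<and> (\<forall>x\<in>syzygy Q \<delta> i. \<beta> x \<in> syzygy P d i) \<and>
      (\<forall>x\<in>syzygy P d i. d i (h x) = \<beta> (\<alpha> x) \<ominus>\<^bsub>P i\<^esub> x)"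
proof (induction i)
  note PD = resolutionD[OF P] and QD = resolutionD[OF Q]
  have comp: "\<exists>h\<in>lmod_hom R (P i) (P (Suc i)). \<forall>x\<in>carrier (P i). d i (h x) = \<gamma> x"
    if "\<gamma> \<in> lmod_hom R (P i) (P i)" "\<And>x. x \<in> carrier (P i) \<Longrightarrow> \<gamma> x \<in> syzygy P d i" for i \<gamma>
  proof -
    obtain I and b :: "'f \<Rightarrow> 'f" and f where "dual_basis R (P i) I b f" using PD(2)[of i] by blast
    from projective_lift[OF this PD(1) PD(1) that(1) PD(3)] that(2)
    show ?thesis by (auto simp: syzygy_def)
  qed
  {
    case 0
    obtain I and b :: "'f \<Rightarrow> 'f" and f where pb: "dual_basis R (P 0) I b f" using PD(2)[of 0] by
        blast
    obtain J and c :: "'g \<Rightarrow> 'g" and k where qb: "dual_basis R (Q 0) J c k" using QD(2)[of 0] by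
        blast
    obtain \<alpha> where \<alpha>: "\<alpha> \<in> lmod_hom R (P 0) (Q 0)" "\<And>x. x \<in> carrier (P 0) \<Longrightarrow> \<epsilon> (\<alpha> x) = e x"
      using projective_lift[OF pb QD(1) M PD(4) QD(4)] QD(5) lmod_homD(1)[OF PD(4)] by auto
    obtain \<beta> where \<beta>: "\<beta> \<in> lmod_hom R (Q 0) (P 0)" "\<And>x. x \<in> carrier (Q 0) \<Longrightarrow> e (\<beta> x) = \<epsilon> x"
      using projective_lift[OF qb PD(1) M QD(4) PD(4)] PD(5) lmod_homD(1)[OF QD(4)] by auto
    interpret P0: left_module R "P 0" by (rule PD(1))
    interpret MM: left_module R M by (rule M)
    have \<gamma>: "(\<lambda>x. \<beta> (\<alpha> x) \<ominus>\<^bsub>P 0\<^esub> (if x \<in> carrier (P 0) then x else \<zero>\<^bsub>P 0\<^esub>)) \<in> lmod_hom R (P 0) (P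
        0)"
      by (intro lmod_hom_minus PD lmod_hom_comp[OF QD(1) PD(1) \<alpha>(1) \<beta>(1)] lmod_hom_id)
    have "\<exists>h\<in>lmod_hom R (P 0) (P (Suc 0)). \<forall>x\<in>carrier (P 0).
        d 0 (h x) = \<beta> (\<alpha> x) \<ominus>\<^bsub>P 0\<^esub> (if x \<in> carrier (P 0) then x else \<zero>\<^bsub>P 0\<^esub>)"
    proof (rule comp[OF \<gamma>])
      fix x assume x: "x \<in> carrier (P 0)"
      have a: "\<alpha> x \<in> carrier (Q 0)" "\<beta> (\<alpha> x) \<in> carrier (P 0)"
        using x lmod_homD(1)[OF \<alpha>(1)] lmod_homD(1)[OF \<beta>(1)] by auto
      have "e (\<beta> (\<alpha> x) \<ominus>\<^bsub>P 0\<^esub> x) = \<zero>\<^bsub>M\<^esub>"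
        using lmod_hom_minus_arg[OF PD(1) M PD(4) a(2) x] \<alpha>(2)[OF x] \<beta>(2)[OF a(1)]
          lmod_homD(1)[OF PD(4) x] by (simp add: MM.M.r_neg a_minus_def)
      then show "\<beta> (\<alpha> x) \<ominus>\<^bsub>P 0\<^esub> (if x \<in> carrier (P 0) then x else \<zero>\<^bsub>P 0\<^esub>) \<in> syzygy P d 0"
        using x a by (simp add: PD(6))
    qed
    then obtain h where h: "h \<in> lmod_hom R (P 0) (P (Suc 0))"
      "\<And>x. x \<in> carrier (P 0) \<Longrightarrow> d 0 (h x) = \<beta> (\<alpha> x) \<ominus>\<^bsub>P 0\<^esub> x" by auto
    show ?case
      by (rule bexI[OF _ \<alpha>(1)], rule bexI[OF _ \<beta>(1)], rule bexI[OF _ h(1)])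
         (use \<alpha>(2) \<beta>(2) h(2) lmod_homD(1)[OF \<alpha>(1)] lmod_homD(1)[OF \<beta>(1)] in \<open>simp add: PD(6) QD(6)\<close>)
  next
    case (Suc i)
    then obtain \<alpha> \<beta> h where \<alpha>: "\<alpha> \<in> lmod_hom R (P i) (Q i)" and \<beta>: "\<beta> \<in> lmod_hom R (Q i) (P i)"
      and h: "h \<in> lmod_hom R (P i) (P (Suc i))"
      and \<alpha>s: "\<And>x. x \<in> syzygy P d i \<Longrightarrow> \<alpha> x \<in> syzygy Q \<delta> i"
      and \<beta>s: "\<And>x. x \<in> syzygy Q \<delta> i \<Longrightarrow> \<beta> x \<in> syzygy P d i"
      and hs: "\<And>x. x \<in> syzygy P d i \<Longrightarrow> d i (h x) = \<beta> (\<alpha> x) \<ominus>\<^bsub>P i\<^esub> x" by blast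
    obtain I and b :: "'f \<Rightarrow> 'f" and f where pb: "dual_basis R (P (Suc i)) I b f" using PD(2) by
        blast
    obtain J and c :: "'g \<Rightarrow> 'g" and k where qb: "dual_basis R (Q (Suc i)) J c k" using QD(2) by
        blast
    have "\<exists>\<alpha>'\<in>lmod_hom R (P (Suc i)) (Q (Suc i)). \<forall>x\<in>carrier (P (Suc i)). \<delta> i (\<alpha>' x) = \<alpha> (d i x)"
      using \<alpha>s by (intro projective_lift[OF pb QD(1) QD(1) lmod_hom_comp[OF PD(1) QD(1) PD(3) \<alpha>]
          QD(3)])
        (auto simp: syzygy_def)
    then obtain \<alpha>' where \<alpha>': "\<alpha>' \<in> lmod_hom R (P (Suc i)) (Q (Suc i))"
      "\<And>x. x \<in> carrier (P (Suc i)) \<Longrightarrow> \<delta> i (\<alpha>' x) = \<alpha> (d i x)" by blast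
    have "\<exists>\<beta>'\<in>lmod_hom R (Q (Suc i)) (P (Suc i)). \<forall>x\<in>carrier (Q (Suc i)). d i (\<beta>' x) = \<beta> (\<delta> i x)"
      using \<beta>s by (intro projective_lift[OF qb PD(1) PD(1) lmod_hom_comp[OF QD(1) PD(1) QD(3) \<beta>]
          PD(3)])
        (auto simp: syzygy_def)
    then obtain \<beta>' where \<beta>': "\<beta>' \<in> lmod_hom R (Q (Suc i)) (P (Suc i))"
      "\<And>x. x \<in> carrier (Q (Suc i)) \<Longrightarrow> d i (\<beta>' x) = \<beta> (\<delta> i x)" by blast
    interpret Pi: left_module R "P i" by (rule PD(1))
    interpret PS: left_module R "P (Suc i)" by (rule PD(1))
    let ?\<gamma> = "\<lambda>x. (\<beta>' (\<alpha>' x) \<ominus>\<^bsub>P (Suc i)\<^esub> (if x \<in> carrier (P (Suc i)) then x else \<zero>\<^bsub>P (Suc i)\<^esub>))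
        \<ominus>\<^bsub>P (Suc i)\<^esub> h (d i x)"
    have \<gamma>: "?\<gamma> \<in> lmod_hom R (P (Suc i)) (P (Suc i))"
      by (intro lmod_hom_minus PD lmod_hom_comp[OF QD(1) PD(1) \<alpha>'(1) \<beta>'(1)] lmod_hom_id
          lmod_hom_comp[OF PD(1) PD(1) PD(3) h])
    have "\<exists>h'\<in>lmod_hom R (P (Suc i)) (P (Suc (Suc i))). \<forall>x\<in>carrier (P (Suc i)). d (Suc i) (h' x) =
        ?\<gamma> x"
    proof (rule comp[OF \<gamma>])
      fix x assume x: "x \<in> carrier (P (Suc i))"
      have a: "\<alpha>' x \<in> carrier (Q (Suc i))" "\<beta>' (\<alpha>' x) \<in> carrier (P (Suc i))" "d i x \<in> carrier (P i)"
        "h (d i x) \<in> carrier (P (Suc i))" "\<alpha> (d i x) \<in> carrier (Q i)" "\<beta> (\<alpha> (d i x)) \<in> carrier (P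
            i)"
        using x lmod_homD(1)[OF \<alpha>'(1)] lmod_homD(1)[OF \<beta>'(1)] lmod_homD(1)[OF PD(3)[of i]]
          lmod_homD(1)[OF h] lmod_homD(1)[OF \<alpha>] lmod_homD(1)[OF \<beta>] by auto
      have dx: "d i x \<in> syzygy P d i" using x by (auto simp: syzygy_def)
      have "d i (\<beta>' (\<alpha>' x) \<ominus>\<^bsub>P (Suc i)\<^esub> x \<ominus>\<^bsub>P (Suc i)\<^esub> h (d i x)) = \<zero>\<^bsub>P i\<^esub>"
        using a x lmod_homD(1)[OF PD(3)[of i] a(4)]
        by (simp add: lmod_hom_minus_arg[OF PD(1) PD(1) PD(3)] \<alpha>'(2) \<beta>'(2) hs[OF dx]
            PS.M.minus_closed) (simp add: a_minus_def Pi.M.r_neg)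
      then show "?\<gamma> x \<in> syzygy P d (Suc i)"
        using x a by (simp add: PD(7))
    qed
    then obtain h' where h': "h' \<in> lmod_hom R (P (Suc i)) (P (Suc (Suc i)))"
      "\<And>x. x \<in> carrier (P (Suc i)) \<Longrightarrow> d (Suc i) (h' x) = ?\<gamma> x" by blast
    have *: "d (Suc i) (h' x) = \<beta>' (\<alpha>' x) \<ominus>\<^bsub>P (Suc i)\<^esub> x" if "x \<in> syzygy P d (Suc i)" for x
    proof -
      have x: "x \<in> carrier (P (Suc i))" "d i x = \<zero>\<^bsub>P i\<^esub>" using that by (auto simp: PD(7))
      have "\<beta>' (\<alpha>' x) \<in> carrier (P (Suc i))"
        using x lmod_homD(1)[OF \<alpha>'(1)] lmod_homD(1)[OF \<beta>'(1)] by auto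
      then show ?thesis using x h'(2)[OF x(1)] by (simp add: lmod_hom_zero[OF PD(1) PD(1) h]
          a_minus_def)
    qed
    show ?case
      by (rule bexI[OF _ \<alpha>'(1)], rule bexI[OF _ \<beta>'(1)], rule bexI[OF _ h'(1)])
         (use \<alpha>'(2) \<beta>'(2) * lmod_homD(1)[OF \<alpha>'(1)] lmod_homD(1)[OF \<beta>'(1)]
           lmod_hom_zero[OF PD(1) QD(1) \<alpha>] lmod_hom_zero[OF QD(1) PD(1) \<beta>] in \<open>simp add: PD(7)
               QD(7)\<close>)
  }
qed

text \<open>The syzygy is a direct summand of the module \<open>P i\<close> in which it lies.\<close>

definition splits_at ::
  "('r, 's) ring_scheme \<Rightarrow> (nat \<Rightarrow> ('r, 'f, 'u) module_scheme) \<Rightarrow> (nat \<Rightarrow> 'f \<Rightarrow> 'f) \<Rightarrow> nat \<Rightarrow> bool" where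
  "splits_at R P d i \<longleftrightarrow> (\<exists>h\<in>lmod_hom R (P i) (P (Suc i)). \<forall>x\<in>syzygy P d i. d i (h x) = x)"

text \<open>
  If \<open>Q\<close> vanishes in degree \<open>i\<close>, then so does \<open>\<beta> \<alpha>\<close>, and the homotopy contracts the syzygy.
\<close>

lemma splits_at_if_finite_resolution:
  assumes M: "left_module R M" and P: "fg_projective_resolution R M P d e"
    and Q: "fg_projective_resolution R M Q \<delta> \<epsilon>" and Qi: "carrier (Q i) = {\<zero>\<^bsub>Q i\<^esub>}"
  shows "splits_at R P d i"
proof -
  note PD = resolutionD[OF P] and QD = resolutionD[OF Q]
  obtain \<alpha> \<beta> h where \<alpha>: "\<alpha> \<in> lmod_hom R (P i) (Q i)" and \<beta>: "\<beta> \<in> lmod_hom R (Q i) (P i)"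
      and h: "h \<in> lmod_hom R (P i) (P (Suc i))"
      and hs: "\<And>x. x \<in> syzygy P d i \<Longrightarrow> d i (h x) = \<beta> (\<alpha> x) \<ominus>\<^bsub>P i\<^esub> x"
    using resolution_comparison[OF M P Q, of i] by blast
  interpret Pi: left_module R "P i" by (rule PD(1))
  have "d i (\<ominus>\<^bsub>P (Suc i)\<^esub> h x) = x" if "x \<in> syzygy P d i" for x
  proof -
    have x: "x \<in> carrier (P i)" using syzygy_closed[OF P that] .
    have "\<alpha> x = \<zero>\<^bsub>Q i\<^esub>" using lmod_homD(1)[OF \<alpha> x] Qi by simp
    then show ?thesis
      using x hs[OF that] lmod_hom_neg_arg[OF PD(1) PD(1) PD(3) lmod_homD(1)[OF h x]]
      by (simp add: lmod_hom_zero[OF QD(1) PD(1) \<beta>] a_minus_def)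
  qed
  then show ?thesis
    unfolding splits_at_def by (intro bexI[OF _ lmod_hom_neg[OF PD(1) h]] ballI)
qed

text \<open>
  Complementary to the summand \<open>syzygy P d (Suc i)\<close> of \<open>P (Suc i)\<close> is a copy of \<open>syzygy P d i\<close>. The
  projection onto it is a cocycle with values in a finitely generated projective module; if it is
  a coboundary, then it factors through \<open>P i\<close>, and this factorization splits the inclusion of
  \<open>syzygy P d i\<close>.
\<close>

lemma splits_at_descend:
  fixes P :: "nat \<Rightarrow> ('r, 'f, 'u) module_scheme"
  assumes P: "fg_projective_resolution R M P d e" and split: "splits_at R P d (Suc i)"
    and Ext: "\<And>f. f \<in> lmod_hom R (P (Suc i)) (regular_lmod R) \<Longrightarrow>
        (\<And>x. x \<in> carrier (P (Suc (Suc i))) \<Longrightarrow> f (d (Suc i) x) = \<zero>\<^bsub>R\<^esub>) \<Longrightarrow>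
        \<exists>g\<in>lmod_hom R (P i) (regular_lmod R). \<forall>y\<in>carrier (P (Suc i)). f y = g (d i y)"
  shows "splits_at R P d i"
proof -
  note PD = resolutionD[OF P]
  obtain h where h: "h \<in> lmod_hom R (P (Suc i)) (P (Suc (Suc i)))"
    "\<And>x. x \<in> syzygy P d (Suc i) \<Longrightarrow> d (Suc i) (h x) = x"
    using split by (auto simp: splits_at_def)
  obtain I and b :: "'f \<Rightarrow> 'f" and f where pb: "dual_basis R (P (Suc i)) I b f" using PD(2) by blast
  note D = dual_basisD[OF pb]
  interpret PS: left_module R "P (Suc i)" by (rule PD(1))
  interpret Pi: left_module R "P i" by (rule PD(1))
  have RR: "left_module R (regular_lmod R)" by (rule regular_lmod_left_module) unfold_locales
  define s where "s = (\<lambda>x. (if x \<in> carrier (P (Suc i)) then x else \<zero>\<^bsub>P (Suc i)\<^esub>)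
      \<ominus>\<^bsub>P (Suc i)\<^esub> d (Suc i) (h x))"
  have s: "s \<in> lmod_hom R (P (Suc i)) (P (Suc i))"
    unfolding s_def by (intro lmod_hom_minus PD lmod_hom_id lmod_hom_comp[OF PD(1) PD(1) h(1)
        PD(3)])
  have sd: "s (d (Suc i) x) = \<zero>\<^bsub>P (Suc i)\<^esub>" if "x \<in> carrier (P (Suc (Suc i)))" for x
    using that h(2)[of "d (Suc i) x"] lmod_homD(1)[OF PD(3) that]
    by (simp add: s_def syzygy_def a_minus_def PS.M.r_neg)
  have "\<exists>g\<in>lmod_hom R (P i) (regular_lmod R). \<forall>y\<in>carrier (P (Suc i)). f j (s y) = g (d i y)"
    if j: "j \<in> I" for j
    by (rule Ext)
       (auto simp: sd lmod_hom_zero[OF PD(1) RR D(4)[OF j], simplified]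
          intro!: lmod_hom_comp[OF PD(1) RR s D(4)[OF j]])
  then obtain g where g: "\<And>j. j \<in> I \<Longrightarrow> g j \<in> lmod_hom R (P i) (regular_lmod R)"
    "\<And>j y. j \<in> I \<Longrightarrow> y \<in> carrier (P (Suc i)) \<Longrightarrow> f j (s y) = g j (d i y)" by metis
  define t where "t = (\<lambda>x. \<Oplus>\<^bsub>P (Suc i)\<^esub>j\<in>I. g j x \<odot>\<^bsub>P (Suc i)\<^esub> b j)"
  have t: "t \<in> lmod_hom R (P i) (P (Suc i))"
    unfolding t_def by (intro lmod_hom_finsum lmod_hom_smult_right PD D g)
  have "d i (t x) = x" if x: "x \<in> syzygy P d i" for x
  proof -
    obtain y where y: "y \<in> carrier (P (Suc i))" "x = d i y" using x by (auto simp: syzygy_def)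
    have "t x = (\<Oplus>\<^bsub>P (Suc i)\<^esub>j\<in>I. f j (s y) \<odot>\<^bsub>P (Suc i)\<^esub> b j)"
      unfolding t_def y(2)
    proof (rule PS.M.finsum_cong')
      show "(\<lambda>j. f j (s y) \<odot>\<^bsub>P (Suc i)\<^esub> b j) \<in> I \<rightarrow> carrier (P (Suc i))"
        using lmod_hom_range[OF RR D(4)] D(3) by (auto intro!: PS.smult_closed)
    qed (auto simp: g(2)[OF _ y(1)])
    also have "\<dots> = s y" by (rule D(5)[OF lmod_homD(1)[OF s y(1)]])
    finally have tx: "t x = s y" .
    have hy: "h y \<in> carrier (P (Suc (Suc i)))" using lmod_homD(1)[OF h(1) y(1)] .
    have "d i (d (Suc i) (h y)) = \<zero>\<^bsub>P i\<^esub>"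
      using PD(7)[of i] hy by (auto simp: syzygy_def)
    then have "d i (s y) = d i y"
      using y(1) hy lmod_homD(1)[OF PD(3) hy] lmod_homD(1)[OF PD(3) y(1)]
      by (simp add: s_def lmod_hom_minus_arg[OF PD(1) PD(1) PD(3)]) (simp add: a_minus_def)
    then show ?thesis by (simp only: tx y(2)[symmetric])
  qed
  then show ?thesis unfolding splits_at_def using t by blast
qed

section \<open>Linear extension from a basis\<close>

lemma lookup_pm_scale: "Poly_Mapping.lookup (pm_scale c p) x = c * Poly_Mapping.lookup p x"
  by transfer (simp add: when_def)

lemma pm_scale_single: "pm_scale c (Poly_Mapping.single x a) = Poly_Mapping.single x (c * a)"
  by (rule poly_mapping_eqI) (simp add: lookup_pm_scale lookup_single when_def)

lemma vector_space_pm_scale: "vector_space (pm_scale :: 'k::field \<Rightarrow> ('x \<Rightarrow>\<^sub>0 'k) \<Rightarrow> ('x \<Rightarrow>\<^sub>0 'k))"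
  by unfold_locales
     (rule poly_mapping_eqI, simp add: lookup_pm_scale lookup_add algebra_simps)+

lemma poly_mapping_sum_singles:
  "(\<Sum>x\<in>Poly_Mapping.keys p. Poly_Mapping.single x (Poly_Mapping.lookup p x)) = p"
  by (rule poly_mapping_eqI)
     (simp add: lookup_sum lookup_single when_def in_keys_iff)

lemma poly_mapping_add_induct:
  fixes p :: "'x \<Rightarrow>\<^sub>0 'k::comm_monoid_add"
  assumes single: "\<And>x c. Q (Poly_Mapping.single x c)" and add: "\<And>p q. Q p \<Longrightarrow> Q q \<Longrightarrow> Q (p + q)"
  shows "Q p"
proof -
  have Q0: "Q 0" using single[of undefined 0] by simp
  have "Q (\<Sum>x\<in>A. Poly_Mapping.single x (Poly_Mapping.lookup p x))" if "finite A" for A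
    using that by (induction A rule: finite_induct) (auto intro: single add Q0)
  from this[of "Poly_Mapping.keys p"] show ?thesis by (simp add: poly_mapping_sum_singles)
qed

context
  fixes s :: "'k::field \<Rightarrow> 'v::ab_group_add \<Rightarrow> 'v"
  assumes vs: "vector_space s"
begin

interpretation V: vector_space s by (fact vs)

lemma lin_ext_superset:
  assumes "finite A" "Poly_Mapping.keys p \<subseteq> A"
  shows "lin_ext s f p = (\<Sum>x\<in>A. s (Poly_Mapping.lookup p x) (f x))"
  unfolding lin_ext_def using assms
  by (intro sum.mono_neutral_left) (auto simp: in_keys_iff)

lemma lin_ext_add: "lin_ext s f (p + q) = lin_ext s f p + lin_ext s f q"
proof -
  let ?A = "Poly_Mapping.keys p \<union> Poly_Mapping.keys q"
  have "finite ?A" "Poly_Mapping.keys (p + q) \<subseteq> ?A" by (auto simp: keys_add)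
  then show ?thesis
    by (simp add: lin_ext_superset[of ?A] lookup_add V.scale_left_distrib sum.distrib)
qed

lemma lin_ext_single: "lin_ext s f (Poly_Mapping.single x c) = s c (f x)"
  by (simp add: lin_ext_superset[of "{x}"])

lemma lin_ext_scale: "lin_ext s f (pm_scale c p) = s c (lin_ext s f p)"
proof -
  have "Poly_Mapping.keys (pm_scale c p) \<subseteq> Poly_Mapping.keys p"
    by (auto simp: in_keys_iff lookup_pm_scale)
  then show ?thesis
    by (simp only: lin_ext_superset[of "Poly_Mapping.keys p"] lookup_pm_scale V.scale_sum_right
        V.scale_scale finite_keys subset_refl)
qed

lemma lin_ext_zero: "lin_ext s f 0 = 0"
  by (simp add: lin_ext_def)

lemma lin_ext_diff: "lin_ext s f (p - q) = lin_ext s f p - lin_ext s f q"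
  using lin_ext_add[of f "p - q" q] by (simp add: algebra_simps)

lemma lin_ext_sum: "lin_ext s f (\<Sum>i\<in>I. p i) = (\<Sum>i\<in>I. lin_ext s f (p i))"
  by (induction I rule: infinite_finite_induct) (simp_all add: lin_ext_add lin_ext_zero)

lemma lin_ext_fun_add: "lin_ext s (\<lambda>x. f x + g x) p = lin_ext s f p + lin_ext s g p"
  by (simp add: lin_ext_def V.scale_right_distrib sum.distrib)

lemma lin_ext_fun_scale: "lin_ext s (\<lambda>x. s c (f x)) p = s c (lin_ext s f p)"
  by (simp add: lin_ext_def V.scale_sum_right mult.commute)

end

section \<open>The enveloping algebra\<close>

definition env_mult :: "('a::{ring,monoid_mult} \<times> 'a \<Rightarrow>\<^sub>0 'k::field) \<Rightarrow> ('a \<times> 'a \<Rightarrow>\<^sub>0 'k) \<Rightarrow> ('a \<times> 'a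
    \<Rightarrow>\<^sub>0 'k)" where
  "env_mult p q = lin_ext pm_scale
     (\<lambda>(a, b). lin_ext pm_scale (\<lambda>(c, d). pure (a * c) (d * b)) q) p"

lemma pre_env_simps:
  "carrier pre_env = UNIV" "p \<otimes>\<^bsub>pre_env\<^esub> q = env_mult p q" "\<one>\<^bsub>pre_env\<^esub> = pure 1 1"
  "\<zero>\<^bsub>pre_env\<^esub> = 0" "p \<oplus>\<^bsub>pre_env\<^esub> q = p + q"
  by (simp_all add: pre_env_def env_mult_def)

lemma env_mult_single:
  "env_mult (Poly_Mapping.single (a, b) r) (Poly_Mapping.single (c, d) t) =
     Poly_Mapping.single (a * c, d * b) (r * t)"
  by (simp add: env_mult_def lin_ext_single[OF vector_space_pm_scale] pure_def pm_scale_single)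

lemma env_mult_add_left: "env_mult (p + q) r = env_mult p r + env_mult q r"
  by (simp add: env_mult_def lin_ext_add[OF vector_space_pm_scale])

lemma env_mult_add_right: "env_mult p (q + r) = env_mult p q + env_mult p r"
  by (simp add: env_mult_def lin_ext_add[OF vector_space_pm_scale] case_prod_unfold
      lin_ext_fun_add[OF vector_space_pm_scale])

lemma env_mult_assoc: "env_mult (env_mult p q) r = env_mult p (env_mult q r)"
proof (induction p rule: poly_mapping_add_induct)
  fix x :: "'a \<times> 'a" and a :: 'b
  show "env_mult (env_mult (Poly_Mapping.single x a) q) r = env_mult (Poly_Mapping.single x a)
      (env_mult q r)"
  proof (induction q rule: poly_mapping_add_induct)
    fix y :: "'a \<times> 'a" and b :: 'b
    show "env_mult (env_mult (Poly_Mapping.single x a) (Poly_Mapping.single y b)) r =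
        env_mult (Poly_Mapping.single x a) (env_mult (Poly_Mapping.single y b) r)"
    proof (induction r rule: poly_mapping_add_induct)
      fix z :: "'a \<times> 'a" and c :: 'b
      show "env_mult (env_mult (Poly_Mapping.single x a) (Poly_Mapping.single y b))
          (Poly_Mapping.single z c) =
        env_mult (Poly_Mapping.single x a) (env_mult (Poly_Mapping.single y b)
            (Poly_Mapping.single z c))"
        by (cases x; cases y; cases z) (simp add: env_mult_single mult.assoc)
    qed (simp add: env_mult_add_right)
  qed (simp add: env_mult_add_left env_mult_add_right)
qed (simp add: env_mult_add_left)

lemma env_mult_scale_left: "env_mult (pm_scale c p) q = pm_scale c (env_mult p q)"
  by (simp add: env_mult_def lin_ext_scale[OF vector_space_pm_scale])

lemma env_mult_scale_right: "env_mult p (pm_scale c q) = pm_scale c (env_mult p q)"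
  by (simp add: env_mult_def lin_ext_scale[OF vector_space_pm_scale] case_prod_unfold
      lin_ext_fun_scale[OF vector_space_pm_scale])

lemma env_mult_diff_left: "env_mult (p - q) r = env_mult p r - env_mult q r"
  using env_mult_add_left[of "p - q" q r] by (simp add: algebra_simps)

lemma env_mult_diff_right: "env_mult r (p - q) = env_mult r p - env_mult r q"
  using env_mult_add_right[of r "p - q" q] by (simp add: algebra_simps)

lemma env_mult_one: "env_mult (pure 1 1) p = p" "env_mult p (pure 1 1) = p"
  by (induction p rule: poly_mapping_add_induct)
     (auto simp: pure_def env_mult_single env_mult_add_left env_mult_add_right)

lemma ring_pre_env: "ring (pre_env :: ('a::{ring,monoid_mult} \<times> 'a \<Rightarrow>\<^sub>0 'k::field) ring)"
proof (rule ringI)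
  show "abelian_group (pre_env :: ('a \<times> 'a \<Rightarrow>\<^sub>0 'k) ring)"
    by (rule abelian_groupI) (auto simp: pre_env_simps algebra_simps intro: exI[of _ "- _"])
  show "Group.monoid (pre_env :: ('a \<times> 'a \<Rightarrow>\<^sub>0 'k) ring)"
    by (rule monoidI) (auto simp: pre_env_simps env_mult_assoc env_mult_one)
qed (auto simp: pre_env_simps env_mult_add_left env_mult_add_right)

definition bilin_generators ::
  "('k::field \<Rightarrow> 'a::{ring,monoid_mult} \<Rightarrow> 'a) \<Rightarrow> ('a \<times> 'a \<Rightarrow>\<^sub>0 'k) set" where
  "bilin_generators sc =
     ({pure (a + a') b - pure a b - pure a' b | a a' b. True} \<union>
      {pure a (b + b') - pure a b - pure a b' | a b b'. True} \<union>
      {pure (sc c a) b - pm_scale c (pure a b) | c a b. True} \<union>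
      {pure a (sc c b) - pm_scale c (pure a b) | c a b. True})"

lemma bilin_relations_span: "bilin_relations sc = module.span pm_scale (bilin_generators sc)"
  by (simp add: bilin_relations_def bilin_generators_def)

lemma bilin_generators_mem:
  "pure (a + a') b - pure a b - pure a' b \<in> bilin_relations sc"
  "pure a (b + b') - pure a b - pure a b' \<in> bilin_relations sc"
  "pure (sc c a) b - pm_scale c (pure a b) \<in> bilin_relations sc"
  "pure a (sc c b) - pm_scale c (pure a b) \<in> bilin_relations sc"
proof -
  interpret P: vector_space pm_scale by (rule vector_space_pm_scale)
  show "pure (a + a') b - pure a b - pure a' b \<in> bilin_relations sc"
    "pure a (b + b') - pure a b - pure a b' \<in> bilin_relations sc"
    "pure (sc c a) b - pm_scale c (pure a b) \<in> bilin_relations sc"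
    "pure a (sc c b) - pm_scale c (pure a b) \<in> bilin_relations sc"
    unfolding bilin_relations_span bilin_generators_def by (rule P.span_base, blast)+
qed

definition env_class :: "('k::field \<Rightarrow> 'a::{ring,monoid_mult} \<Rightarrow> 'a) \<Rightarrow> ('a \<times> 'a \<Rightarrow>\<^sub>0 'k) \<Rightarrow> ('a \<times> 'a
    \<Rightarrow>\<^sub>0 'k) set" where
  "env_class sc p = bilin_relations sc +>\<^bsub>pre_env\<^esub> p"

definition tensor :: "('k::field \<Rightarrow> 'a::{ring,monoid_mult} \<Rightarrow> 'a) \<Rightarrow> 'a \<Rightarrow> 'a \<Rightarrow> ('a \<times> 'a \<Rightarrow>\<^sub>0 'k) set"
    where
  "tensor sc a b = env_class sc (pure a b)"

definition bilinear_on :: "('k::field \<Rightarrow> 'a::ab_group_add \<Rightarrow> 'a) \<Rightarrow> ('k \<Rightarrow> 'v::ab_group_add \<Rightarrow> 'v)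
    \<Rightarrow> ('a \<Rightarrow> 'a \<Rightarrow> 'v) \<Rightarrow> bool" where
  "bilinear_on sc s \<beta> \<longleftrightarrow>
     (\<forall>a a' b. \<beta> (a + a') b = \<beta> a b + \<beta> a' b) \<and> (\<forall>a b b'. \<beta> a (b + b') = \<beta> a b + \<beta> a b') \<and>
     (\<forall>c a b. \<beta> (sc c a) b = s c (\<beta> a b)) \<and> (\<forall>c a b. \<beta> a (sc c b) = s c (\<beta> a b))"

text \<open>
  The additive map on \<open>A \<otimes> A\<^sup>o\<^sup>p\<close> induced by a bilinear map on \<open>A \<times> A\<close>, given by the same
  choice of representatives as the scalar multiplication of a bimodule.
\<close>

definition tensor_lift :: "('k::field \<Rightarrow> 'v::ab_group_add \<Rightarrow> 'v) \<Rightarrow> ('a \<Rightarrow> 'a \<Rightarrow> 'v) \<Rightarrow> ('a \<times> 'a \<Rightarrow>\<^sub>0 'k)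
    set \<Rightarrow> 'v" where
  "tensor_lift s \<beta> t = lin_ext s (\<lambda>(a, b). \<beta> a b) (SOME p. p \<in> t)"

lemma env_class_def': "env_class sc p = {i + p | i. i \<in> bilin_relations sc}"
  by (auto simp: env_class_def a_r_coset_def' pre_env_simps)

lemma lin_ext_bilin_relations:
  assumes "vector_space s" "bilinear_on sc s \<beta>" "p \<in> bilin_relations sc"
  shows "lin_ext s (\<lambda>(a, b). \<beta> a b) p = 0"
proof -
  interpret P: vector_space pm_scale by (rule vector_space_pm_scale)
  interpret V: vector_space s by fact
  note le = lin_ext_add[OF assms(1)] lin_ext_diff[OF assms(1)] lin_ext_scale[OF assms(1)]
    lin_ext_single[OF assms(1)] lin_ext_zero[OF assms(1)]
  have gen: "lin_ext s (\<lambda>(a, b). \<beta> a b) x = 0" if "x \<in> bilin_generators sc" for x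
    using that assms(2) by (auto simp: bilin_generators_def bilinear_on_def pure_def le)
  show ?thesis
    using assms(3)[unfolded bilin_relations_span]
    by (induction rule: P.span_induct_alt) (simp_all add: le gen)
qed

lemma tensor_lift_class:
  assumes "vector_space s" "bilinear_on sc s \<beta>"
  shows "tensor_lift s \<beta> (env_class sc p) = lin_ext s (\<lambda>(a, b). \<beta> a b) p"
proof -
  interpret P: vector_space pm_scale by (rule vector_space_pm_scale)
  have "p \<in> env_class sc p"
    unfolding env_class_def' bilin_relations_span using P.span_zero by (auto intro: exI[of _ 0])
  then have "(SOME q. q \<in> env_class sc p) \<in> env_class sc p" by (rule someI)
  then obtain i where "i \<in> bilin_relations sc" "(SOME q. q \<in> env_class sc p) = i + p"
    unfolding env_class_def' by blast
  then show ?thesis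
    by (simp add: tensor_lift_def lin_ext_add[OF assms(1)] lin_ext_bilin_relations[OF assms])
qed

context k_algebra
begin

lemma env_mult_generator:
  assumes "g \<in> bilin_generators sc"
  shows "env_mult x g \<in> bilin_relations sc" "env_mult g x \<in> bilin_relations sc"
proof -
  interpret P: vector_space pm_scale by (rule vector_space_pm_scale)
  note gen = bilin_generators_mem[where sc = sc]
  have l: "env_mult (Poly_Mapping.single (u, v) r) (pure a b) = pm_scale r (pure (u * a) (b * v))"
    and r: "env_mult (pure a b) (Poly_Mapping.single (u, v) r) = pm_scale r (pure (a * u) (v *
        b))" for u v r a b
    by (simp_all add: pure_def env_mult_single pm_scale_single)
  have sd: "pm_scale r p - pm_scale r q = pm_scale r (p - q)"
    "pm_scale r (pm_scale c p) = pm_scale c (pm_scale r p)" for r c p q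
    by (simp_all only: P.scale_right_diff_distrib P.scale_left_commute)
  have sm: "pm_scale r p \<in> bilin_relations sc" if "p \<in> bilin_relations sc" for r p
    using that unfolding bilin_relations_span by (rule P.span_scale)
  have gen_scaled: "pm_scale r (pure (sc c a) b) - pm_scale (c * r) (pure a b) \<in> bilin_relations sc"
    "pm_scale r (pure a (sc c b)) - pm_scale (c * r) (pure a b) \<in> bilin_relations sc" for a b c r
    using sm[OF gen(3), of r c a b] sm[OF gen(4), of r a c b]
    by (simp_all add: P.scale_right_diff_distrib mult.commute)
  have ad: "p + q \<in> bilin_relations sc" if "p \<in> bilin_relations sc" "q \<in> bilin_relations sc" for p q
    using that unfolding bilin_relations_span by (rule P.span_add)
  show "env_mult x g \<in> bilin_relations sc"
  proof (induction x rule: poly_mapping_add_induct)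
    fix y :: "'a \<times> 'a" and c
    obtain u v where y: "y = (u, v)" by force
    show "env_mult (Poly_Mapping.single y c) g \<in> bilin_relations sc"
      using assms
      by (auto simp: bilin_generators_def y env_mult_diff_right env_mult_scale_right l sd
          distrib_left distrib_right
          scale_mult_left scale_mult_right intro!: sm gen gen_scaled)
  qed (auto simp: env_mult_add_left intro: ad)
  show "env_mult g x \<in> bilin_relations sc"
  proof (induction x rule: poly_mapping_add_induct)
    fix y :: "'a \<times> 'a" and c
    obtain u v where y: "y = (u, v)" by force
    show "env_mult g (Poly_Mapping.single y c) \<in> bilin_relations sc"
      using assms
      by (auto simp: bilin_generators_def y env_mult_diff_left env_mult_scale_left r sd
          distrib_left distrib_right
          scale_mult_left scale_mult_right intro!: sm gen gen_scaled)
  qed (auto simp: env_mult_add_right intro: ad)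
qed

lemma ideal_bilin_relations: "ideal (bilin_relations sc) pre_env"
proof (rule idealI[OF ring_pre_env])
  interpret P: vector_space pm_scale by (rule vector_space_pm_scale)
  interpret pre: ring pre_env by (rule ring_pre_env)
  have neg: "\<ominus>\<^bsub>pre_env\<^esub> p = - p" for p :: "'a \<times> 'a \<Rightarrow>\<^sub>0 'k"
    by (rule pre.minus_equality) (auto simp: pre_env_simps)
  show "subgroup (bilin_relations sc) (add_monoid pre_env)"
  proof (rule pre.add.subgroupI)
    show "bilin_relations sc \<subseteq> carrier pre_env" by (simp add: pre_env_simps)
    show "bilin_relations sc \<noteq> {}" unfolding bilin_relations_span using P.span_zero by blast
    show "\<ominus>\<^bsub>pre_env\<^esub> a \<in> bilin_relations sc" if "a \<in> bilin_relations sc" for a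
      using that unfolding neg bilin_relations_span by (rule P.span_neg)
    show "a \<oplus>\<^bsub>pre_env\<^esub> b \<in> bilin_relations sc" if "a \<in> bilin_relations sc" "b \<in> bilin_relations
        sc" for a b
      using that unfolding bilin_relations_span pre_env_simps by (rule P.span_add)
  qed
  show "x \<otimes>\<^bsub>pre_env\<^esub> a \<in> bilin_relations sc" if "a \<in> bilin_relations sc" for a x
    using that[unfolded bilin_relations_span]
  proof (induction rule: P.span_induct_alt)
    case base then show ?case
      using env_mult_diff_right[of x 0 0] P.span_zero by (simp add: pre_env_simps
          bilin_relations_span)
  next
    case (step c g y)
    then show ?case using env_mult_generator(1)[OF step(1), of x]
      by (simp add: pre_env_simps env_mult_add_right env_mult_scale_right bilin_relations_span
         P.span_add P.span_scale)
  qed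
  show "a \<otimes>\<^bsub>pre_env\<^esub> x \<in> bilin_relations sc" if "a \<in> bilin_relations sc" for a x
    using that[unfolded bilin_relations_span]
  proof (induction rule: P.span_induct_alt)
    case base then show ?case
      using env_mult_diff_left[of 0 0 x] P.span_zero by (simp add: pre_env_simps
          bilin_relations_span)
  next
    case (step c g y)
    then show ?case using env_mult_generator(2)[OF step(1), of x]
      by (simp add: pre_env_simps env_mult_add_left env_mult_scale_left bilin_relations_span
         P.span_add P.span_scale)
  qed
qed

lemma env_ring: "ring (env_alg sc)"
  unfolding env_alg_def by (rule ideal.quotient_is_ring[OF ideal_bilin_relations])

lemma env_class_ops:
  "env_class sc p \<oplus>\<^bsub>env_alg sc\<^esub> env_class sc q = env_class sc (p + q)"
  "env_class sc p \<otimes>\<^bsub>env_alg sc\<^esub> env_class sc q = env_class sc (env_mult p q)"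
  "\<one>\<^bsub>env_alg sc\<^esub> = tensor sc 1 1"
  "\<zero>\<^bsub>env_alg sc\<^esub> = env_class sc 0"
  "carrier (env_alg sc) = range (env_class sc)"
proof -
  note h = ideal.rcos_ring_hom[OF ideal_bilin_relations]
  show "env_class sc p \<oplus>\<^bsub>env_alg sc\<^esub> env_class sc q = env_class sc (p + q)"
    "env_class sc p \<otimes>\<^bsub>env_alg sc\<^esub> env_class sc q = env_class sc (env_mult p q)"
    using ring_hom_add[OF h, of p q] ring_hom_mult[OF h, of p q]
    by (simp_all add: env_class_def env_alg_def pre_env_simps)
  show "\<one>\<^bsub>env_alg sc\<^esub> = tensor sc 1 1"
    using ring_hom_one[OF h] by (simp add: tensor_def env_class_def env_alg_def pre_env_simps)
  show "\<zero>\<^bsub>env_alg sc\<^esub> = env_class sc 0"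
    by (auto simp: env_class_def' env_alg_def FactRing_def)
  show "carrier (env_alg sc) = range (env_class sc)"
    by (auto simp: env_class_def env_alg_def FactRing_def A_RCOSETS_def' a_r_coset_def'
        pre_env_simps)
qed

lemma tensor_closed [simp]: "tensor sc a b \<in> carrier (env_alg sc)"
  by (simp add: tensor_def env_class_ops)

lemma tensor_mult: "tensor sc a b \<otimes>\<^bsub>env_alg sc\<^esub> tensor sc c d = tensor sc (a * c) (d * b)"
  by (simp add: tensor_def env_class_ops) (simp add: pure_def env_mult_single)

lemma env_class_eq: "p - q \<in> bilin_relations sc \<Longrightarrow> env_class sc p = env_class sc q"
proof -
  interpret P: vector_space pm_scale by (rule vector_space_pm_scale)
  assume a: "p - q \<in> bilin_relations sc"
  have "i + p \<in> env_class sc q" if "i \<in> bilin_relations sc" for i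
    using P.span_add[of i _ "p - q"] a that unfolding env_class_def' bilin_relations_span
    by (auto intro!: exI[of _ "i + (p - q)"])
  moreover have "i + q \<in> env_class sc p" if "i \<in> bilin_relations sc" for i
    using P.span_diff[of i _ "p - q"] a that unfolding env_class_def' bilin_relations_span
    by (auto intro!: exI[of _ "i - (p - q)"])
  ultimately show ?thesis by (auto simp: env_class_def')
qed

text \<open>Every class is a sum of pure tensors, because a scalar can be absorbed into a factor.\<close>

lemma env_induct [consumes 1, case_names tensor add]:
  assumes "t \<in> carrier (env_alg sc)"
    and tensor: "\<And>a b. Q (tensor sc a b)"
    and add: "\<And>t u. t \<in> carrier (env_alg sc) \<Longrightarrow> u \<in> carrier (env_alg sc) \<Longrightarrow> Q t \<Longrightarrow> Q u \<Longrightarrow>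
          Q (t \<oplus>\<^bsub>env_alg sc\<^esub> u)"
  shows "Q t"
proof -
  have "Q (env_class sc p)" for p
  proof (induction p rule: poly_mapping_add_induct)
    fix x :: "'a \<times> 'a" and c :: 'k
    obtain a b where x: "x = (a, b)" by force
    from env_class_eq[OF bilin_generators_mem(3)] have "env_class sc (Poly_Mapping.single x c) =
        tensor sc (sc c a) b"
      by (simp add: tensor_def x pure_def pm_scale_single)
    then show "Q (env_class sc (Poly_Mapping.single x c))" using tensor by simp
  next
    fix p q assume "Q (env_class sc p)" "Q (env_class sc q)"
    then show "Q (env_class sc (p + q))"
      using add[of "env_class sc p" "env_class sc q"] by (simp add: env_class_ops)
  qed
  then show ?thesis using assms(1) by (auto simp: env_class_ops)
qed

lemma tensor_lift_add:
  assumes "vector_space s" "bilinear_on sc s \<beta>" "t \<in> carrier (env_alg sc)" "u \<in> carrier (env_alg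
      sc)"
  shows "tensor_lift s \<beta> (t \<oplus>\<^bsub>env_alg sc\<^esub> u) = tensor_lift s \<beta> t + tensor_lift s \<beta> u"
  using assms(3,4)
  by (auto simp: env_class_ops tensor_lift_class[OF assms(1,2)] lin_ext_add[OF assms(1)])

lemma tensor_lift_tensor:
  assumes "vector_space s" "bilinear_on sc s \<beta>"
  shows "tensor_lift s \<beta> (tensor sc a b) = \<beta> a b"
proof -
  interpret V: vector_space s by fact
  show ?thesis
    by (simp add: tensor_def tensor_lift_class[OF assms] pure_def lin_ext_single[OF assms(1)])
qed

lemma tensor_lift_zero:
  assumes "vector_space s" "bilinear_on sc s \<beta>"
  shows "tensor_lift s \<beta> \<zero>\<^bsub>env_alg sc\<^esub> = 0"
  by (simp add: env_class_ops tensor_lift_class[OF assms] lin_ext_zero[OF assms(1)])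

lemma env_flip_tensor: "env_flip (tensor sc a b) = tensor sc b a"
proof -
  interpret P: vector_space "pm_scale :: 'k \<Rightarrow> ('a \<times> 'a \<Rightarrow>\<^sub>0 'k) \<Rightarrow> _" by (rule vector_space_pm_scale)
  let ?w = "Poly_Mapping.map_key prod.swap :: ('a \<times> 'a \<Rightarrow>\<^sub>0 'k) \<Rightarrow> _"
  have inj: "inj (prod.swap :: 'a \<times> 'a \<Rightarrow> _)" by (auto simp: inj_def)
  have add: "?w (p + q) = ?w p + ?w q" for p q by (rule map_key_plus[OF inj])
  have w0: "?w 0 = 0" using add[of 0 0] by simp
  have diff: "?w (p - q) = ?w p - ?w q" for p q using add[of "p - q" q] by (simp add: algebra_simps)
  have scale: "?w (pm_scale c p) = pm_scale c (?w p)" for c p by (rule map_key_map[OF inj])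
  have pure: "?w (pure a b) = pure b a" for a b
    using map_key_single[OF inj, of "(b, a)" "1 :: 'k"] by (simp add: pure_def)
  have ww: "?w (?w p) = p" for p
    using map_key_compose[OF inj inj] by (simp add: fun_eq_iff id_def map_key_id)
  have wI: "?w i \<in> bilin_relations sc" if "i \<in> bilin_relations sc" for i
    using that unfolding bilin_relations_span
  proof (induction rule: P.span_induct_alt)
    case base then show ?case by (simp add: w0 P.span_zero)
  next
    case (step c g y)
    have "?w g \<in> bilin_generators sc"
      using step(1) unfolding bilin_generators_def Un_iff mem_Collect_eq
      by (elim disjE exE conjE; simp only: diff scale pure; blast)
    then show ?case using step by (simp add: add scale P.span_add P.span_scale P.span_base)
  qed
  show ?thesis
  proof
    show "env_flip (tensor sc a b) \<subseteq> tensor sc b a"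
      using wI by (auto simp: env_flip_def tensor_def env_class_def' add pure)
    show "tensor sc b a \<subseteq> env_flip (tensor sc a b)"
    proof
      fix p assume "p \<in> tensor sc b a"
      then obtain i where i: "i \<in> bilin_relations sc" "p = i + pure b a"
        by (auto simp: tensor_def env_class_def')
      have "p = ?w (?w i + pure a b)" by (simp add: add ww pure i)
      then show "p \<in> env_flip (tensor sc a b)"
        using wI[OF i(1)] by (auto simp: env_flip_def tensor_def env_class_def')
    qed
  qed
qed

end

section \<open>Bimodules\<close>

lemma bimod_simps [simp]:
  "carrier (bimod s act) = UNIV" "\<zero>\<^bsub>bimod s act\<^esub> = 0" "x \<oplus>\<^bsub>bimod s act\<^esub> y = x + y"
  by (simp_all add: bimod_def)

lemma bimod_smult: "t \<odot>\<^bsub>bimod s act\<^esub> x = tensor_lift s (\<lambda>a b. act a x b) t"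
  by (simp add: bimod_def tensor_lift_def)

lemma abelian_group_bimod: "abelian_group (bimod s act)"
proof (rule abelian_groupI)
  fix x assume "x \<in> carrier (bimod s act)"
  show "\<exists>y\<in>carrier (bimod s act). y \<oplus>\<^bsub>bimod s act\<^esub> x = \<zero>\<^bsub>bimod s act\<^esub>"
    by (rule bexI[of _ "- x"]) simp_all
qed (simp_all add: algebra_simps)

lemma bimod_finsum:
  assumes "finite I"
  shows "(\<Oplus>\<^bsub>bimod s act\<^esub>i\<in>I. x i) = (\<Sum>i\<in>I. x i)"
proof -
  interpret B: abelian_group "bimod s act" by (rule abelian_group_bimod)
  show ?thesis using assms by (induction I rule: finite_induct) (simp_all add: B.finsum_insert)
qed

lemma bimod_smult_linear:
  assumes "vector_space s" "\<And>a x y b. act a (x + y) b = act a x b + act a y b"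
    "\<And>a c x b. act a (s c x) b = s c (act a x b)"
  shows "t \<odot>\<^bsub>bimod s act\<^esub> (x + y) = t \<odot>\<^bsub>bimod s act\<^esub> x + t \<odot>\<^bsub>bimod s act\<^esub> y"
    "t \<odot>\<^bsub>bimod s act\<^esub> (s c x) = s c (t \<odot>\<^bsub>bimod s act\<^esub> x)"
  by (simp_all add: bimod_smult tensor_lift_def case_prod_unfold assms(2,3)
      lin_ext_fun_add[OF assms(1)] lin_ext_fun_scale[OF assms(1)])

context k_algebra
begin

definition bimodule_action :: "('k \<Rightarrow> 'v::ab_group_add \<Rightarrow> 'v) \<Rightarrow> ('a \<Rightarrow> 'v \<Rightarrow> 'a \<Rightarrow> 'v) \<Rightarrow> bool" where
  "bimodule_action s act \<longleftrightarrow> vector_space s \<and> (\<forall>x. bilinear_on sc s (\<lambda>a b. act a x b)) \<and>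
     (\<forall>a x y b. act a (x + y) b = act a x b + act a y b) \<and>
     (\<forall>a c x b. act a (s c x) b = s c (act a x b)) \<and>
     (\<forall>a b c d x. act a (act c x d) b = act (a * c) x (d * b)) \<and> (\<forall>x. act 1 x 1 = x)"

lemma bimodule_actionD:
  assumes "bimodule_action s act"
  shows "vector_space s" "bilinear_on sc s (\<lambda>a b. act a x b)"
    "act a (x + y) b = act a x b + act a y b" "act a (s c x) b = s c (act a x b)"
    "act a (act c' x d) b = act (a * c') x (d * b)" "act 1 x 1 = x"
  using assms by (auto simp: bimodule_action_def)

lemma tensor_smult:
  assumes "bimodule_action s act"
  shows "tensor sc a b \<odot>\<^bsub>bimod s act\<^esub> x = act a x b"
  using tensor_lift_tensor[OF bimodule_actionD(1,2)[OF assms]] by (simp add: bimod_smult)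

lemma left_module_bimod:
  assumes "bimodule_action s act"
  shows "left_module (env_alg sc) (bimod s act)"
proof -
  note D = bimodule_actionD[OF assms]
  interpret E: ring "env_alg sc" by (rule env_ring)
  let ?B = "bimod s act"
  have ladd: "(t \<oplus>\<^bsub>env_alg sc\<^esub> u) \<odot>\<^bsub>?B\<^esub> x = t \<odot>\<^bsub>?B\<^esub> x + u \<odot>\<^bsub>?B\<^esub> x"
    if "t \<in> carrier (env_alg sc)" "u \<in> carrier (env_alg sc)" for t u x
    using that by (simp add: bimod_smult tensor_lift_add[OF D(1,2)])
  have radd: "t \<odot>\<^bsub>?B\<^esub> (x + y) = t \<odot>\<^bsub>?B\<^esub> x + t \<odot>\<^bsub>?B\<^esub> y" for t x y
    by (rule bimod_smult_linear(1)) (fact D)+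
  have assoc: "(t \<otimes>\<^bsub>env_alg sc\<^esub> u) \<odot>\<^bsub>?B\<^esub> x = t \<odot>\<^bsub>?B\<^esub> (u \<odot>\<^bsub>?B\<^esub> x)"
    if "t \<in> carrier (env_alg sc)" "u \<in> carrier (env_alg sc)" for t u x
    using that(1)
  proof (induction t rule: env_induct)
    case (tensor a b)
    show ?case using that(2)
    proof (induction u rule: env_induct)
      case (tensor c d)
      then show ?case by (simp add: tensor_mult tensor_smult[OF assms] D(5))
    next
      case (add t u)
      then show ?case by (simp add: E.r_distr ladd radd)
    qed
  next
    case (add t u')
    then show ?case using that(2) by (simp add: E.l_distr ladd)
  qed
  show ?thesis
  proof (intro left_module.intro left_module_axioms.intro)
    show "\<one>\<^bsub>env_alg sc\<^esub> \<odot>\<^bsub>?B\<^esub> x = x" for x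
      by (simp only: env_class_ops(3) tensor_smult[OF assms] D(6))
  qed (simp_all only: ladd radd assoc env_ring abelian_group_bimod bimod_simps UNIV_I)
qed

end

section \<open>The class map of the top cohomology\<close>

lemma hom_env_simps [simp]:
  "carrier (hom_env sc P) = lmod_hom (env_alg sc) P (regular_lmod (env_alg sc))"
  "\<zero>\<^bsub>hom_env sc P\<^esub> = (\<lambda>x. \<zero>\<^bsub>env_alg sc\<^esub>)"
  "f \<oplus>\<^bsub>hom_env sc P\<^esub> g = (\<lambda>x. f x \<oplus>\<^bsub>env_alg sc\<^esub> g x)"
  "t \<odot>\<^bsub>hom_env sc P\<^esub> f = (\<lambda>x. f x \<otimes>\<^bsub>env_alg sc\<^esub> env_flip t)"
  by (simp_all add: hom_env_def Let_def)

lemma mem_cocycles_iff: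
  "f \<in> cocycles sc P d i \<longleftrightarrow> f \<in> lmod_hom (env_alg sc) (P i) (regular_lmod (env_alg sc)) \<and>
     (\<forall>x\<in>carrier (P (Suc i)). f (d i x) = \<zero>\<^bsub>env_alg sc\<^esub>)"
  by (simp add: cocycles_def)

lemma mem_coboundaries_iff:
  "f \<in> coboundaries sc P d (Suc i) \<longleftrightarrow>
     (\<exists>g\<in>lmod_hom (env_alg sc) (P i) (regular_lmod (env_alg sc)). f = (\<lambda>x. g (d i x)))"
  by (auto simp: coboundaries_def)

context k_algebra
begin

abbreviation E :: "('a \<times> 'a \<Rightarrow>\<^sub>0 'k) set ring" where "E \<equiv> env_alg sc"

lemma E_regular: "left_module E (regular_lmod E)"
  by (rule regular_lmod_left_module[OF env_ring])

lemma diagonal_action: "bimodule_action sc (\<lambda>a x b. a * x * b)"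
  unfolding bimodule_action_def bilinear_on_def using vector_space_axioms
  by (auto simp: distrib_left distrib_right scale_mult_left scale_mult_right mult.assoc)

lemma left_module_diagonal: "left_module E (diagonal_bimod sc)"
  unfolding diagonal_bimod_def by (rule left_module_bimod[OF diagonal_action])

lemma abelian_group_hom_env: "abelian_group (hom_env sc Q)"
proof (rule abelian_groupI)
  interpret E: ring E by (rule env_ring)
  interpret R: left_module E "regular_lmod E" by (rule E_regular)
  fix f g k assume f: "f \<in> carrier (hom_env sc Q)" and g: "g \<in> carrier (hom_env sc Q)"
    and k: "k \<in> carrier (hom_env sc Q)"
  have cl: "f x \<in> carrier E" "g x \<in> carrier E" "k x \<in> carrier E" for x
    using lmod_hom_range[OF E_regular] f g k by auto
  show "f \<oplus>\<^bsub>hom_env sc Q\<^esub> g \<in> carrier (hom_env sc Q)"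
    using lmod_hom_add[OF E_regular] f g by simp
  show "f \<oplus>\<^bsub>hom_env sc Q\<^esub> g \<oplus>\<^bsub>hom_env sc Q\<^esub> k = f \<oplus>\<^bsub>hom_env sc Q\<^esub> (g \<oplus>\<^bsub>hom_env sc Q\<^esub> k)"
    using cl by (simp add: E.a_assoc)
  show "f \<oplus>\<^bsub>hom_env sc Q\<^esub> g = g \<oplus>\<^bsub>hom_env sc Q\<^esub> f" using cl by (simp add: E.a_comm)
  show "\<zero>\<^bsub>hom_env sc Q\<^esub> \<oplus>\<^bsub>hom_env sc Q\<^esub> f = f" using cl by simp
  show "\<exists>y\<in>carrier (hom_env sc Q). y \<oplus>\<^bsub>hom_env sc Q\<^esub> f = \<zero>\<^bsub>hom_env sc Q\<^esub>"
  proof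
    have "(\<lambda>x. \<ominus>\<^bsub>regular_lmod E\<^esub> f x) \<in> carrier (hom_env sc Q)"
      using lmod_hom_neg[OF E_regular] f by simp
    then show "(\<lambda>x. \<ominus>\<^bsub>regular_lmod E\<^esub> f x) \<in> carrier (hom_env sc Q)" .
    show "(\<lambda>x. \<ominus>\<^bsub>regular_lmod E\<^esub> f x) \<oplus>\<^bsub>hom_env sc Q\<^esub> f = \<zero>\<^bsub>hom_env sc Q\<^esub>"
      using cl R.M.l_neg by (simp add: fun_eq_iff)
  qed
qed (use lmod_hom_const_zero[OF E_regular] in simp)

lemma abelian_subgroup_coboundaries:
  assumes P: "fg_projective_resolution E M P d e"
  shows "abelian_subgroup (coboundaries sc P d (Suc i)) (hom_env sc (P (Suc i)))"
proof (rule abelian_subgroupI3)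
  note PD = resolutionD[OF P]
  interpret H: abelian_group "hom_env sc (P (Suc i))" by (rule abelian_group_hom_env)
  interpret H': abelian_group "hom_env sc (P i)" by (rule abelian_group_hom_env)
  have inv: "\<ominus>\<^bsub>hom_env sc Q\<^esub> f = (\<lambda>x. \<ominus>\<^bsub>regular_lmod E\<^esub> f x)"
    if f: "f \<in> carrier (hom_env sc Q)" for f and Q :: "(_, 'z, 'y) module_scheme"
  proof -
    interpret A: abelian_group "hom_env sc Q" by (rule abelian_group_hom_env)
    interpret R: left_module E "regular_lmod E" by (rule E_regular)
    show ?thesis
    proof (rule A.minus_equality)
      show "(\<lambda>x. \<ominus>\<^bsub>regular_lmod E\<^esub> f x) \<oplus>\<^bsub>hom_env sc Q\<^esub> f = \<zero>\<^bsub>hom_env sc Q\<^esub>"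
        using R.M.l_neg lmod_hom_range[OF E_regular, of f Q] f by (simp add: fun_eq_iff)
    qed (use f lmod_hom_neg[OF E_regular] in simp_all)
  qed
  have sub: "coboundaries sc P d (Suc i) \<subseteq> carrier (hom_env sc (P (Suc i)))"
    by (auto simp: mem_coboundaries_iff intro: lmod_hom_comp[OF PD(1) E_regular PD(3)])
  show "additive_subgroup (coboundaries sc P d (Suc i)) (hom_env sc (P (Suc i)))"
  proof (rule additive_subgroupI, rule H.add.subgroupI)
    show "coboundaries sc P d (Suc i) \<subseteq> carrier (hom_env sc (P (Suc i)))" by (rule sub)
    show "coboundaries sc P d (Suc i) \<noteq> {}"
      using lmod_hom_const_zero[OF E_regular, of "P i"] by (auto simp: coboundaries_def)
  next
    fix f assume f: "f \<in> coboundaries sc P d (Suc i)"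
    then obtain g where g: "g \<in> lmod_hom E (P i) (regular_lmod E)" "f = (\<lambda>x. g (d i x))"
      by (auto simp: mem_coboundaries_iff)
    show "\<ominus>\<^bsub>hom_env sc (P (Suc i))\<^esub> f \<in> coboundaries sc P d (Suc i)"
      unfolding inv[OF subsetD[OF sub f]] mem_coboundaries_iff
      by (rule bexI[OF _ lmod_hom_neg[OF E_regular g(1)]]) (simp add: g(2))
  next
    fix f f' assume "f \<in> coboundaries sc P d (Suc i)" "f' \<in> coboundaries sc P d (Suc i)"
    then obtain g g' where "g \<in> lmod_hom E (P i) (regular_lmod E)" "f = (\<lambda>x. g (d i x))"
      "g' \<in> lmod_hom E (P i) (regular_lmod E)" "f' = (\<lambda>x. g' (d i x))"
      by (auto simp: mem_coboundaries_iff)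
    then show "f \<oplus>\<^bsub>hom_env sc (P (Suc i))\<^esub> f' \<in> coboundaries sc P d (Suc i)"
      using lmod_hom_add[OF E_regular, of g "P i" g']
      by (auto simp: mem_coboundaries_iff intro!: bexI[of _ "\<lambda>x. g x \<oplus>\<^bsub>E\<^esub> g' x"])
  qed
  show "abelian_group (hom_env sc (P (Suc i)))" by (rule abelian_group_hom_env)
qed

lemma coboundary_cocycle:
  assumes P: "fg_projective_resolution E M P d e"
  shows "coboundaries sc P d (Suc i) \<subseteq> cocycles sc P d (Suc i)"
proof
  note PD = resolutionD[OF P]
  fix f assume "f \<in> coboundaries sc P d (Suc i)"
  then obtain g where g: "g \<in> lmod_hom E (P i) (regular_lmod E)" "f = (\<lambda>x. g (d i x))"
    by (auto simp: mem_coboundaries_iff)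
  have "d i (d (Suc i) x) = \<zero>\<^bsub>P i\<^esub>" if "x \<in> carrier (P (Suc (Suc i)))" for x
    using PD(7)[of i] that by (auto simp: syzygy_def)
  then show "f \<in> cocycles sc P d (Suc i)"
    using g(2) lmod_hom_comp[OF PD(1) E_regular PD(3) g(1)] lmod_hom_zero[OF PD(1) E_regular g(1)]
    by (auto simp: mem_cocycles_iff)
qed

lemma cocycle_is_coboundary_if_Ext_zero:
  assumes P: "fg_projective_resolution E M P d e"
    and Ext: "carrier (Ext_env sc P d (Suc i)) = {\<zero>\<^bsub>Ext_env sc P d (Suc i)\<^esub>}"
    and f: "f \<in> cocycles sc P d (Suc i)"
  shows "f \<in> coboundaries sc P d (Suc i)"
proof -
  let ?B = "coboundaries sc P d (Suc i)"
  interpret abelian_subgroup ?B "hom_env sc (P (Suc i))"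
    by (rule abelian_subgroup_coboundaries[OF P])
  have "?B +>\<^bsub>hom_env sc (P (Suc i))\<^esub> f \<in> carrier (Ext_env sc P d (Suc i))"
    using f by (simp add: Ext_env_def quot_lmod_def)
  then have "?B +>\<^bsub>hom_env sc (P (Suc i))\<^esub> f = ?B"
    using Ext by (simp add: Ext_env_def quot_lmod_def)
  then show ?thesis using a_rcos_self[of f] f by (simp add: mem_cocycles_iff)
qed

lemma cocycles_add:
  "f \<in> cocycles sc P d i \<Longrightarrow> g \<in> cocycles sc P d i \<Longrightarrow> (\<lambda>x. f x \<oplus>\<^bsub>E\<^esub> g x) \<in> cocycles sc P d i"
proof -
  interpret ring E by (rule env_ring)
  show "f \<in> cocycles sc P d i \<Longrightarrow> g \<in> cocycles sc P d i \<Longrightarrow> (\<lambda>x. f x \<oplus>\<^bsub>E\<^esub> g x) \<in> cocycles sc P d i"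
    using lmod_hom_add[OF E_regular, of f "P i" g] by (auto simp: mem_cocycles_iff)
qed

lemma cocycles_minus:
  "f \<in> cocycles sc P d i \<Longrightarrow> g \<in> cocycles sc P d i \<Longrightarrow>
     (\<lambda>x. f x \<ominus>\<^bsub>regular_lmod E\<^esub> g x) \<in> cocycles sc P d i"
proof -
  interpret R: left_module E "regular_lmod E" by (rule E_regular)
  show "f \<in> cocycles sc P d i \<Longrightarrow> g \<in> cocycles sc P d i \<Longrightarrow>
      (\<lambda>x. f x \<ominus>\<^bsub>regular_lmod E\<^esub> g x) \<in> cocycles sc P d i"
    using lmod_hom_minus[OF E_regular, of f "P i" g] R.M.r_neg[of "\<zero>\<^bsub>E\<^esub>"]
    by (auto simp: mem_cocycles_iff a_minus_def)
qed

lemma cocycles_mult: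
  assumes "f \<in> cocycles sc P d i" "t \<in> carrier E"
  shows "(\<lambda>x. f x \<otimes>\<^bsub>E\<^esub> t) \<in> cocycles sc P d i"
proof -
  interpret ring E by (rule env_ring)
  show ?thesis
    using lmod_hom_smult_right[OF E_regular, of t f "P i"] assms by (auto simp: mem_cocycles_iff)
qed

text \<open>
  An isomorphism of the top \<open>Ext\<close> with the diagonal bimodule, read as a map on cocycles. Right
  multiplication by \<open>a \<otimes> b\<close> on cocycles is left multiplication by \<open>b \<otimes> a\<close> on \<open>Ext\<close>, which
  explains the order of the factors.
\<close>

lemma ext_class_map:
  assumes P: "fg_projective_resolution E M P d e"
    and iso: "lmod_iso E (Ext_env sc P d (Suc i)) (diagonal_bimod sc)"
  obtains \<theta> where
    "\<forall>f\<in>cocycles sc P d (Suc i). \<forall>g\<in>cocycles sc P d (Suc i). \<theta> (\<lambda>x. f x \<oplus>\<^bsub>E\<^esub> g x) = \<theta> f + \<theta> g"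
    "\<forall>f\<in>cocycles sc P d (Suc i). \<forall>a b. \<theta> (\<lambda>x. f x \<otimes>\<^bsub>E\<^esub> tensor sc a b) = b * \<theta> f * a"
    "\<forall>f\<in>cocycles sc P d (Suc i). \<theta> f = 0 \<longleftrightarrow> f \<in> coboundaries sc P d (Suc i)"
    "\<exists>\<omega>\<in>cocycles sc P d (Suc i). \<theta> \<omega> = 1"
proof -
  let ?B = "coboundaries sc P d (Suc i)" and ?Z = "cocycles sc P d (Suc i)"
  let ?H = "hom_env sc (P (Suc i))" and ?X = "Ext_env sc P d (Suc i)"
  interpret E: ring E by (rule env_ring)
  interpret abelian_subgroup ?B ?H by (rule abelian_subgroup_coboundaries[OF P])
  obtain F where F: "F \<in> lmod_hom E ?X (diagonal_bimod sc)"
    and bij: "bij_betw F (carrier ?X) (carrier (diagonal_bimod sc))"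
    using iso by (auto simp: lmod_iso_def)
  have D: "carrier (diagonal_bimod sc) = UNIV" "x \<oplus>\<^bsub>diagonal_bimod sc\<^esub> y = x + y"
    "tensor sc a b \<odot>\<^bsub>diagonal_bimod sc\<^esub> x = a * x * b" for x y a b
    by (simp_all add: diagonal_bimod_def tensor_smult[OF diagonal_action])
  have X: "carrier ?X = (\<lambda>f. ?B +>\<^bsub>?H\<^esub> f) ` ?Z" "\<zero>\<^bsub>?X\<^esub> = ?B" "Y \<oplus>\<^bsub>?X\<^esub> Y' = set_add ?H Y Y'"
    "t \<odot>\<^bsub>?X\<^esub> Y = (\<Union>f\<in>Y. ?B +>\<^bsub>?H\<^esub> (t \<odot>\<^bsub>?H\<^esub> f))" for Y Y' t
    by (simp_all add: Ext_env_def quot_lmod_def)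
  have ZH: "f \<in> carrier ?H" if "f \<in> ?Z" for f using that by (simp add: mem_cocycles_iff)
  have Bm: "(\<lambda>x. f x \<otimes>\<^bsub>E\<^esub> t) \<in> ?B" if f: "f \<in> ?B" and t: "t \<in> carrier E" for f t
  proof -
    obtain g where g: "g \<in> lmod_hom E (P i) (regular_lmod E)" "f = (\<lambda>x. g (d i x))"
      using f by (auto simp: mem_coboundaries_iff)
    then show ?thesis
      using lmod_hom_smult_right[OF E_regular, of t g "P i"] t
      by (auto simp: mem_coboundaries_iff intro!: bexI[of _ "\<lambda>x. g x \<otimes>\<^bsub>E\<^esub> t"])
  qed
  define \<theta> where "\<theta> f = F (?B +>\<^bsub>?H\<^esub> f)" for f
  have add: "\<theta> (\<lambda>x. f x \<oplus>\<^bsub>E\<^esub> g x) = \<theta> f + \<theta> g" if "f \<in> ?Z" "g \<in> ?Z" for f g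
  proof -
    have "?B +>\<^bsub>?H\<^esub> (f \<oplus>\<^bsub>?H\<^esub> g) = (?B +>\<^bsub>?H\<^esub> f) \<oplus>\<^bsub>?X\<^esub> (?B +>\<^bsub>?H\<^esub> g)"
      unfolding X(3) using a_rcos_sum[OF ZH ZH] that by simp
    then show ?thesis
      using lmod_homD(2)[OF F, of "?B +>\<^bsub>?H\<^esub> f" "?B +>\<^bsub>?H\<^esub> g"] that by (simp add: \<theta>_def X(1) D)
  qed
  have mult: "\<theta> (\<lambda>x. f x \<otimes>\<^bsub>E\<^esub> tensor sc a b) = b * \<theta> f * a" if f: "f \<in> ?Z" for f a b
  proof -
    let ?t = "tensor sc a b" and ?u = "tensor sc b a"
    have ft: "(\<lambda>x. f x \<otimes>\<^bsub>E\<^esub> ?t) \<in> carrier ?H" using ZH[OF cocycles_mult[OF f]] by simp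
    have cl: "f x \<in> carrier E" if "f \<in> carrier ?H" for f x
      using lmod_hom_range[OF E_regular] that by auto
    have "?B +>\<^bsub>?H\<^esub> (?u \<odot>\<^bsub>?H\<^esub> g) = ?B +>\<^bsub>?H\<^esub> (\<lambda>x. f x \<otimes>\<^bsub>E\<^esub> ?t)"
      if g: "g \<in> ?B +>\<^bsub>?H\<^esub> f" for g
    proof -
      obtain b0 where b0: "b0 \<in> ?B" "g = b0 \<oplus>\<^bsub>?H\<^esub> f" using g by (auto simp: a_r_coset_def')
      have "?u \<odot>\<^bsub>?H\<^esub> g = (\<lambda>x. b0 x \<otimes>\<^bsub>E\<^esub> ?t) \<oplus>\<^bsub>?H\<^esub> (\<lambda>x. f x \<otimes>\<^bsub>E\<^esub> ?t)"
        using cl[OF a_Hcarr[OF b0(1)]] cl[OF ZH[OF f]]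
        by (simp add: b0(2) env_flip_tensor E.l_distr)
      then have "?u \<odot>\<^bsub>?H\<^esub> g \<in> ?B +>\<^bsub>?H\<^esub> (\<lambda>x. f x \<otimes>\<^bsub>E\<^esub> ?t)"
        using Bm[OF b0(1) tensor_closed[of a b]] unfolding a_r_coset_def' by blast
      then show ?thesis using a_repr_independence[OF _ ft] a_subgroup by simp
    qed
    then have "?u \<odot>\<^bsub>?X\<^esub> (?B +>\<^bsub>?H\<^esub> f) = ?B +>\<^bsub>?H\<^esub> (\<lambda>x. f x \<otimes>\<^bsub>E\<^esub> ?t)"
      unfolding X(4) using a_rcos_self[OF ZH[OF f]] by auto
    then have "\<theta> (\<lambda>x. f x \<otimes>\<^bsub>E\<^esub> ?t) = F (?u \<odot>\<^bsub>?X\<^esub> (?B +>\<^bsub>?H\<^esub> f))" by (simp add: \<theta>_def)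
    also have "\<dots> = ?u \<odot>\<^bsub>diagonal_bimod sc\<^esub> \<theta> f"
      unfolding \<theta>_def using f by (intro lmod_homD(3)[OF F]) (simp_all add: X(1))
    finally show ?thesis by (simp add: D)
  qed
  have ker: "\<theta> f = 0 \<longleftrightarrow> f \<in> ?B" if f: "f \<in> ?Z" for f
  proof -
    have z: "(\<lambda>x. \<zero>\<^bsub>E\<^esub>) \<in> ?Z" "(\<lambda>x. \<zero>\<^bsub>E\<^esub>) \<in> ?B"
      using lmod_hom_const_zero[OF E_regular, of "P i"] coboundary_cocycle[OF P, of i]
      by (auto simp: mem_coboundaries_iff intro!: bexI[of _ "\<lambda>x. \<zero>\<^bsub>E\<^esub>"])
    have "\<theta> (\<lambda>x. \<zero>\<^bsub>E\<^esub>) = 0" using add[OF z(1) z(1)] by simp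
    moreover have "\<theta> f = \<theta> (\<lambda>x. \<zero>\<^bsub>E\<^esub>) \<longleftrightarrow> ?B +>\<^bsub>?H\<^esub> f = ?B +>\<^bsub>?H\<^esub> (\<lambda>x. \<zero>\<^bsub>E\<^esub>)"
      unfolding \<theta>_def using bij f z by (auto simp: bij_betw_def inj_on_def X(1))
    moreover have "?B +>\<^bsub>?H\<^esub> (\<lambda>x. \<zero>\<^bsub>E\<^esub>) = ?B" using a_rcos_const[OF z(2)] .
    moreover have "?B +>\<^bsub>?H\<^esub> f = ?B \<longleftrightarrow> f \<in> ?B"
      using a_rcos_const[of f] a_rcos_self[OF ZH[OF f]] by auto
    ultimately show ?thesis by simp
  qed
  have unit: "\<exists>\<omega>\<in>?Z. \<theta> \<omega> = 1"
  proof -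
    have "1 \<in> F ` carrier ?X" using bij by (simp add: bij_betw_def D(1))
    then show ?thesis by (auto simp: X(1) \<theta>_def)
  qed
  show ?thesis by (rule that[OF _ _ _ unit]) (simp_all add: add mult ker)
qed

end

section \<open>Resolutions of two-dimensional Calabi-Yau algebras\<close>

text \<open>
  The splitting condition says that the resolution can be cut off in degree two, that is, that \<open>A\<close>
  has projective dimension at most two as a bimodule.
\<close>

locale cy2_resolution = k_algebra sc
  for sc :: "'k::field \<Rightarrow> 'a::{ring,monoid_mult} \<Rightarrow> 'a" +
  fixes P :: "nat \<Rightarrow> (('a \<times> 'a \<Rightarrow>\<^sub>0 'k) set, 'f, 'u) module_scheme" and d :: "nat \<Rightarrow> 'f \<Rightarrow> 'f"
    and e :: "'f \<Rightarrow> 'a"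
  assumes resolution: "fg_projective_resolution (env_alg sc) (diagonal_bimod sc) P d e"
    and splits: "splits_at (env_alg sc) P d (Suc (Suc 0))"
    and ext_iso: "lmod_iso (env_alg sc) (Ext_env sc P d (Suc (Suc 0))) (diagonal_bimod sc)"

text \<open>
  The resolution that computes \<open>Ext\<close> may be infinite. Comparison with a finite one splits a high
  syzygy, and the vanishing of \<open>Ext\<^sup>i(A, A\<^sup>e)\<close> for \<open>i > 2\<close> carries the splitting down to degree two.
\<close>

lemma (in k_algebra) calabi_yau_2_resolution:
  assumes "calabi_yau_2 sc"
  obtains P :: "nat \<Rightarrow> (('a \<times> 'a \<Rightarrow>\<^sub>0 'k) set, nat \<Rightarrow> ('a \<times> 'a \<Rightarrow>\<^sub>0 'k) set) module" and d e
  where "cy2_resolution sc P d e"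
proof -
  obtain Q :: "nat \<Rightarrow> (('a \<times> 'a \<Rightarrow>\<^sub>0 'k) set, nat \<Rightarrow> ('a \<times> 'a \<Rightarrow>\<^sub>0 'k) set) module" and \<delta> \<epsilon>
    where Q: "fg_projective_resolution E (diagonal_bimod sc) Q \<delta> \<epsilon>" "finite_length Q"
    using assms by (auto simp: calabi_yau_2_def homologically_smooth_def)
  obtain P :: "nat \<Rightarrow> (('a \<times> 'a \<Rightarrow>\<^sub>0 'k) set, nat \<Rightarrow> ('a \<times> 'a \<Rightarrow>\<^sub>0 'k) set) module" and d e
    where P: "fg_projective_resolution E (diagonal_bimod sc) P d e"
      and iso: "lmod_iso E (Ext_env sc P d 2) (diagonal_bimod sc)"
      and Ext: "\<And>i. i \<noteq> 2 \<Longrightarrow> carrier (Ext_env sc P d i) = {\<zero>\<^bsub>Ext_env sc P d i\<^esub>}"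
    using assms by (auto simp: calabi_yau_2_def)
  obtain N where N: "\<And>i. i > N \<Longrightarrow> carrier (Q i) = {\<zero>\<^bsub>Q i\<^esub>}"
    using Q(2) by (auto simp: finite_length_def)
  have top: "splits_at E P d (N + 3)"
    using splits_at_if_finite_resolution[OF left_module_diagonal P Q(1)] N by simp
  have down: "splits_at E P d i" if "splits_at E P d (Suc i)" "i \<ge> 2" for i
  proof (rule splits_at_descend[OF P that(1)])
    fix f assume f: "f \<in> lmod_hom E (P (Suc i)) (regular_lmod E)"
      "\<And>x. x \<in> carrier (P (Suc (Suc i))) \<Longrightarrow> f (d (Suc i) x) = \<zero>\<^bsub>E\<^esub>"
    have "f \<in> coboundaries sc P d (Suc i)"
      using f that(2) by (intro cocycle_is_coboundary_if_Ext_zero[OF P Ext]) (auto simp: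
          mem_cocycles_iff)
    then show "\<exists>g\<in>lmod_hom E (P i) (regular_lmod E). \<forall>y\<in>carrier (P (Suc i)). f y = g (d i y)"
      by (auto simp: mem_coboundaries_iff)
  qed
  have "splits_at E P d (2 + k) \<Longrightarrow> splits_at E P d 2" for k
    by (induction k) (auto dest: down)
  from this[of "N + 1"] top have "splits_at E P d 2" by (simp add: numeral_3_eq_3)
  then have "cy2_resolution sc P d e"
    using P iso by unfold_locales (simp_all add: numeral_2_eq_2)
  then show ?thesis by (rule that)
qed

section \<open>Cochains with values in a finite-dimensional bimodule\<close>

abbreviation (input) fun_scale :: "('k \<Rightarrow> 'v \<Rightarrow> 'v) \<Rightarrow> 'k \<Rightarrow> ('x \<Rightarrow> 'v) \<Rightarrow> ('x \<Rightarrow> 'v)" where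
  "fun_scale s \<equiv> (\<lambda>c \<phi> x. s c (\<phi> x))"

abbreviation (input) pair_scale :: "('k \<Rightarrow> 'v \<Rightarrow> 'v) \<Rightarrow> ('k \<Rightarrow> 'w \<Rightarrow> 'w) \<Rightarrow> 'k \<Rightarrow> 'v \<times> 'w \<Rightarrow> 'v \<times> 'w" where
  "pair_scale s1 s2 \<equiv> (\<lambda>c x. (s1 c (fst x), s2 c (snd x)))"

lemma vector_space_fun_scale: "vector_space s \<Longrightarrow> vector_space (fun_scale s)"
  by (simp add: vector_space_def fun_eq_iff plus_fun_def)

lemma vector_space_pair_scale:
  "vector_space s1 \<Longrightarrow> vector_space s2 \<Longrightarrow> vector_space (pair_scale s1 s2)"
  by (simp add: vector_space_def prod_eq_iff)

lemma vector_space_field: "vector_space ((*) :: 'k::field \<Rightarrow> 'k \<Rightarrow> 'k)"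
  by unfold_locales (auto simp: algebra_simps)

lemma subspace_if_closed:
  assumes "vector_space s" "0 \<in> W" "\<And>x y. x \<in> W \<Longrightarrow> y \<in> W \<Longrightarrow> x + y \<in> W" "\<And>c x. x \<in> W \<Longrightarrow> s c x \<in> W"
  shows "module.subspace s W"
proof -
  interpret vector_space s by fact
  show ?thesis using assms(2-4) by (simp add: subspace_def)
qed

lemma linear_if_compatible:
  assumes "vector_space s1" "vector_space s2" "\<And>x y. f (x + y) = f x + f y" "\<And>c x. f (s1 c x) = s2
      c (f x)"
  shows "Vector_Spaces.linear s1 s2 f"
  using assms by (simp add: Vector_Spaces.linear_iff)

lemma frame_prod:
  fixes s1 :: "'k::field \<Rightarrow> 'v::ab_group_add \<Rightarrow> 'v" and s2 :: "'k \<Rightarrow> 'w::ab_group_add \<Rightarrow> 'w"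
    and I :: "'i set" and J :: "'j set"
  assumes s1: "vector_space s1" and s2: "vector_space s2"
    and U: "frame s1 U I u \<phi>" and W: "frame s2 W J w \<psi>"
  shows "frame (pair_scale s1 s2) (U \<times> W) (Inl ` I \<union> Inr ` J)
    (case_sum (\<lambda>i. (u i, 0)) (\<lambda>j. (0, w j))) (case_sum (\<lambda>i x. \<phi> i (fst x)) (\<lambda>j x. \<psi> j (snd x)))"
proof -
  interpret V1: vector_space s1 by fact
  interpret V2: vector_space s2 by fact
  note vp = vector_space_pair_scale[OF s1 s2]
  have sU: "V1.subspace U" and sW: "V2.subspace W" using U W by (simp_all add: frame_def)
  have disj: "Inl ` I \<inter> Inr ` J = {}" by auto
  note fin = frame_finite[OF s1 U] frame_finite[OF s2 W]
  have l1: "Vector_Spaces.linear (pair_scale s1 s2) (*) (\<lambda>x. \<phi> i (fst x))" if "i \<in> I" for i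
    using linear_functional_simps[OF s1 frame_linear[OF s1 U that]]
    by (intro linear_if_compatible vp vector_space_field) auto
  have l2: "Vector_Spaces.linear (pair_scale s1 s2) (*) (\<lambda>x. \<psi> j (snd x))" if "j \<in> J" for j
    using linear_functional_simps[OF s2 frame_linear[OF s2 W that]]
    by (intro linear_if_compatible vp vector_space_field) auto
  have ex: "x = (\<Sum>l\<in>Inl ` I \<union> Inr ` J. pair_scale s1 s2
      (case_sum (\<lambda>i x. \<phi> i (fst x)) (\<lambda>j x. \<psi> j (snd x)) l x) (case_sum (\<lambda>i. (u i, 0)) (\<lambda>j. (0, w
          j)) l))"
    if x: "x \<in> U \<times> W" for x
  proof -
    have "fst x \<in> U" "snd x \<in> W" using x by auto
    then show ?thesis
      using frame_expand[OF s1 U, of "fst x"] frame_expand[OF s2 W, of "snd x"]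
      by (simp add: sum.union_disjoint[OF _ _ disj] fin sum.reindex prod_eq_iff fst_sum snd_sum)
  qed
  show ?thesis
    unfolding frame_def
  proof (intro conjI ballI)
    show "finite (Inl ` I \<union> Inr ` J)" using fin by simp
    show "module.subspace (pair_scale s1 s2) (U \<times> W)"
      by (rule subspace_if_closed[OF vp])
         (auto simp: V1.subspace_0[OF sU] V2.subspace_0[OF sW] V1.subspace_add[OF sU]
             V2.subspace_add[OF sW]
            V1.subspace_scale[OF sU] V2.subspace_scale[OF sW] zero_prod_def)
    fix l :: "'i + 'j" assume "l \<in> Inl ` I \<union> Inr ` J"
    then show "case_sum (\<lambda>i. (u i, 0)) (\<lambda>j. (0, w j)) l \<in> U \<times> W"
      "Vector_Spaces.linear (pair_scale s1 s2) (*) (case_sum (\<lambda>i x. \<phi> i (fst x)) (\<lambda>j x. \<psi> j (snd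
          x)) l)"
      using frame_mem[OF s1 U] frame_mem[OF s2 W] V1.subspace_0[OF sU] V2.subspace_0[OF sW] l1 l2
      by (auto simp: zero_prod_def)
  qed (rule ex)
qed

lemma dim_prod:
  fixes s1 :: "'k::field_char_0 \<Rightarrow> 'v::ab_group_add \<Rightarrow> 'v" and s2 :: "'k \<Rightarrow> 'w::ab_group_add \<Rightarrow> 'w"
  assumes s1: "vector_space s1" and s2: "vector_space s2"
    and U: "module.subspace s1 U" "finite_dimensional s1 U"
    and W: "module.subspace s2 W" "finite_dimensional s2 W"
  shows "vector_space.dim (pair_scale s1 s2) (U \<times> W) = vector_space.dim s1 U + vector_space.dim s2
      W"
    and "finite_dimensional (pair_scale s1 s2) (U \<times> W)"
    and "module.subspace (pair_scale s1 s2) (U \<times> W)"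
proof -
  obtain I and u :: "'v \<Rightarrow> 'v" and \<phi> where fU: "frame s1 U I u \<phi>" using frame_exists[OF s1 U(2,1)]
      by blast
  obtain J and w :: "'w \<Rightarrow> 'w" and \<psi> where fW: "frame s2 W J w \<psi>" using frame_exists[OF s2 W(2,1)]
      by blast
  note fr = frame_prod[OF s1 s2 fU fW] and vp = vector_space_pair_scale[OF s1 s2]
  show "finite_dimensional (pair_scale s1 s2) (U \<times> W)" by (rule frame_finite_dimensional[OF vp fr])
  show "module.subspace (pair_scale s1 s2) (U \<times> W)" using fr by (simp add: frame_def)
  have disj: "Inl ` I \<inter> Inr ` J = {}" by auto
  have "of_nat (vector_space.dim (pair_scale s1 s2) (U \<times> W)) =
      (of_nat (vector_space.dim s1 U + vector_space.dim s2 W) :: 'k)"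
    using frame_finite[OF s1 fU] frame_finite[OF s2 fW]
    by (simp add: dim_eq_frame_trace[OF vp fr] dim_eq_frame_trace[OF s1 fU] dim_eq_frame_trace[OF
        s2 fW]
        sum.union_disjoint[OF _ _ disj] sum.reindex)
  then show "vector_space.dim (pair_scale s1 s2) (U \<times> W) = vector_space.dim s1 U +
      vector_space.dim s2 W"
    using of_nat_eq_iff by blast
qed

context k_algebra
begin

lemma hom_bimodD:
  assumes "\<phi> \<in> lmod_hom E Q (bimod s act)"
  shows "x \<in> carrier Q \<Longrightarrow> y \<in> carrier Q \<Longrightarrow> \<phi> (x \<oplus>\<^bsub>Q\<^esub> y) = \<phi> x + \<phi> y"
    "t \<in> carrier E \<Longrightarrow> x \<in> carrier Q \<Longrightarrow> \<phi> (t \<odot>\<^bsub>Q\<^esub> x) = t \<odot>\<^bsub>bimod s act\<^esub> \<phi> x"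
    "x \<notin> carrier Q \<Longrightarrow> \<phi> x = 0"
  using lmod_homD[OF assms] by simp_all

lemma hom_bimod_minus:
  assumes "bimodule_action s act" "left_module E Q" "\<phi> \<in> lmod_hom E Q (bimod s act)" "x \<in> carrier
      Q" "y \<in> carrier Q"
  shows "\<phi> (x \<ominus>\<^bsub>Q\<^esub> y) = \<phi> x - \<phi> y"
proof -
  interpret Q: left_module E Q by fact
  have "\<phi> ((x \<ominus>\<^bsub>Q\<^esub> y) \<oplus>\<^bsub>Q\<^esub> y) = \<phi> (x \<ominus>\<^bsub>Q\<^esub> y) + \<phi> y"
    using assms(4,5) by (intro hom_bimodD(1)[OF assms(3)]) auto
  moreover have "(x \<ominus>\<^bsub>Q\<^esub> y) \<oplus>\<^bsub>Q\<^esub> y = x" using assms(4,5) by (simp add: a_minus_def Q.M.a_assoc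
      Q.M.l_neg)
  ultimately show ?thesis by simp
qed

lemma hom_bimod_zero:
  assumes "bimodule_action s act" "left_module E Q" "\<phi> \<in> lmod_hom E Q (bimod s act)"
  shows "\<phi> \<zero>\<^bsub>Q\<^esub> = 0"
  using lmod_hom_zero[OF assms(2) left_module_bimod[OF assms(1)] assms(3)] by simp

lemma bimod_linear:
  assumes "bimodule_action s act"
  shows "t \<odot>\<^bsub>bimod s act\<^esub> (x + y) = t \<odot>\<^bsub>bimod s act\<^esub> x + t \<odot>\<^bsub>bimod s act\<^esub> y"
    "t \<odot>\<^bsub>bimod s act\<^esub> (s c x) = s c (t \<odot>\<^bsub>bimod s act\<^esub> x)"
    "t \<odot>\<^bsub>bimod s act\<^esub> (\<Sum>i\<in>I. g i) = (\<Sum>i\<in>I. t \<odot>\<^bsub>bimod s act\<^esub> g i)"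
    "t \<odot>\<^bsub>bimod s act\<^esub> (x - y) = t \<odot>\<^bsub>bimod s act\<^esub> x - t \<odot>\<^bsub>bimod s act\<^esub> y"
    "t \<odot>\<^bsub>bimod s act\<^esub> (- x) = - (t \<odot>\<^bsub>bimod s act\<^esub> x)"
    "t \<odot>\<^bsub>bimod s act\<^esub> 0 = 0"
proof -
  note D = bimodule_actionD[OF assms]
  show 1: "t \<odot>\<^bsub>bimod s act\<^esub> (x + y) = t \<odot>\<^bsub>bimod s act\<^esub> x + t \<odot>\<^bsub>bimod s act\<^esub> y" for x y
    by (rule bimod_smult_linear(1)) (fact D)+
  show "t \<odot>\<^bsub>bimod s act\<^esub> (s c x) = s c (t \<odot>\<^bsub>bimod s act\<^esub> x)"
    by (rule bimod_smult_linear(2)) (fact D)+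
  show 0: "t \<odot>\<^bsub>bimod s act\<^esub> 0 = 0" using 1[of 0 0] by simp
  show "t \<odot>\<^bsub>bimod s act\<^esub> (\<Sum>i\<in>I. g i) = (\<Sum>i\<in>I. t \<odot>\<^bsub>bimod s act\<^esub> g i)"
    by (induction I rule: infinite_finite_induct) (simp_all add: 0 1)
  show "t \<odot>\<^bsub>bimod s act\<^esub> (x - y) = t \<odot>\<^bsub>bimod s act\<^esub> x - t \<odot>\<^bsub>bimod s act\<^esub> y"
    using 1[of "x - y" y] by (simp add: algebra_simps)
  show "t \<odot>\<^bsub>bimod s act\<^esub> (- x) = - (t \<odot>\<^bsub>bimod s act\<^esub> x)"
    using 1[of x "- x"] by (simp add: 0 eq_neg_iff_add_eq_0 add.commute)
qed

lemma act_linear: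
  assumes "bimodule_action s act"
  shows "act a (x + y) b = act a x b + act a y b" "act a (s c x) b = s c (act a x b)"
    "act a (\<Sum>i\<in>I. g i) b = (\<Sum>i\<in>I. act a (g i) b)" "act a (x - y) b = act a x b - act a y b"
    "act a (- x) b = - act a x b" "act a 0 b = 0"
  using bimod_linear[OF assms, of "tensor sc a b"] by (simp_all add: tensor_smult[OF assms])

lemma act_bilinear:
  assumes "bimodule_action s act"
  shows "act (a + a') x b = act a x b + act a' x b" "act a x (b + b') = act a x b + act a x b'"
    "act (sc c a) x b = s c (act a x b)" "act a x (sc c b) = s c (act a x b)"
    "act 0 x b = 0" "act a x 0 = 0"
proof -
  note B = bimodule_actionD(2)[OF assms, unfolded bilinear_on_def]
  show "act (a + a') x b = act a x b + act a' x b" "act a x (b + b') = act a x b + act a x b'"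
    "act (sc c a) x b = s c (act a x b)" "act a x (sc c b) = s c (act a x b)" for a a' b b' using
        B by auto
  from this(1)[of 0 0] this(2)[of _ 0 0] show "act 0 x b = 0" "act a x 0 = 0" by simp_all
qed

lemma hom_bimod_subspace:
  assumes "bimodule_action s act"
  shows "module.subspace (fun_scale s) (lmod_hom E Q (bimod s act))"
proof -
  note D = bimodule_actionD[OF assms] and L = bimod_linear[OF assms]
  interpret V: vector_space s by (rule D(1))
  show ?thesis
  proof (rule subspace_if_closed[OF vector_space_fun_scale[OF D(1)]])
    show "0 \<in> lmod_hom E Q (bimod s act)" by (rule lmod_homI) (simp_all add: L zero_fun_def)
    show "\<phi> + \<psi> \<in> lmod_hom E Q (bimod s act)"
      if "\<phi> \<in> lmod_hom E Q (bimod s act)" "\<psi> \<in> lmod_hom E Q (bimod s act)" for \<phi> \<psi>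
      using lmod_hom_add[OF left_module_bimod[OF assms] that] by (simp add: plus_fun_def)
    show "fun_scale s c \<phi> \<in> lmod_hom E Q (bimod s act)" if "\<phi> \<in> lmod_hom E Q (bimod s act)" for c \<phi>
      by (rule lmod_homI) (simp_all add: hom_bimodD[OF that] L V.scale_right_distrib)
  qed
qed

lemma dual_basis_expand_bimod:
  assumes "bimodule_action s act" "dual_basis E Q I b f" "\<phi> \<in> lmod_hom E Q (bimod s act)" "x \<in>
      carrier Q"
  shows "\<phi> x = (\<Sum>i\<in>I. f i x \<odot>\<^bsub>bimod s act\<^esub> \<phi> (b i))"
  using dual_basis_expand_hom[OF assms(2) left_module_bimod[OF assms(1)] assms(3,4)]
    bimod_finsum[OF dual_basisD(2)[OF assms(2)]] by simp

text \<open>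
  The cochains that factor through an idempotent \<open>p\<close> of \<open>Q\<close> are the homomorphisms from the
  projective module \<open>p Q\<close>. The frame expresses \<open>\<phi>\<close> by its values on the dual basis, and those
  values by their coordinates.
\<close>

lemma hom_frame:
  fixes Q :: "(('a \<times> 'a \<Rightarrow>\<^sub>0 'k) set, 'q, 'z) module_scheme" and I :: "'i set" and J :: "'j set"
    and s :: "'k \<Rightarrow> 'v::ab_group_add \<Rightarrow> 'v"
  assumes act: "bimodule_action s act" and db: "dual_basis E Q I b f"
    and p: "p \<in> lmod_hom E Q Q" "\<And>x. x \<in> carrier Q \<Longrightarrow> p (p x) = p x"
    and V: "frame s UNIV J v \<mu>"
  shows "frame (fun_scale s) {\<phi> \<in> lmod_hom E Q (bimod s act). \<forall>x\<in>carrier Q. \<phi> (p x) = \<phi> x} (I \<times> J)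
     (\<lambda>l x. f (fst l) (p x) \<odot>\<^bsub>bimod s act\<^esub> v (snd l)) (\<lambda>l \<phi>. \<mu> (snd l) (\<phi> (b (fst l))))"
proof -
  note A = bimodule_actionD[OF act] and D = dual_basisD[OF db] and L = bimod_linear[OF act]
  note Bm = left_module_bimod[OF act]
  interpret V: vector_space s by (rule A(1))
  interpret F: vector_space "fun_scale s" by (rule vector_space_fun_scale[OF A(1)])
  have sub: "F.subspace (lmod_hom E Q (bimod s act))" by (rule hom_bimod_subspace[OF act])
  have ev: "(\<Sum>l\<in>S. g l) x = (\<Sum>l\<in>S. g l x)" for S :: "('i \<times> 'j) set" and g :: "_ \<Rightarrow> 'q \<Rightarrow> 'v" and x
    by (induction S rule: infinite_finite_induct) simp_all
  show ?thesis
    unfolding frame_def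
  proof (intro conjI ballI)
    show "finite (I \<times> J)" using D(2) frame_finite[OF A(1) V] by simp
    show "F.subspace {\<phi> \<in> lmod_hom E Q (bimod s act). \<forall>x\<in>carrier Q. \<phi> (p x) = \<phi> x}"
      by (rule subspace_if_closed[OF vector_space_fun_scale[OF A(1)]])
        (auto simp: F.subspace_0[OF sub] F.subspace_add[OF sub] F.subspace_scale[OF sub])
  next
    fix l assume l: "l \<in> I \<times> J"
    have "(\<lambda>x. f (fst l) (p x) \<odot>\<^bsub>bimod s act\<^esub> v (snd l)) \<in> lmod_hom E Q (bimod s act)"
      using l by (intro lmod_hom_smult_right[OF Bm] lmod_hom_comp[OF D(1) E_regular p(1) D(4)]) auto
    then show "(\<lambda>x. f (fst l) (p x) \<odot>\<^bsub>bimod s act\<^esub> v (snd l))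
        \<in> {\<phi> \<in> lmod_hom E Q (bimod s act). \<forall>x\<in>carrier Q. \<phi> (p x) = \<phi> x}"
      by (simp add: p(2))
    show "Vector_Spaces.linear (fun_scale s) (*) (\<lambda>\<phi>. \<mu> (snd l) (\<phi> (b (fst l))))"
      using l linear_functional_simps[OF A(1) frame_linear[OF A(1) V, of "snd l"]]
      by (intro linear_if_compatible F.vector_space_axioms vector_space_field) auto
  next
    fix \<phi> assume "\<phi> \<in> {\<phi> \<in> lmod_hom E Q (bimod s act). \<forall>x\<in>carrier Q. \<phi> (p x) = \<phi> x}"
    then have \<phi>: "\<phi> \<in> lmod_hom E Q (bimod s act)" "\<And>x. x \<in> carrier Q \<Longrightarrow> \<phi> (p x) = \<phi> x" by auto
    show "\<phi> = (\<Sum>l\<in>I \<times> J. fun_scale s (\<mu> (snd l) (\<phi> (b (fst l))))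
        (\<lambda>x. f (fst l) (p x) \<odot>\<^bsub>bimod s act\<^esub> v (snd l)))"
    proof
      fix x
      have px: "\<phi> (p x) = \<phi> x"
        using \<phi>(2)[of x] lmod_homD(4)[OF p(1), of x] hom_bimodD(3)[OF \<phi>(1), of x]
            hom_bimod_zero[OF act D(1) \<phi>(1)]
        by (cases "x \<in> carrier Q") auto
      have "\<phi> x = (\<Sum>i\<in>I. f i (p x) \<odot>\<^bsub>bimod s act\<^esub> \<phi> (b i))"
        using dual_basis_expand_bimod[OF act db \<phi>(1) lmod_hom_range[OF D(1) p(1)]] px by simp
      also have "\<dots> = (\<Sum>i\<in>I. f i (p x) \<odot>\<^bsub>bimod s act\<^esub> (\<Sum>j\<in>J. s (\<mu> j (\<phi> (b i))) (v j)))"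
        using frame_expand[OF A(1) V] by simp
      also have "\<dots> = (\<Sum>i\<in>I. \<Sum>j\<in>J. s (\<mu> j (\<phi> (b i))) (f i (p x) \<odot>\<^bsub>bimod s act\<^esub> v j))"
        by (simp add: L)
      also have "\<dots> = (\<Sum>l\<in>I \<times> J. fun_scale s (\<mu> (snd l) (\<phi> (b (fst l))))
        (\<lambda>x. f (fst l) (p x) \<odot>\<^bsub>bimod s act\<^esub> v (snd l))) x"
        unfolding ev by (simp add: sum.cartesian_product case_prod_unfold)
      finally show "\<phi> x = (\<Sum>l\<in>I \<times> J. fun_scale s (\<mu> (snd l) (\<phi> (b (fst l))))
        (\<lambda>x. f (fst l) (p x) \<odot>\<^bsub>bimod s act\<^esub> v (snd l))) x" .
    qed
  qed
qed

end

section \<open>Derivations and one-cocycles\<close>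

context k_algebra
begin

definition derivations :: "('k \<Rightarrow> 'v::ab_group_add \<Rightarrow> 'v) \<Rightarrow> ('a \<Rightarrow> 'v \<Rightarrow> 'a \<Rightarrow> 'v) \<Rightarrow> ('a \<Rightarrow> 'v) set" where
  "derivations s act = {D. (\<forall>a b. D (a + b) = D a + D b) \<and> (\<forall>c a. D (sc c a) = s c (D a)) \<and>
     (\<forall>a b. D (a * b) = act a (D b) 1 + act 1 (D a) b)}"

definition bimod_cocycles ::
  "('k \<Rightarrow> 'v::ab_group_add \<Rightarrow> 'v) \<Rightarrow> ('a \<Rightarrow> 'v \<Rightarrow> 'a \<Rightarrow> 'v) \<Rightarrow>
     (nat \<Rightarrow> (('a \<times> 'a \<Rightarrow>\<^sub>0 'k) set, 'f, 'u) module_scheme) \<Rightarrow> (nat \<Rightarrow> 'f \<Rightarrow> 'f) \<Rightarrow> nat \<Rightarrow> ('f \<Rightarrow> 'v) set"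
         where
  "bimod_cocycles s act P d i =
     {\<phi> \<in> lmod_hom E (P i) (bimod s act). \<forall>x\<in>carrier (P (Suc i)). \<phi> (d i x) = 0}"

lemma bimod_cocycles_subspace:
  assumes "bimodule_action s act"
  shows "module.subspace (fun_scale s) (bimod_cocycles s act P d i)"
proof -
  note A = bimodule_actionD[OF assms]
  interpret V: vector_space s by (rule A(1))
  interpret F: vector_space "fun_scale s" by (rule vector_space_fun_scale[OF A(1)])
  have sub: "F.subspace (lmod_hom E (P i) (bimod s act))" by (rule hom_bimod_subspace[OF assms])
  show ?thesis unfolding bimod_cocycles_def
    by (rule subspace_if_closed[OF F.vector_space_axioms])
       (auto simp: F.subspace_0[OF sub] F.subspace_add[OF sub] F.subspace_scale[OF sub])
qed

lemma tensor_add_left: "tensor sc (a + a') b = tensor sc a b \<oplus>\<^bsub>E\<^esub> tensor sc a' b"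
  and tensor_add_right: "tensor sc a (b + b') = tensor sc a b \<oplus>\<^bsub>E\<^esub> tensor sc a b'"
  and tensor_scale_swap: "tensor sc (sc c a) b = tensor sc a (sc c b)"
  and tensor_zero_right: "tensor sc a 0 = \<zero>\<^bsub>E\<^esub>"
proof -
  interpret E: ring E by (rule env_ring)
  note gen = bilin_generators_mem[where sc = sc]
  show "tensor sc (a + a') b = tensor sc a b \<oplus>\<^bsub>E\<^esub> tensor sc a' b"
    using gen(1) by (simp add: tensor_def env_class_ops, intro env_class_eq) (simp add:
        algebra_simps)
  show r: "tensor sc a (b + b') = tensor sc a b \<oplus>\<^bsub>E\<^esub> tensor sc a b'" for b b'
    using gen(2) by (simp add: tensor_def env_class_ops, intro env_class_eq) (simp add:
        algebra_simps)
  show "tensor sc (sc c a) b = tensor sc a (sc c b)"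
    using env_class_eq[OF gen(3)[of c a b]] env_class_eq[OF gen(4)[of a c b]] by (simp add:
        tensor_def)
  show "tensor sc a 0 = \<zero>\<^bsub>E\<^esub>"
    using r[of 0 0] tensor_closed[of a 0] by (metis E.add.r_cancel_one' add_0)
qed

lemma act_combine:
  assumes "bimodule_action s act"
  shows "act a (act c x d) b = act (a * c) x (d * b)" "act 1 x 1 = x"
  using bimodule_actionD(5,6)[OF assms] by auto

text \<open>
  The syzygy of \<open>A\<close> with respect to the multiplication \<open>A \<otimes> A\<^sup>o\<^sup>p \<rightarrow> A\<close> is generated by the
  elements \<open>a \<otimes> 1 - 1 \<otimes> a\<close>, and its homomorphisms to \<open>V\<close> are the derivations. Schanuel's lemma
  compares it with the syzygy of the given resolution, whose homomorphisms to \<open>V\<close> are the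
  one-cocycles. The generator \<open>1\<close> of \<open>A\<close> lifts to \<open>x0\<close>, and \<open>\<epsilon>\<close> lifts the augmentation to
  \<open>A \<otimes> A\<^sup>o\<^sup>p\<close>; a one-cocycle and a vector of \<open>V\<close> are sent to the sum of the induced derivation and
  of an inner one.
\<close>

lemma derivation_exact_sequence:
  fixes s :: "'k \<Rightarrow> 'v::ab_group_add \<Rightarrow> 'v" and P :: "nat \<Rightarrow> (('a \<times> 'a \<Rightarrow>\<^sub>0 'k) set, 'f, 'u)
      module_scheme"
  assumes act: "bimodule_action s act"
    and P: "fg_projective_resolution E (diagonal_bimod sc) P d e"
  obtains \<Phi> \<Psi> where
    "Vector_Spaces.linear (pair_scale (fun_scale s) s) (fun_scale s) \<Phi>"
    "Vector_Spaces.linear (fun_scale s) (pair_scale (fun_scale s) s) \<Psi>"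
    "\<Phi> ` (bimod_cocycles s act P d (Suc 0) \<times> UNIV) = derivations s act"
    "{w \<in> bimod_cocycles s act P d (Suc 0) \<times> UNIV. \<Phi> w = 0} = \<Psi> ` lmod_hom E (P 0) (bimod s act)"
    "\<forall>\<psi>\<in>lmod_hom E (P 0) (bimod s act). \<Psi> \<psi> = 0 \<longrightarrow> \<psi> = 0"
proof -
  note PD = resolutionD[OF P] and A = bimodule_actionD[OF act] and L = bimod_linear[OF act]
  note B = act_linear[OF act] act_bilinear[OF act] act_combine[OF act]
  note ts = tensor_smult[OF act]
  let ?Z = "bimod_cocycles s act P d (Suc 0)" and ?C = "lmod_hom E (P 0) (bimod s act)"
  let ?D = "diagonal_bimod sc" and ?V = "bimod s act"
  interpret E: ring E by (rule env_ring)
  interpret V: vector_space s by (rule A(1))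
  interpret F: vector_space "fun_scale s" by (rule vector_space_fun_scale[OF A(1)])
  interpret PF: vector_space "pair_scale (fun_scale s) s"
    by (rule vector_space_pair_scale[OF F.vector_space_axioms A(1)])
  interpret P0: left_module E "P 0" by (rule PD(1))
  interpret P1: left_module E "P (Suc 0)" by (rule PD(1))
  interpret VM: left_module E ?V by (rule left_module_bimod[OF act])
  interpret DM: left_module E ?D by (rule left_module_diagonal)
  have Ds: "x \<oplus>\<^bsub>?D\<^esub> y = x + y" "\<zero>\<^bsub>?D\<^esub> = 0" "carrier ?D = UNIV" "tensor sc a b \<odot>\<^bsub>?D\<^esub> x = a * x * b"
      for x y a b
    by (simp_all add: diagonal_bimod_def tensor_smult[OF diagonal_action])
  have cocycleD: "\<phi> \<in> lmod_hom E (P (Suc 0)) ?V" "\<And>x. x \<in> carrier (P (Suc (Suc 0))) \<Longrightarrow> \<phi> (d (Suc 0)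
      x) = 0"
    if "\<phi> \<in> ?Z" for \<phi> using that by (auto simp: bimod_cocycles_def)
  have ed: "e (d 0 x) = 0" if "x \<in> carrier (P (Suc 0))" for x
    using PD(6) that by (auto simp: syzygy_def Ds)
  have dd: "d 0 (d (Suc 0) x) = \<zero>\<^bsub>P 0\<^esub>" if "x \<in> carrier (P (Suc (Suc 0)))" for x
    using PD(7)[of 0] that by (auto simp: syzygy_def)
  have d0c: "d 0 x \<in> carrier (P 0)" if "x \<in> carrier (P (Suc 0))" for x
    using lmod_homD(1)[OF PD(3) that] .
  \<comment> \<open>A cocycle depends only on the boundary of its argument.\<close>
  have wd: "\<phi> x = \<phi> y" if \<phi>: "\<phi> \<in> ?Z" and x: "x \<in> carrier (P (Suc 0))" and y: "y \<in> carrier (P (Suc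
      0))"
    and eq: "d 0 x = d 0 y" for \<phi> x y
  proof -
    have "d 0 (x \<ominus>\<^bsub>P (Suc 0)\<^esub> y) = \<zero>\<^bsub>P 0\<^esub>"
      using lmod_hom_minus_arg[OF PD(1) PD(1) PD(3) x y] eq d0c[OF y] by (simp add: a_minus_def
          P0.M.r_neg)
    then have "x \<ominus>\<^bsub>P (Suc 0)\<^esub> y \<in> syzygy P d (Suc 0)" using x y by (simp add: PD(7))
    then have "\<phi> (x \<ominus>\<^bsub>P (Suc 0)\<^esub> y) = 0" using cocycleD(2)[OF \<phi>] by (auto simp: syzygy_def)
    then show ?thesis using hom_bimod_minus[OF act PD(1) cocycleD(1)[OF \<phi>] x y] by simp
  qed
  obtain x0 where x0: "x0 \<in> carrier (P 0)" "e x0 = 1" using PD(5) Ds(3) by (metis UNIV_I imageE)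
  define X where "X t = t \<odot>\<^bsub>P 0\<^esub> x0" for t
  have Xc: "X t \<in> carrier (P 0)" if "t \<in> carrier E" for t
    using that x0 by (simp add: X_def P0.smult_closed)
  have Xadd: "X (t \<oplus>\<^bsub>E\<^esub> u) = X t \<oplus>\<^bsub>P 0\<^esub> X u" if "t \<in> carrier E" "u \<in> carrier E" for t u
    using that x0 by (simp add: X_def P0.smult_l_distr)
  have Xmul: "X (t \<otimes>\<^bsub>E\<^esub> u) = t \<odot>\<^bsub>P 0\<^esub> X u" if "t \<in> carrier E" "u \<in> carrier E" for t u
    using that x0 by (simp add: X_def P0.smult_assoc)
  have smul_minus: "t \<odot>\<^bsub>P 0\<^esub> (x \<ominus>\<^bsub>P 0\<^esub> y) = t \<odot>\<^bsub>P 0\<^esub> x \<ominus>\<^bsub>P 0\<^esub> t \<odot>\<^bsub>P 0\<^esub> y"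
    if "t \<in> carrier E" "x \<in> carrier (P 0)" "y \<in> carrier (P 0)" for t x y
    using that by (simp add: a_minus_def P0.smult_r_distr P0.smult_neg)
  have eX: "e (X t) = t \<odot>\<^bsub>?D\<^esub> 1" if "t \<in> carrier E" for t
    using lmod_homD(3)[OF PD(4) that x0(1)] by (simp add: X_def x0)
  define w where "w a = X (tensor sc a 1) \<ominus>\<^bsub>P 0\<^esub> X (tensor sc 1 a)" for a
  have wc: "w a \<in> carrier (P 0)" for a by (simp add: w_def Xc P0.M.minus_closed)
  have "\<exists>y\<in>carrier (P (Suc 0)). d 0 y = w a" for a
  proof -
    have "e (w a) = 0"
      unfolding w_def using lmod_hom_minus_arg[OF PD(1) left_module_diagonal PD(4), of "X (tensor
          sc a 1)" "X (tensor sc 1 a)"]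
        DM.M.r_neg[of a] by (simp add: Xc eX Ds a_minus_def)
    then have "w a \<in> syzygy P d 0" by (simp add: PD(6) wc Ds)
    then show ?thesis by (auto simp: syzygy_def)
  qed
  then obtain y where y: "\<And>a. y a \<in> carrier (P (Suc 0))" "\<And>a. d 0 (y a) = w a" by metis
  have d_add: "d 0 (u \<oplus>\<^bsub>P (Suc 0)\<^esub> v) = d 0 u \<oplus>\<^bsub>P 0\<^esub> d 0 v" "d 0 (u \<ominus>\<^bsub>P (Suc 0)\<^esub> v) = d 0 u \<ominus>\<^bsub>P 0\<^esub>
      d 0 v"
    if "u \<in> carrier (P (Suc 0))" "v \<in> carrier (P (Suc 0))" for u v
    using lmod_homD(2)[OF PD(3) that] lmod_hom_minus_arg[OF PD(1) PD(1) PD(3) that] by auto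
  have d_mul: "d 0 (t \<odot>\<^bsub>P (Suc 0)\<^esub> u) = t \<odot>\<^bsub>P 0\<^esub> d 0 u" if "t \<in> carrier E" "u \<in> carrier (P (Suc
      0))" for t u
    using lmod_homD(3)[OF PD(3) that] .
  \<comment> \<open>The relations between the elements \<open>a \<otimes> 1 - 1 \<otimes> a\<close>.\<close>
  have y_add: "d 0 (y (a + b)) = d 0 (y a \<oplus>\<^bsub>P (Suc 0)\<^esub> y b)" for a b
    by (simp add: y d_add w_def tensor_add_left tensor_add_right Xadd)
       (simp add: a_minus_def P0.M.minus_add P0.M.a_ac Xc)
  have y_scale: "d 0 (y (sc c a)) = d 0 (tensor sc (sc c 1) 1 \<odot>\<^bsub>P (Suc 0)\<^esub> y a)" for c a
    by (simp add: y d_mul w_def smul_minus Xc Xmul[symmetric] tensor_mult scale_mult_left)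
       (simp add: tensor_scale_swap[of c 1 a, symmetric])
  have y_mult: "d 0 (y (a * b)) =
      d 0 (tensor sc a 1 \<odot>\<^bsub>P (Suc 0)\<^esub> y b \<oplus>\<^bsub>P (Suc 0)\<^esub> tensor sc 1 b \<odot>\<^bsub>P (Suc 0)\<^esub> y a)" for a b
  proof -
    let ?p = "X (tensor sc (a * b) 1)" and ?q = "X (tensor sc a b)" and ?r = "X (tensor sc 1 (a *
        b))"
    have "(?p \<ominus>\<^bsub>P 0\<^esub> ?q) \<oplus>\<^bsub>P 0\<^esub> (?q \<ominus>\<^bsub>P 0\<^esub> ?r) = ?p \<oplus>\<^bsub>P 0\<^esub> (\<ominus>\<^bsub>P 0\<^esub> ?q \<oplus>\<^bsub>P 0\<^esub> ?q) \<oplus>\<^bsub>P 0\<^esub> \<ominus>\<^bsub>P 0\<^esub> ?r"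
      by (simp add: a_minus_def P0.M.a_assoc Xc)
    also have "\<dots> = ?p \<ominus>\<^bsub>P 0\<^esub> ?r" by (simp add: P0.M.l_neg Xc a_minus_def)
    finally show ?thesis
      by (simp add: y d_add d_mul P1.smult_closed w_def smul_minus Xc Xmul[symmetric] tensor_mult)
  qed
  \<comment> \<open>Every \<open>t\<close> is congruent to \<open>1 \<otimes> \<mu>(t)\<close>, where \<open>\<mu>\<close> is the multiplication.\<close>
  have reduce: "\<exists>u\<in>carrier (P (Suc 0)). d 0 u = X t \<ominus>\<^bsub>P 0\<^esub> X (tensor sc 1 (t \<odot>\<^bsub>?D\<^esub> 1)) \<and>
      (\<forall>\<phi>\<in>?Z. \<forall>v. (\<forall>a. \<phi> (y a) = act a v 1 - act 1 v a) \<longrightarrow>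
         \<phi> u = t \<odot>\<^bsub>?V\<^esub> v - act 1 v (t \<odot>\<^bsub>?D\<^esub> 1))" if "t \<in> carrier E" for t
    using that
  proof (induction t rule: env_induct)
    case (tensor a b)
    have "d 0 (tensor sc 1 b \<odot>\<^bsub>P (Suc 0)\<^esub> y a) =
        X (tensor sc a b) \<ominus>\<^bsub>P 0\<^esub> X (tensor sc 1 (tensor sc a b \<odot>\<^bsub>?D\<^esub> 1))"
      by (simp add: y d_mul w_def smul_minus Xc Xmul[symmetric] tensor_mult Ds)
    moreover have "\<phi> (tensor sc 1 b \<odot>\<^bsub>P (Suc 0)\<^esub> y a) =
        tensor sc a b \<odot>\<^bsub>?V\<^esub> v - act 1 v (tensor sc a b \<odot>\<^bsub>?D\<^esub> 1)"
      if "\<phi> \<in> ?Z" "\<forall>a. \<phi> (y a) = act a v 1 - act 1 v a" for \<phi> v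
      using that by (simp add: hom_bimodD(2)[OF cocycleD(1)] y ts B Ds)
    ultimately show ?case by (intro bexI[of _ "tensor sc 1 b \<odot>\<^bsub>P (Suc 0)\<^esub> y a"]) (auto simp:
        P1.smult_closed y)
  next
    case (add t t')
    then obtain u u' where u: "u \<in> carrier (P (Suc 0))" "d 0 u = X t \<ominus>\<^bsub>P 0\<^esub> X (tensor sc 1 (t
        \<odot>\<^bsub>?D\<^esub> 1))"
      "\<And>\<phi> v. \<phi> \<in> ?Z \<Longrightarrow> \<forall>a. \<phi> (y a) = act a v 1 - act 1 v a \<Longrightarrow>
         \<phi> u = t \<odot>\<^bsub>?V\<^esub> v - act 1 v (t \<odot>\<^bsub>?D\<^esub> 1)"
      and u': "u' \<in> carrier (P (Suc 0))" "d 0 u' = X t' \<ominus>\<^bsub>P 0\<^esub> X (tensor sc 1 (t' \<odot>\<^bsub>?D\<^esub> 1))"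
      "\<And>\<phi> v. \<phi> \<in> ?Z \<Longrightarrow> \<forall>a. \<phi> (y a) = act a v 1 - act 1 v a \<Longrightarrow>
         \<phi> u' = t' \<odot>\<^bsub>?V\<^esub> v - act 1 v (t' \<odot>\<^bsub>?D\<^esub> 1)" by blast
    have Dadd: "(t \<oplus>\<^bsub>E\<^esub> t') \<odot>\<^bsub>?D\<^esub> 1 = t \<odot>\<^bsub>?D\<^esub> 1 + t' \<odot>\<^bsub>?D\<^esub> 1"
      using DM.smult_l_distr[OF add(1,2), of 1] by (simp add: Ds)
    have Vadd: "(t \<oplus>\<^bsub>E\<^esub> t') \<odot>\<^bsub>?V\<^esub> v = t \<odot>\<^bsub>?V\<^esub> v + t' \<odot>\<^bsub>?V\<^esub> v" for v
      using VM.smult_l_distr[OF add(1,2), of v] by simp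
    have "d 0 (u \<oplus>\<^bsub>P (Suc 0)\<^esub> u') = X (t \<oplus>\<^bsub>E\<^esub> t') \<ominus>\<^bsub>P 0\<^esub> X (tensor sc 1 ((t \<oplus>\<^bsub>E\<^esub> t') \<odot>\<^bsub>?D\<^esub> 1))"
      using add(1,2)
      by (simp add: d_add u(1,2) u'(1,2) Dadd tensor_add_right Xadd)
         (simp add: a_minus_def P0.M.minus_add P0.M.a_ac Xc)
    moreover have "\<phi> (u \<oplus>\<^bsub>P (Suc 0)\<^esub> u') =
        (t \<oplus>\<^bsub>E\<^esub> t') \<odot>\<^bsub>?V\<^esub> v - act 1 v ((t \<oplus>\<^bsub>E\<^esub> t') \<odot>\<^bsub>?D\<^esub> 1)"
      if "\<phi> \<in> ?Z" "\<forall>a. \<phi> (y a) = act a v 1 - act 1 v a" for \<phi> v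
      using u(3)[OF that] u'(3)[OF that] hom_bimodD(1)[OF cocycleD(1)[OF that(1)] u(1) u'(1)]
      by (simp add: Dadd Vadd B)
    moreover have "u \<oplus>\<^bsub>P (Suc 0)\<^esub> u' \<in> carrier (P (Suc 0))" using u(1) u'(1) by simp
    ultimately show ?case by blast
  qed
  \<comment> \<open>Subtracting \<open>\<epsilon>(x) x0\<close> moves \<open>x\<close> into the kernel of \<open>e\<close>, so the difference lifts to \<open>\<rho>(x)\<close>.\<close>
  obtain I and b :: "'f \<Rightarrow> 'f" and f where pb: "dual_basis E (P 0) I b f" using PD(2)[of 0] by blast
  define \<mu> where "\<mu> t = (if t \<in> carrier E then t \<odot>\<^bsub>?D\<^esub> 1 else 0)" for t
  have \<mu>: "\<mu> \<in> lmod_hom E (regular_lmod E) ?D"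
    by (rule lmod_homI) (use DM.smult_l_distr[of _ _ 1] DM.smult_assoc[of _ _ 1] in \<open>simp_all add:
        \<mu>_def Ds\<close>)
  have "\<exists>\<epsilon>\<in>lmod_hom E (P 0) (regular_lmod E). \<forall>x\<in>carrier (P 0). \<mu> (\<epsilon> x) = e x"
  proof (rule projective_lift[OF pb E_regular left_module_diagonal PD(4) \<mu>])
    fix x
    have "e x = \<mu> (tensor sc (e x) 1)" by (simp add: \<mu>_def Ds)
    then show "e x \<in> \<mu> ` carrier (regular_lmod E)"
      by (rule image_eqI) simp
  qed
  then obtain \<epsilon> where \<epsilon>: "\<epsilon> \<in> lmod_hom E (P 0) (regular_lmod E)"
    and "\<And>x. x \<in> carrier (P 0) \<Longrightarrow> \<mu> (\<epsilon> x) = e x" by blast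
  moreover have \<epsilon>c: "\<epsilon> x \<in> carrier E" for x using lmod_hom_range[OF E_regular \<epsilon>] by simp
  ultimately have \<epsilon>e: "\<epsilon> x \<odot>\<^bsub>?D\<^esub> 1 = e x" if "x \<in> carrier (P 0)" for x using that by (simp add:
      \<mu>_def)
  have \<epsilon>m: "\<epsilon> (t \<odot>\<^bsub>P 0\<^esub> x) = t \<otimes>\<^bsub>E\<^esub> \<epsilon> x" if "t \<in> carrier E" "x \<in> carrier (P 0)" for t x
    using lmod_homD(3)[OF \<epsilon> that] by simp
  have "(\<lambda>x. \<epsilon> x \<odot>\<^bsub>P 0\<^esub> x0) \<in> lmod_hom E (P 0) (P 0)"
    by (rule lmod_hom_smult_right[OF PD(1) x0(1) \<epsilon>])
  from lmod_hom_minus[OF PD(1) lmod_hom_id[OF PD(1)] this]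
  have \<gamma>: "(\<lambda>x. (if x \<in> carrier (P 0) then x else \<zero>\<^bsub>P 0\<^esub>) \<ominus>\<^bsub>P 0\<^esub> X (\<epsilon> x)) \<in> lmod_hom E (P 0) (P 0)"
    by (simp add: X_def)
  have "\<exists>\<rho>\<in>lmod_hom E (P 0) (P (Suc 0)). \<forall>x\<in>carrier (P 0).
      d 0 (\<rho> x) = (if x \<in> carrier (P 0) then x else \<zero>\<^bsub>P 0\<^esub>) \<ominus>\<^bsub>P 0\<^esub> X (\<epsilon> x)"
  proof (rule projective_lift[OF pb PD(1) PD(1) \<gamma> PD(3)])
    fix x assume x: "x \<in> carrier (P 0)"
    have "e (x \<ominus>\<^bsub>P 0\<^esub> X (\<epsilon> x)) = 0"
      using lmod_hom_minus_arg[OF PD(1) left_module_diagonal PD(4) x Xc[OF \<epsilon>c]] DM.M.r_neg[of "e x"]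
      by (simp add: eX[OF \<epsilon>c] \<epsilon>e[OF x] a_minus_def Ds)
    then have "x \<ominus>\<^bsub>P 0\<^esub> X (\<epsilon> x) \<in> syzygy P d 0" using x by (simp add: PD(6) Ds Xc \<epsilon>c
        P0.M.minus_closed)
    then show "(if x \<in> carrier (P 0) then x else \<zero>\<^bsub>P 0\<^esub>) \<ominus>\<^bsub>P 0\<^esub> X (\<epsilon> x) \<in> d 0 ` carrier (P (Suc 0))"
      using x by (simp add: syzygy_def)
  qed
  then obtain \<rho> where \<rho>: "\<rho> \<in> lmod_hom E (P 0) (P (Suc 0))"
    and d\<rho>: "\<And>x. x \<in> carrier (P 0) \<Longrightarrow> d 0 (\<rho> x) = x \<ominus>\<^bsub>P 0\<^esub> X (\<epsilon> x)" by auto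
  define \<Phi> where "\<Phi> = (\<lambda>(\<phi> :: 'f \<Rightarrow> 'v, v) a. \<phi> (y a) + act a v 1 - act 1 v a)"
  define \<Psi> where "\<Psi> = (\<lambda>\<psi> :: 'f \<Rightarrow> 'v. (\<lambda>x. \<psi> (d 0 x), - \<psi> x0))"
  have lin\<Phi>: "Vector_Spaces.linear (pair_scale (fun_scale s) s) (fun_scale s) \<Phi>"
    by (rule linear_if_compatible[OF PF.vector_space_axioms F.vector_space_axioms])
       (auto simp: \<Phi>_def fun_eq_iff B algebra_simps V.scale_right_distrib
           V.scale_right_diff_distrib)
  have lin\<Psi>: "Vector_Spaces.linear (fun_scale s) (pair_scale (fun_scale s) s) \<Psi>"
    by (rule linear_if_compatible[OF F.vector_space_axioms PF.vector_space_axioms])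
       (auto simp: \<Psi>_def fun_eq_iff)
  have into: "\<Phi> (\<phi>, v) \<in> derivations s act" if \<phi>: "\<phi> \<in> ?Z" for \<phi> v
  proof -
    note h = hom_bimodD[OF cocycleD(1)[OF \<phi>]]
    have 1: "\<phi> (y (a + b)) = \<phi> (y a) + \<phi> (y b)" for a b
      using wd[OF \<phi> _ _ y_add] y by (simp add: h)
    have 2: "\<phi> (y (sc c a)) = s c (\<phi> (y a))" for c a
      using wd[OF \<phi> _ _ y_scale] y by (simp add: h P1.smult_closed ts B)
    have 3: "\<phi> (y (a * b)) = act a (\<phi> (y b)) 1 + act 1 (\<phi> (y a)) b" for a b
      using wd[OF \<phi> _ _ y_mult] y by (simp add: h P1.smult_closed ts)
    show ?thesis
      by (auto simp: derivations_def \<Phi>_def 1 2 3 B V.scale_right_distrib V.scale_right_diff_distrib)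
  qed
  have onto: "D \<in> \<Phi> ` (?Z \<times> UNIV)" if "D \<in> derivations s act" for D
  proof -
    have D: "D (a + b) = D a + D b" "D (sc c a) = s c (D a)" "D (a * b) = act a (D b) 1 + act 1 (D
        a) b" for a b c
      using that by (auto simp: derivations_def)
    have D1: "D 1 = 0" using D(3)[of 1 1] by (simp add: B)
    define T where "T = tensor_lift s (\<lambda>a b. act 1 (D a) b)"
    have bil: "bilinear_on sc s (\<lambda>a b. act 1 (D a) b)" by (auto simp: bilinear_on_def B D)
    have Tt: "T (tensor sc a b) = act 1 (D a) b" for a b
      unfolding T_def by (rule tensor_lift_tensor[OF A(1) bil])
    have Ta: "T (t \<oplus>\<^bsub>E\<^esub> u) = T t + T u" if "t \<in> carrier E" "u \<in> carrier E" for t u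
      unfolding T_def by (rule tensor_lift_add[OF A(1) bil that])
    have T0: "T \<zero>\<^bsub>E\<^esub> = 0" unfolding T_def by (rule tensor_lift_zero[OF A(1) bil])
    have Tm: "T (tensor sc a b \<otimes>\<^bsub>E\<^esub> t) = act a (T t) b + act 1 (D a) (t \<odot>\<^bsub>?D\<^esub> 1 * b)"
      if "t \<in> carrier E" for a b t
      using that
    proof (induction t rule: env_induct)
      case (tensor c c')
      then show ?case by (simp add: tensor_mult Tt D B Ds mult.assoc)
    next
      case (add t u)
      then show ?case
        using DM.smult_l_distr[of t u 1] by (simp add: E.r_distr Ta B Ds distrib_right)
    qed
    have Tu: "T (u \<otimes>\<^bsub>E\<^esub> t) = u \<odot>\<^bsub>?V\<^esub> T t" if "u \<in> carrier E" "t \<in> carrier E" "t \<odot>\<^bsub>?D\<^esub> 1 = 0" for u t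
      using that(1)
    proof (induction u rule: env_induct)
      case (tensor a b)
      then show ?case using that by (simp add: Tm ts B)
    next
      case (add u u')
      then show ?case using that VM.smult_l_distr[of u u' "T t"] by (simp add: E.l_distr Ta)
    qed
    define \<phi> where "\<phi> x = (if x \<in> carrier (P (Suc 0)) then T (\<epsilon> (d 0 x)) else 0)" for x
    have \<phi>Z: "\<phi> \<in> ?Z"
      unfolding bimod_cocycles_def
    proof (intro CollectI conjI ballI)
      show "\<phi> \<in> lmod_hom E (P (Suc 0)) ?V"
      proof (rule lmod_homI)
        fix x z assume "x \<in> carrier (P (Suc 0))" "z \<in> carrier (P (Suc 0))"
        then show "\<phi> (x \<oplus>\<^bsub>P (Suc 0)\<^esub> z) = \<phi> x \<oplus>\<^bsub>?V\<^esub> \<phi> z"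
          using lmod_homD(2)[OF \<epsilon> d0c d0c] by (simp add: \<phi>_def d_add Ta \<epsilon>c)
      next
        fix t x assume "t \<in> carrier E" "x \<in> carrier (P (Suc 0))"
        then show "\<phi> (t \<odot>\<^bsub>P (Suc 0)\<^esub> x) = t \<odot>\<^bsub>?V\<^esub> \<phi> x"
          by (simp add: \<phi>_def P1.smult_closed d_mul \<epsilon>m d0c Tu \<epsilon>c \<epsilon>e ed)
      qed (simp_all add: \<phi>_def)
      fix x assume x: "x \<in> carrier (P (Suc (Suc 0)))"
      show "\<phi> (d (Suc 0) x) = 0"
        using dd[OF x] lmod_hom_zero[OF PD(1) E_regular \<epsilon>] by (simp add: \<phi>_def T0)
    qed
    have "\<Phi> (\<phi>, - T (\<epsilon> x0)) = D"
    proof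
      fix a
      have eX': "\<epsilon> (X t) = t \<otimes>\<^bsub>E\<^esub> \<epsilon> x0" if "t \<in> carrier E" for t
        using \<epsilon>m[OF that x0(1)] by (simp add: X_def)
      have "w a \<oplus>\<^bsub>P 0\<^esub> X (tensor sc 1 a) = X (tensor sc a 1)"
        by (simp add: w_def a_minus_def P0.M.a_assoc Xc P0.M.l_neg)
      then have "\<epsilon> (X (tensor sc a 1)) = \<epsilon> (w a) \<oplus>\<^bsub>E\<^esub> \<epsilon> (X (tensor sc 1 a))"
        using lmod_homD(2)[OF \<epsilon> wc[of a] Xc[OF tensor_closed[of 1 a]]] by simp
      then have "T (\<epsilon> (X (tensor sc a 1))) = T (\<epsilon> (w a)) + T (\<epsilon> (X (tensor sc 1 a)))"
        by (simp add: Ta \<epsilon>c)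
      then have "\<phi> (y a) = T (tensor sc a 1 \<otimes>\<^bsub>E\<^esub> \<epsilon> x0) - T (tensor sc 1 a \<otimes>\<^bsub>E\<^esub> \<epsilon> x0)"
        by (simp add: \<phi>_def y eX')
      also have "\<dots> = act a (T (\<epsilon> x0)) 1 + D a - act 1 (T (\<epsilon> x0)) a"
        by (simp add: Tm \<epsilon>c \<epsilon>e x0 B D1)
      finally show "\<Phi> (\<phi>, - T (\<epsilon> x0)) a = D a" by (simp add: \<Phi>_def B)
    qed
    then show ?thesis using \<phi>Z by (intro image_eqI[of _ _ "(\<phi>, - T (\<epsilon> x0))"]) auto
  qed
  have ker1: "\<Psi> \<psi> \<in> ?Z \<times> UNIV \<and> \<Phi> (\<Psi> \<psi>) = 0" if \<psi>: "\<psi> \<in> ?C" for \<psi>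
  proof
    have "(\<lambda>x. \<psi> (d 0 x)) \<in> lmod_hom E (P (Suc 0)) ?V"
      by (rule lmod_hom_comp[OF PD(1) left_module_bimod[OF act] PD(3) \<psi>])
    then show "\<Psi> \<psi> \<in> ?Z \<times> UNIV"
      using dd hom_bimod_zero[OF act PD(1) \<psi>] by (simp add: \<Psi>_def bimod_cocycles_def)
    have "\<psi> (w a) = act a (\<psi> x0) 1 - act 1 (\<psi> x0) a" for a
      using hom_bimod_minus[OF act PD(1) \<psi>, of "X (tensor sc a 1)" "X (tensor sc 1 a)"] x0(1)
      by (simp add: w_def Xc) (simp add: X_def hom_bimodD(2)[OF \<psi>] ts)
    then show "\<Phi> (\<Psi> \<psi>) = 0" by (simp add: \<Phi>_def \<Psi>_def fun_eq_iff y B)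
  qed
  have ker2: "(\<phi>, v) \<in> \<Psi> ` ?C" if \<phi>: "\<phi> \<in> ?Z" and 0: "\<Phi> (\<phi>, v) = 0" for \<phi> v
  proof -
    have "\<phi> (y a) + act a v 1 - act 1 v a = 0" for a using fun_cong[OF 0, of a] by (simp add: \<Phi>_def)
    then have \<phi>y: "\<forall>a. \<phi> (y a) = act a (- v) 1 - act 1 (- v) a"
      by (simp add: B algebra_simps eq_neg_iff_add_eq_0)
    define \<psi> where "\<psi> = (\<lambda>x. \<phi> (\<rho> x) + \<epsilon> x \<odot>\<^bsub>?V\<^esub> (- v))"
    have "\<psi> \<in> ?C"
      unfolding \<psi>_def
      using lmod_hom_add[OF left_module_bimod[OF act]
          lmod_hom_comp[OF PD(1) left_module_bimod[OF act] \<rho> cocycleD(1)[OF \<phi>]]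
          lmod_hom_smult_right[OF left_module_bimod[OF act] _ \<epsilon>, of "- v"]] by simp
    moreover have "\<Psi> \<psi> = (\<phi>, v)"
    proof -
      have "\<psi> (d 0 x) = \<phi> x" for x
      proof (cases "x \<in> carrier (P (Suc 0))")
        case x: True
        obtain u where u: "u \<in> carrier (P (Suc 0))"
          "d 0 u = X (\<epsilon> (d 0 x)) \<ominus>\<^bsub>P 0\<^esub> X (tensor sc 1 (\<epsilon> (d 0 x) \<odot>\<^bsub>?D\<^esub> 1))"
          "\<phi> u = \<epsilon> (d 0 x) \<odot>\<^bsub>?V\<^esub> (- v) - act 1 (- v) (\<epsilon> (d 0 x) \<odot>\<^bsub>?D\<^esub> 1)"
          using reduce[OF \<epsilon>c[of "d 0 x"]] \<phi> \<phi>y by blast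
        have X0: "X \<zero>\<^bsub>E\<^esub> = \<zero>\<^bsub>P 0\<^esub>" using x0 by (simp add: X_def P0.smult_zero_left)
        have "d 0 u = X (\<epsilon> (d 0 x))" "\<phi> u = \<epsilon> (d 0 x) \<odot>\<^bsub>?V\<^esub> (- v)"
          using u x by (simp_all add: \<epsilon>e d0c ed tensor_zero_right X0 a_minus_def Xc \<epsilon>c B)
        moreover from this have "\<phi> (\<rho> (d 0 x)) = \<phi> (x \<ominus>\<^bsub>P (Suc 0)\<^esub> u)"
          using x u(1) by (intro wd[OF \<phi>] lmod_homD(1)[OF \<rho>]) (auto simp: d\<rho> d0c d_add
              P1.M.minus_closed)
        ultimately show ?thesis
          using hom_bimod_minus[OF act PD(1) cocycleD(1)[OF \<phi>] x u(1)] by (simp add: \<psi>_def)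
      next
        case False
        then show ?thesis
          using lmod_homD(4)[OF PD(3) False] hom_bimodD(3)[OF cocycleD(1)[OF \<phi>] False]
              hom_bimod_zero[OF act PD(1) \<open>\<psi> \<in> ?C\<close>]
          by simp
      qed
      moreover have "\<psi> x0 = - v"
      proof -
        obtain u where u: "u \<in> carrier (P (Suc 0))"
          "d 0 u = X (\<epsilon> x0) \<ominus>\<^bsub>P 0\<^esub> X (tensor sc 1 (\<epsilon> x0 \<odot>\<^bsub>?D\<^esub> 1))"
          "\<phi> u = \<epsilon> x0 \<odot>\<^bsub>?V\<^esub> (- v) - act 1 (- v) (\<epsilon> x0 \<odot>\<^bsub>?D\<^esub> 1)"
          using reduce[OF \<epsilon>c[of x0]] \<phi> \<phi>y by blast
        have X1: "X (tensor sc 1 1) = x0"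
          using P0.smult_one[OF x0(1)] by (simp add: X_def env_class_ops(3))
        have "d 0 (\<rho> x0 \<oplus>\<^bsub>P (Suc 0)\<^esub> u) = (x0 \<ominus>\<^bsub>P 0\<^esub> X (\<epsilon> x0)) \<oplus>\<^bsub>P 0\<^esub> (X (\<epsilon> x0) \<ominus>\<^bsub>P 0\<^esub> x0)"
          using u lmod_homD(1)[OF \<rho> x0(1)] by (simp add: d_add d\<rho> x0 \<epsilon>e X1)
        also have "\<dots> = x0 \<oplus>\<^bsub>P 0\<^esub> (\<ominus>\<^bsub>P 0\<^esub> X (\<epsilon> x0) \<oplus>\<^bsub>P 0\<^esub> X (\<epsilon> x0)) \<oplus>\<^bsub>P 0\<^esub> \<ominus>\<^bsub>P 0\<^esub> x0"
          using x0(1) by (simp add: a_minus_def P0.M.a_assoc Xc \<epsilon>c)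
        also have "\<dots> = \<zero>\<^bsub>P 0\<^esub>" using x0(1) by (simp add: P0.M.l_neg P0.M.r_neg Xc \<epsilon>c)
        also have "\<dots> = d 0 \<zero>\<^bsub>P (Suc 0)\<^esub>" by (rule lmod_hom_zero[OF PD(1) PD(1) PD(3), symmetric])
        finally have "\<phi> (\<rho> x0 \<oplus>\<^bsub>P (Suc 0)\<^esub> u) = \<phi> \<zero>\<^bsub>P (Suc 0)\<^esub>"
          using u(1) lmod_homD(1)[OF \<rho> x0(1)] by (intro wd[OF \<phi>]) auto
        then have "\<phi> (\<rho> x0) + \<phi> u = 0"
          using hom_bimodD(1)[OF cocycleD(1)[OF \<phi>] lmod_homD(1)[OF \<rho> x0(1)] u(1)]
            hom_bimod_zero[OF act PD(1) cocycleD(1)[OF \<phi>]] by simp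
        then show ?thesis
          using u(3) by (simp add: \<psi>_def \<epsilon>e x0 B algebra_simps eq_neg_iff_add_eq_0)
      qed
      ultimately show ?thesis by (simp add: \<Psi>_def)
    qed
    ultimately show ?thesis by (intro image_eqI[of _ _ \<psi>]) auto
  qed
  have inj: "\<psi> = 0" if \<psi>: "\<psi> \<in> ?C" and 0: "\<Psi> \<psi> = 0" for \<psi>
  proof
    fix x
    have z: "\<psi> (d 0 u) = 0" "\<psi> x0 = 0" for u
      using 0 by (auto simp: \<Psi>_def zero_prod_def fun_eq_iff)
    show "\<psi> x = 0 x"
    proof (cases "x \<in> carrier (P 0)")
      case x: True
      have "\<psi> (x \<ominus>\<^bsub>P 0\<^esub> X (\<epsilon> x)) = 0" using z(1)[of "\<rho> x"] by (simp add: d\<rho> x)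
      moreover have "\<psi> (X (\<epsilon> x)) = 0" using z(2) x0 by (simp add: X_def hom_bimodD(2)[OF \<psi>] \<epsilon>c L)
      ultimately show ?thesis using hom_bimod_minus[OF act PD(1) \<psi> x Xc[OF \<epsilon>c]] by simp
    next
      case False then show ?thesis using hom_bimodD(3)[OF \<psi>] by simp
    qed
  qed
  have img: "\<Phi> ` (?Z \<times> UNIV) = derivations s act" using into onto by auto
  have ker: "{w \<in> ?Z \<times> UNIV. \<Phi> w = 0} = \<Psi> ` ?C"
  proof
    show "\<Psi> ` ?C \<subseteq> {w \<in> ?Z \<times> UNIV. \<Phi> w = 0}" using ker1 by blast
    show "{w \<in> ?Z \<times> UNIV. \<Phi> w = 0} \<subseteq> \<Psi> ` ?C" using ker2 by blast
  qed
  show ?thesis by (rule that[OF lin\<Phi> lin\<Psi> img ker]) (use inj in blast)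
qed

end

lemma dim_derivations:
  fixes sc :: "'k::field_char_0 \<Rightarrow> 'a::{ring,monoid_mult} \<Rightarrow> 'a" and s :: "'k \<Rightarrow> 'v::ab_group_add \<Rightarrow> 'v"
  assumes "k_algebra sc" "k_algebra.bimodule_action sc s act"
    and P: "fg_projective_resolution (env_alg sc) (diagonal_bimod sc) P d e"
    and V: "finite_dimensional s UNIV"
    and C0: "finite_dimensional (fun_scale s) (lmod_hom (env_alg sc) (P 0) (bimod s act))"
    and Z1: "finite_dimensional (fun_scale s) (k_algebra.bimod_cocycles sc s act P d (Suc 0))"
  shows "finite_dimensional (fun_scale s) (k_algebra.derivations sc s act)"
    and "vector_space.dim (fun_scale s) (k_algebra.derivations sc s act) +
       vector_space.dim (fun_scale s) (lmod_hom (env_alg sc) (P 0) (bimod s act)) =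
     vector_space.dim (fun_scale s) (k_algebra.bimod_cocycles sc s act P d (Suc 0)) +
         vector_space.dim s UNIV"
proof -
  interpret k_algebra sc by fact
  note act = assms(2)
  note A = bimodule_actionD[OF act]
  interpret V: vector_space s by (rule A(1))
  interpret F: vector_space "fun_scale s" by (rule vector_space_fun_scale[OF A(1)])
  interpret PF: vector_space "pair_scale (fun_scale s) s"
    by (rule vector_space_pair_scale[OF F.vector_space_axioms A(1)])
  let ?Z = "bimod_cocycles s act P d (Suc 0)" and ?C = "lmod_hom E (P 0) (bimod s act)"
  obtain \<Phi> \<Psi> where lin: "Vector_Spaces.linear (pair_scale (fun_scale s) s) (fun_scale s) \<Phi>"
    "Vector_Spaces.linear (fun_scale s) (pair_scale (fun_scale s) s) \<Psi>"
    and img: "\<Phi> ` (?Z \<times> UNIV) = derivations s act"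
    and ker: "{w \<in> ?Z \<times> UNIV. \<Phi> w = 0} = \<Psi> ` ?C"
    and inj: "\<forall>\<psi>\<in>?C. \<Psi> \<psi> = 0 \<longrightarrow> \<psi> = 0"
    by (rule derivation_exact_sequence[OF act P])
  note pr = dim_prod[OF F.vector_space_axioms A(1) bimod_cocycles_subspace[OF act] Z1
      V.subspace_UNIV V]
  show "finite_dimensional (fun_scale s) (derivations s act)"
    using rank_nullity(2)[OF lin(1) pr(3,2)] by (simp add: img)
  have subC: "F.subspace ?C" by (rule hom_bimod_subspace[OF act])
  have "{\<psi> \<in> ?C. \<Psi> \<psi> = 0} = {0}"
  proof -
    interpret \<Psi>: Vector_Spaces.linear "fun_scale s" "pair_scale (fun_scale s) s" \<Psi> by (rule lin(2))
    show ?thesis using inj F.subspace_0[OF subC] \<Psi>.zero by auto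
  qed
  moreover have "F.dim {0} = 0"
    using F.dim_eq_card[of "{}" "{0}"] F.independent_empty F.span_insert_0[of "{}"] by simp
  ultimately have "F.dim ?C = PF.dim (\<Psi> ` ?C)"
    using rank_nullity(1)[OF lin(2) subC C0] by simp
  moreover have "PF.dim (?Z \<times> UNIV) = PF.dim (\<Psi> ` ?C) + F.dim (derivations s act)"
    using rank_nullity(1)[OF lin(1) pr(3,2)] by (simp add: img ker)
  ultimately show "F.dim (derivations s act) + F.dim ?C = F.dim ?Z + V.dim UNIV" using pr(1) by simp
qed

section \<open>Duality in degree two\<close>

lemma sum_fun_apply: "(\<Sum>i\<in>I. f i) x = (\<Sum>i\<in>I. f i x)"
  by (induction I rule: infinite_finite_induct) simp_all

context k_algebra
begin

definition commutators :: "('k \<Rightarrow> 'v::ab_group_add \<Rightarrow> 'v) \<Rightarrow> ('a \<Rightarrow> 'v \<Rightarrow> 'a \<Rightarrow> 'v) \<Rightarrow> 'v set" where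
  "commutators s act = module.span s {act a v 1 - act 1 v a | a v. True}"

end

context cy2_resolution
begin

lemmas res = resolutionD[OF resolution]

text \<open>
  By the splitting, the image of \<open>P 3\<close> has a complement in \<open>P 2\<close>; the cocycles are the
  homomorphisms that factor through the projection \<open>p\<close> onto it.
\<close>

lemma complement_projection:
  obtains p where "p \<in> lmod_hom E (P (Suc (Suc 0))) (P (Suc (Suc 0)))"
    "\<forall>x\<in>carrier (P (Suc (Suc (Suc 0)))). p (d (Suc (Suc 0)) x) = \<zero>\<^bsub>P (Suc (Suc 0))\<^esub>"
    "\<forall>x\<in>carrier (P (Suc (Suc 0))). \<exists>y\<in>carrier (P (Suc (Suc (Suc 0)))).
        p x = x \<ominus>\<^bsub>P (Suc (Suc 0))\<^esub> d (Suc (Suc 0)) y"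
proof -
  let ?Q = "P (Suc (Suc 0))" and ?d = "d (Suc (Suc 0))"
  obtain h where h: "h \<in> lmod_hom E ?Q (P (Suc (Suc (Suc 0))))"
    "\<And>x. x \<in> syzygy P d (Suc (Suc 0)) \<Longrightarrow> ?d (h x) = x"
    using splits by (auto simp: splits_at_def)
  interpret Q: left_module E ?Q by (rule res(1))
  define p where "p = (\<lambda>x. (if x \<in> carrier ?Q then x else \<zero>\<^bsub>?Q\<^esub>) \<ominus>\<^bsub>?Q\<^esub> ?d (h x))"
  have p: "p \<in> lmod_hom E ?Q ?Q"
    unfolding p_def by (intro lmod_hom_minus res lmod_hom_id lmod_hom_comp[OF res(1) res(1) h(1)
        res(3)])
  have pd: "p (?d x) = \<zero>\<^bsub>?Q\<^esub>" if "x \<in> carrier (P (Suc (Suc (Suc 0))))" for x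
    using that h(2)[of "?d x"] lmod_homD(1)[OF res(3) that]
    by (simp add: p_def syzygy_def a_minus_def Q.M.r_neg)
  show ?thesis
    by (rule that[OF p]) (use pd lmod_homD(1)[OF h(1)] in \<open>auto simp: p_def\<close>)
qed

lemma cocycle_factors:
  assumes N: "left_module E N" and f: "f \<in> lmod_hom E (P (Suc (Suc 0))) N"
    and fd: "\<And>x. x \<in> carrier (P (Suc (Suc (Suc 0)))) \<Longrightarrow> f (d (Suc (Suc 0)) x) = \<zero>\<^bsub>N\<^esub>"
    and p: "p \<in> lmod_hom E (P (Suc (Suc 0))) (P (Suc (Suc 0)))"
    and pd: "\<forall>x\<in>carrier (P (Suc (Suc 0))). \<exists>y\<in>carrier (P (Suc (Suc (Suc 0)))).
        p x = x \<ominus>\<^bsub>P (Suc (Suc 0))\<^esub> d (Suc (Suc 0)) y"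
  shows "f (p x) = f x"
proof -
  interpret N: left_module E N by (rule N)
  show ?thesis
  proof (cases "x \<in> carrier (P (Suc (Suc 0)))")
    case True
    then obtain y where y: "y \<in> carrier (P (Suc (Suc (Suc 0))))"
      "p x = x \<ominus>\<^bsub>P (Suc (Suc 0))\<^esub> d (Suc (Suc 0)) y" using pd by blast
    have "f (p x) = f x \<ominus>\<^bsub>N\<^esub> \<zero>\<^bsub>N\<^esub>"
      using lmod_hom_minus_arg[OF res(1) N f True lmod_homD(1)[OF res(3) y(1)]] fd[OF y(1)] y(2)
          by simp
    then show ?thesis using lmod_homD(1)[OF f True] by (simp add: a_minus_def)
  next
    case False
    then show ?thesis
      using lmod_homD(4)[OF f] lmod_homD(4)[OF p] lmod_hom_zero[OF res(1) N f] by simp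
  qed
qed

text \<open>
  The identification of \<open>Ext\<^sup>2(A, A\<^sup>e)\<close> with \<open>A\<close>, and right exactness of the tensor product with
  \<open>V\<close>, identify the second cohomology of \<open>V\<close> with \<open>A \<otimes>\<^bsub>A\<^sup>e\<^esub> V\<close>, that is, with \<open>V\<close> modulo
  commutators. The class \<open>\<omega>\<close> of \<open>1\<close> provides the map \<open>v \<mapsto> \<omega> v\<close> in one direction; in the other, a
  cocycle is written as a combination of cocycles with values in \<open>A\<^sup>e\<close> by means of a dual basis, and
  each of these is replaced by its class in \<open>A\<close>.
\<close>

lemma second_cohomology:
  fixes s :: "'k \<Rightarrow> 'v::ab_group_add \<Rightarrow> 'v"
  assumes act: "bimodule_action s act"
  obtains T where "Vector_Spaces.linear (fun_scale s) s T"
    "\<forall>\<phi>\<in>bimod_cocycles s act P d (Suc (Suc 0)). T \<phi> \<in> commutators s act \<longleftrightarrow>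
        \<phi> \<in> (\<lambda>\<psi> x. \<psi> (d (Suc 0) x)) ` lmod_hom E (P (Suc 0)) (bimod s act)"
    "\<forall>v. \<exists>\<phi>\<in>bimod_cocycles s act P d (Suc (Suc 0)). T \<phi> - v \<in> commutators s act"
proof -
  let ?Q = "P (Suc (Suc 0))" and ?V = "bimod s act" and ?d = "d (Suc 0)"
  let ?Z = "bimod_cocycles s act P d (Suc (Suc 0))" and ?ZE = "cocycles sc P d (Suc (Suc 0))"
  let ?B = "(\<lambda>\<psi> x. \<psi> (?d x)) ` lmod_hom E (P (Suc 0)) ?V"
  let ?C = "commutators s act"
  note A = bimodule_actionD[OF act] and L = bimod_linear[OF act] and ts = tensor_smult[OF act]
  note B = act_linear[OF act] act_bilinear[OF act] act_combine[OF act]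
  note VM = left_module_bimod[OF act]
  interpret E: ring E by (rule env_ring)
  interpret V: vector_space s by (rule A(1))
  interpret F: vector_space "fun_scale s" by (rule vector_space_fun_scale[OF A(1)])
  interpret VM: left_module E ?V by (rule VM)
  interpret RM: left_module E "regular_lmod E" by (rule E_regular)
  have subC: "V.subspace ?C" unfolding commutators_def by (rule V.subspace_span)
  have genC: "act a v 1 - act 1 v a \<in> ?C" for a v
    unfolding commutators_def by (rule V.span_base) blast
  note Cadd = V.subspace_add[OF subC] and Csum = V.subspace_sum[OF subC]
    and Cdiff = V.subspace_diff[OF subC] and C0 = V.subspace_0[OF subC]
  obtain \<theta> where add: "\<forall>f\<in>?ZE. \<forall>g\<in>?ZE. \<theta> (\<lambda>x. f x \<oplus>\<^bsub>E\<^esub> g x) = \<theta> f + \<theta> g"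
    and mult: "\<forall>f\<in>?ZE. \<forall>a b. \<theta> (\<lambda>x. f x \<otimes>\<^bsub>E\<^esub> tensor sc a b) = b * \<theta> f * a"
    and ker: "\<forall>f\<in>?ZE. \<theta> f = 0 \<longleftrightarrow> f \<in> coboundaries sc P d (Suc (Suc 0))"
    and \<theta>_unit: "\<exists>\<omega>\<in>?ZE. \<theta> \<omega> = 1"
    by (rule ext_class_map[OF resolution ext_iso])
  note \<theta>_add = add[rule_format] and \<theta>_mult = mult[rule_format] and \<theta>_ker = ker[rule_format]
  obtain \<omega> where \<omega>: "\<omega> \<in> ?ZE" "\<theta> \<omega> = 1" using \<theta>_unit by blast
  have ZEc: "f x \<in> carrier E" if "f \<in> ?ZE" for f x
    using that lmod_hom_range[OF E_regular, of f ?Q x] by (simp add: mem_cocycles_iff)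
  have zeroZE: "(\<lambda>x. \<zero>\<^bsub>E\<^esub>) \<in> ?ZE"
    using lmod_hom_const_zero[OF E_regular, of ?Q] by (simp add: mem_cocycles_iff)
  have \<theta>_zero: "\<theta> (\<lambda>x. \<zero>\<^bsub>E\<^esub>) = 0" using \<theta>_add[OF zeroZE zeroZE] by simp
  have \<theta>_sum: "(\<lambda>x. \<Oplus>\<^bsub>regular_lmod E\<^esub>i\<in>I. f i x) \<in> ?ZE \<and>
      \<theta> (\<lambda>x. \<Oplus>\<^bsub>regular_lmod E\<^esub>i\<in>I. f i x) = (\<Sum>i\<in>I. \<theta> (f i))"
    if "finite I" "\<And>i. i \<in> I \<Longrightarrow> f i \<in> ?ZE" for I :: "'f set" and f
    using that
  proof (induction I rule: finite_induct)
    case empty then show ?case using zeroZE \<theta>_zero by simp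
  next
    case (insert j J)
    have "(\<Oplus>\<^bsub>regular_lmod E\<^esub>i\<in>insert j J. f i x) = f j x \<oplus>\<^bsub>E\<^esub> (\<Oplus>\<^bsub>regular_lmod E\<^esub>i\<in>J. f i x)" for x
      using insert.hyps insert.prems ZEc RM.M.finsum_insert[of J j "\<lambda>i. f i x"] by simp
    moreover have "(\<lambda>x. f j x \<oplus>\<^bsub>E\<^esub> (\<Oplus>\<^bsub>regular_lmod E\<^esub>i\<in>J. f i x)) \<in> ?ZE"
      by (rule cocycles_add) (use insert in auto)
    ultimately show ?case using insert \<theta>_add[of "f j"] by simp
  qed
  have cobound: "\<exists>k\<in>lmod_hom E (P (Suc 0)) (regular_lmod E). \<forall>x. f x = k (?d x) \<oplus>\<^bsub>E\<^esub> g x"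
    if f: "f \<in> ?ZE" and g: "g \<in> ?ZE" and eq: "\<theta> f = \<theta> g" for f g
  proof -
    let ?m = "\<lambda>x. f x \<ominus>\<^bsub>regular_lmod E\<^esub> g x"
    have m: "?m \<in> ?ZE" by (rule cocycles_minus[OF f g])
    have mg: "?m x \<oplus>\<^bsub>E\<^esub> g x = f x" for x
      using ZEc[OF f, of x] ZEc[OF g, of x] RM.M.a_inv_closed[of "g x"] RM.M.l_neg[of "g x"]
      by (simp add: a_minus_def E.a_assoc)
    have "\<theta> f = \<theta> ?m + \<theta> g" using \<theta>_add[OF m g] mg by simp
    then have "\<theta> ?m = 0" using eq by simp
    then obtain k where k: "k \<in> lmod_hom E (P (Suc 0)) (regular_lmod E)" "?m = (\<lambda>x. k (?d x))"
      using \<theta>_ker[OF m] by (auto simp: mem_coboundaries_iff)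
    have "f x = k (?d x) \<oplus>\<^bsub>E\<^esub> g x" for x using mg[of x] fun_cong[OF k(2), of x] by simp
    then show ?thesis using k(1) by blast
  qed
  obtain p where p: "p \<in> lmod_hom E ?Q ?Q"
    and pd: "\<forall>x\<in>carrier (P (Suc (Suc (Suc 0)))). p (d (Suc (Suc 0)) x) = \<zero>\<^bsub>?Q\<^esub>"
    and px: "\<forall>x\<in>carrier ?Q. \<exists>y\<in>carrier (P (Suc (Suc (Suc 0)))). p x = x \<ominus>\<^bsub>?Q\<^esub> d (Suc (Suc 0)) y"
    by (rule complement_projection)
  obtain I and b :: "'f \<Rightarrow> 'f" and f where db: "dual_basis E ?Q I b f" using res(2) by blast
  note D = dual_basisD[OF db]
  define q where "q i = (\<lambda>x. f i (p x))" for i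
  have q: "q i \<in> ?ZE" if "i \<in> I" for i
    unfolding q_def using lmod_hom_comp[OF res(1) E_regular p D(4)[OF that]] pd
      lmod_hom_zero[OF res(1) E_regular D(4)[OF that]] by (simp add: mem_cocycles_iff)
  have expandE: "(\<Oplus>\<^bsub>regular_lmod E\<^esub>i\<in>I. q i x \<otimes>\<^bsub>E\<^esub> g (b i)) = g x" if g: "g \<in> ?ZE" for g x
  proof -
    have g': "g \<in> lmod_hom E ?Q (regular_lmod E)" using g by (simp add: mem_cocycles_iff)
    have "g (p x) = (\<Oplus>\<^bsub>regular_lmod E\<^esub>i\<in>I. q i x \<otimes>\<^bsub>E\<^esub> g (b i))"
      using dual_basis_expand_hom[OF db E_regular g' lmod_hom_range[OF res(1) p]] by (simp add:
          q_def)
    moreover have "g (p x) = g x"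
      using g by (intro cocycle_factors[OF E_regular g' _ p px]) (simp add: mem_cocycles_iff)
    ultimately show ?thesis by simp
  qed
  have expandV: "\<phi> x = (\<Sum>i\<in>I. q i x \<odot>\<^bsub>?V\<^esub> \<phi> (b i))" if \<phi>: "\<phi> \<in> ?Z" for \<phi> x
  proof -
    have \<phi>': "\<phi> \<in> lmod_hom E ?Q ?V" using \<phi> by (simp add: bimod_cocycles_def)
    have "\<phi> (p x) = (\<Sum>i\<in>I. q i x \<odot>\<^bsub>?V\<^esub> \<phi> (b i))"
      using dual_basis_expand_bimod[OF act db \<phi>' lmod_hom_range[OF res(1) p]] by (simp add: q_def)
    moreover have "\<phi> (p x) = \<phi> x"
      using \<phi> by (intro cocycle_factors[OF VM \<phi>' _ p px]) (simp add: bimod_cocycles_def)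
    ultimately show ?thesis by simp
  qed
  define T where "T \<phi> = (\<Sum>i\<in>I. act (\<theta> (q i)) (\<phi> (b i)) 1)" for \<phi> :: "'f \<Rightarrow> 'v"
  have linT: "Vector_Spaces.linear (fun_scale s) s T"
    by (rule linear_if_compatible[OF F.vector_space_axioms A(1)])
       (simp_all add: T_def B sum.distrib V.scale_sum_right)
  \<comment> \<open>In the coinvariants, acting on \<open>v\<close> agrees with acting on the class.\<close>
  have balance: "act (\<theta> z) (t \<odot>\<^bsub>?V\<^esub> v) 1 - act (\<theta> (\<lambda>x. z x \<otimes>\<^bsub>E\<^esub> t)) v 1 \<in> ?C"
    if z: "z \<in> ?ZE" and t: "t \<in> carrier E" for z t v
    using t
  proof (induction t rule: env_induct)
    case (tensor a c)
    have "act (\<theta> z) (act a v c) 1 - act (c * \<theta> z * a) v 1 =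
        - (act c (act (\<theta> z * a) v 1) 1 - act 1 (act (\<theta> z * a) v 1) c)"
      by (simp add: B mult.assoc)
    also have "\<dots> \<in> ?C" by (intro V.subspace_neg[OF subC] genC)
    finally show ?case using \<theta>_mult[OF z] by (simp add: ts)
  next
    case (add t u)
    have "(\<lambda>x. z x \<otimes>\<^bsub>E\<^esub> (t \<oplus>\<^bsub>E\<^esub> u)) = (\<lambda>x. z x \<otimes>\<^bsub>E\<^esub> t \<oplus>\<^bsub>E\<^esub> z x \<otimes>\<^bsub>E\<^esub> u)"
      using ZEc[OF z] add by (simp add: E.r_distr)
    then have "\<theta> (\<lambda>x. z x \<otimes>\<^bsub>E\<^esub> (t \<oplus>\<^bsub>E\<^esub> u)) = \<theta> (\<lambda>x. z x \<otimes>\<^bsub>E\<^esub> t) + \<theta> (\<lambda>x. z x \<otimes>\<^bsub>E\<^esub> u)"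
      using \<theta>_add[OF cocycles_mult[OF z add(1)] cocycles_mult[OF z add(2)]] by simp
    moreover have "(t \<oplus>\<^bsub>E\<^esub> u) \<odot>\<^bsub>?V\<^esub> v = t \<odot>\<^bsub>?V\<^esub> v + u \<odot>\<^bsub>?V\<^esub> v"
      using VM.smult_l_distr[OF add(1,2), of v] by simp
    ultimately show ?case using Cadd[OF add(3,4)] by (simp add: B algebra_simps)
  qed
  have act_sum: "act (\<Sum>i\<in>J. h i) v c = (\<Sum>i\<in>J. act (h i) v c)" for J :: "'f set" and h v c
    by (induction J rule: infinite_finite_induct) (simp_all add: B)
  have T_smult: "T (\<lambda>x. g x \<odot>\<^bsub>?V\<^esub> v) - act (\<theta> g) v 1 \<in> ?C" if g: "g \<in> ?ZE" for g v
  proof -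
    have "\<theta> g = \<theta> (\<lambda>x. \<Oplus>\<^bsub>regular_lmod E\<^esub>i\<in>I. q i x \<otimes>\<^bsub>E\<^esub> g (b i))" by (simp add: expandE[OF g])
    also have "\<dots> = (\<Sum>i\<in>I. \<theta> (\<lambda>x. q i x \<otimes>\<^bsub>E\<^esub> g (b i)))"
      using \<theta>_sum[OF D(2), of "\<lambda>i x. q i x \<otimes>\<^bsub>E\<^esub> g (b i)"] cocycles_mult[OF q ZEc[OF g]] by simp
    finally have "act (\<theta> g) v 1 = (\<Sum>i\<in>I. act (\<theta> (\<lambda>x. q i x \<otimes>\<^bsub>E\<^esub> g (b i))) v 1)"
      by (simp add: act_sum)
    then have "T (\<lambda>x. g x \<odot>\<^bsub>?V\<^esub> v) - act (\<theta> g) v 1 =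
        (\<Sum>i\<in>I. act (\<theta> (q i)) (g (b i) \<odot>\<^bsub>?V\<^esub> v) 1 - act (\<theta> (\<lambda>x. q i x \<otimes>\<^bsub>E\<^esub> g (b i))) v 1)"
      by (simp add: T_def sum_subtractf)
    also have "\<dots> \<in> ?C" by (intro Csum balance q ZEc[OF g])
    finally show ?thesis .
  qed
  have subB: "F.subspace ?B"
  proof -
    have "Vector_Spaces.linear (fun_scale s) (fun_scale s) (\<lambda>\<psi> x. \<psi> (?d x))"
      by (rule linear_if_compatible[OF F.vector_space_axioms F.vector_space_axioms]) (simp_all
          add: fun_eq_iff)
    then interpret l: Vector_Spaces.linear "fun_scale s" "fun_scale s" "\<lambda>\<psi> x. \<psi> (?d x)" .
    show ?thesis by (rule l.subspace_image[OF hom_bimod_subspace[OF act]])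
  qed
  have smultB: "(\<lambda>x. k (?d x) \<odot>\<^bsub>?V\<^esub> v) \<in> ?B" if "k \<in> lmod_hom E (P (Suc 0)) (regular_lmod E)" for
      k v
    using lmod_hom_smult_right[OF VM _ that, of v] by (intro image_eqI[of _ _ "\<lambda>x. k x \<odot>\<^bsub>?V\<^esub> v"])
        simp_all
  have cob_closed: "(\<lambda>x. k (?d x)) \<in> ?ZE" "\<theta> (\<lambda>x. k (?d x)) = 0"
    if k: "k \<in> lmod_hom E (P (Suc 0)) (regular_lmod E)" for k
  proof -
    have c: "(\<lambda>x. k (?d x)) \<in> coboundaries sc P d (Suc (Suc 0))"
      using k by (auto simp: mem_coboundaries_iff)
    then show z: "(\<lambda>x. k (?d x)) \<in> ?ZE" using coboundary_cocycle[OF resolution] by blast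
    show "\<theta> (\<lambda>x. k (?d x)) = 0" using \<theta>_ker[OF z] c by blast
  qed
  have TB: "T \<phi> \<in> ?C" if \<phi>: "\<phi> \<in> ?B" for \<phi>
  proof -
    obtain \<psi> where \<psi>: "\<psi> \<in> lmod_hom E (P (Suc 0)) ?V" "\<phi> = (\<lambda>x. \<psi> (?d x))" using \<phi> by blast
    obtain J and c :: "'f \<Rightarrow> 'f" and g where dbJ: "dual_basis E (P (Suc 0)) J c g" using res(2) by
        blast
    note DJ = dual_basisD[OF dbJ]
    interpret T: Vector_Spaces.linear "fun_scale s" s T by (rule linT)
    have "\<phi> x = (\<Sum>j\<in>J. g j (?d x) \<odot>\<^bsub>?V\<^esub> \<psi> (c j))" for x
      using dual_basis_expand_bimod[OF act dbJ \<psi>(1) lmod_hom_range[OF res(1) res(3)]] by (simp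
          add: \<psi>(2))
    then have "\<phi> = (\<lambda>x. \<Sum>j\<in>J. g j (?d x) \<odot>\<^bsub>?V\<^esub> \<psi> (c j))" by (rule ext)
    then have "\<phi> = (\<Sum>j\<in>J. (\<lambda>x. g j (?d x) \<odot>\<^bsub>?V\<^esub> \<psi> (c j)))"
      by (simp add: fun_eq_iff sum_fun_apply)
    then have "T \<phi> = (\<Sum>j\<in>J. T (\<lambda>x. g j (?d x) \<odot>\<^bsub>?V\<^esub> \<psi> (c j)))" by (simp add: T.sum)
    also have "\<dots> \<in> ?C"
    proof (rule Csum)
      fix j assume "j \<in> J"
      then show "T (\<lambda>x. g j (?d x) \<odot>\<^bsub>?V\<^esub> \<psi> (c j)) \<in> ?C"
        using T_smult[OF cob_closed(1)[OF DJ(4)], of j "\<psi> (c j)"] cob_closed(2)[OF DJ(4)] by (simp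
            add: B)
    qed
    finally show ?thesis .
  qed
  have LC: "(\<lambda>x. \<omega> x \<odot>\<^bsub>?V\<^esub> v) \<in> ?B" if "v \<in> ?C" for v
    using that unfolding commutators_def
  proof (induction rule: V.span_induct_alt)
    case base
    then show ?case using F.subspace_0[OF subB] by (simp add: L zero_fun_def)
  next
    case (step c u w)
    obtain a v where u: "u = act a v 1 - act 1 v a" using step(1) by blast
    have "\<theta> (\<lambda>x. \<omega> x \<otimes>\<^bsub>E\<^esub> tensor sc a 1) = \<theta> (\<lambda>x. \<omega> x \<otimes>\<^bsub>E\<^esub> tensor sc 1 a)"
      by (simp add: \<theta>_mult[OF \<omega>(1)] \<omega>(2))
    then obtain k where k: "k \<in> lmod_hom E (P (Suc 0)) (regular_lmod E)"
      "\<And>x. \<omega> x \<otimes>\<^bsub>E\<^esub> tensor sc a 1 = k (?d x) \<oplus>\<^bsub>E\<^esub> (\<omega> x \<otimes>\<^bsub>E\<^esub> tensor sc 1 a)"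
      using cobound[OF cocycles_mult[OF \<omega>(1)] cocycles_mult[OF \<omega>(1)]] tensor_closed by metis
    have kc: "k x \<in> carrier E" for x using lmod_hom_range[OF E_regular k(1)] by simp
    have "\<omega> x \<odot>\<^bsub>?V\<^esub> u = k (?d x) \<odot>\<^bsub>?V\<^esub> v" for x
    proof -
      have "(\<omega> x \<otimes>\<^bsub>E\<^esub> tensor sc a 1) \<odot>\<^bsub>?V\<^esub> v = k (?d x) \<odot>\<^bsub>?V\<^esub> v + (\<omega> x \<otimes>\<^bsub>E\<^esub> tensor sc 1 a) \<odot>\<^bsub>?V\<^esub> v"
        using VM.smult_l_distr[of "k (?d x)" "\<omega> x \<otimes>\<^bsub>E\<^esub> tensor sc 1 a" v] ZEc[OF \<omega>(1)] by (simp
            add: k(2) kc)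
      then show ?thesis
        using VM.smult_assoc[of "\<omega> x" "tensor sc a 1" v] VM.smult_assoc[of "\<omega> x" "tensor sc 1 a"
            v] ZEc[OF \<omega>(1)]
        by (simp add: u L ts)
    qed
    then have "(\<lambda>x. \<omega> x \<odot>\<^bsub>?V\<^esub> u) \<in> ?B" using smultB[OF k(1)] by simp
    from F.subspace_add[OF subB F.subspace_scale[OF subB this] step(2)]
    show ?case by (simp add: L plus_fun_def)
  qed
  have LT: "\<phi> - (\<lambda>x. \<omega> x \<odot>\<^bsub>?V\<^esub> T \<phi>) \<in> ?B" if \<phi>: "\<phi> \<in> ?Z" for \<phi>
  proof -
    have "\<exists>k\<in>lmod_hom E (P (Suc 0)) (regular_lmod E). \<forall>x. q i x = k (?d x) \<oplus>\<^bsub>E\<^esub> (\<omega> x \<otimes>\<^bsub>E\<^esub> tensor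
        sc (\<theta> (q i)) 1)"
      if "i \<in> I" for i
      by (rule cobound[OF q[OF that] cocycles_mult[OF \<omega>(1)]]) (simp_all add: \<theta>_mult[OF \<omega>(1)] \<omega>(2))
    then obtain k where k: "\<And>i. i \<in> I \<Longrightarrow> k i \<in> lmod_hom E (P (Suc 0)) (regular_lmod E)"
      "\<And>i x. i \<in> I \<Longrightarrow> q i x = k i (?d x) \<oplus>\<^bsub>E\<^esub> (\<omega> x \<otimes>\<^bsub>E\<^esub> tensor sc (\<theta> (q i)) 1)" by metis
    have kc: "k i x \<in> carrier E" if "i \<in> I" for i x using lmod_hom_range[OF E_regular k(1)[OF
        that]] by simp
    have "q i x \<odot>\<^bsub>?V\<^esub> v - \<omega> x \<odot>\<^bsub>?V\<^esub> act (\<theta> (q i)) v 1 = k i (?d x) \<odot>\<^bsub>?V\<^esub> v" if "i \<in> I" for i x v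
    proof -
      have "q i x \<odot>\<^bsub>?V\<^esub> v = k i (?d x) \<odot>\<^bsub>?V\<^esub> v + (\<omega> x \<otimes>\<^bsub>E\<^esub> tensor sc (\<theta> (q i)) 1) \<odot>\<^bsub>?V\<^esub> v"
        using VM.smult_l_distr[of "k i (?d x)" "\<omega> x \<otimes>\<^bsub>E\<^esub> tensor sc (\<theta> (q i)) 1" v] ZEc[OF \<omega>(1)]
            kc[OF that]
        by (simp add: k(2)[OF that])
      then show ?thesis
        using VM.smult_assoc[of "\<omega> x" "tensor sc (\<theta> (q i)) 1" v] ZEc[OF \<omega>(1)] by (simp add: ts)
    qed
    then have "\<phi> x - \<omega> x \<odot>\<^bsub>?V\<^esub> T \<phi> = (\<Sum>i\<in>I. k i (?d x) \<odot>\<^bsub>?V\<^esub> \<phi> (b i))" for x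
      using expandV[OF \<phi>, of x] by (simp add: T_def L sum_subtractf[symmetric])
    then have "\<phi> - (\<lambda>x. \<omega> x \<odot>\<^bsub>?V\<^esub> T \<phi>) = (\<Sum>i\<in>I. (\<lambda>x. k i (?d x) \<odot>\<^bsub>?V\<^esub> \<phi> (b i)))"
      by (simp add: fun_eq_iff sum_fun_apply)
    also have "\<dots> \<in> ?B" by (intro F.subspace_sum[OF subB] smultB k)
    finally show ?thesis .
  qed
  show ?thesis
  proof (rule that[OF linT])
    show "\<forall>\<phi>\<in>?Z. T \<phi> \<in> ?C \<longleftrightarrow> \<phi> \<in> ?B"
    proof (intro ballI iffI)
      fix \<phi> assume \<phi>: "\<phi> \<in> ?Z" "T \<phi> \<in> ?C"
      have "\<phi> - (\<lambda>x. \<omega> x \<odot>\<^bsub>?V\<^esub> T \<phi>) + (\<lambda>x. \<omega> x \<odot>\<^bsub>?V\<^esub> T \<phi>) \<in> ?B"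
        by (rule F.subspace_add[OF subB LT[OF \<phi>(1)] LC[OF \<phi>(2)]])
      then show "\<phi> \<in> ?B" by simp
    qed (rule TB)
    show "\<forall>v. \<exists>\<phi>\<in>?Z. T \<phi> - v \<in> ?C"
    proof
      fix v
      have \<omega>': "\<omega> \<in> lmod_hom E ?Q (regular_lmod E)" using \<omega>(1) by (simp add: mem_cocycles_iff)
      have "(\<lambda>x. \<omega> x \<odot>\<^bsub>?V\<^esub> v) \<in> ?Z"
        using lmod_hom_smult_right[OF VM _ \<omega>', of v] \<omega>(1) VM.smult_zero_left[of v]
        by (simp add: bimod_cocycles_def mem_cocycles_iff)
      moreover have "T (\<lambda>x. \<omega> x \<odot>\<^bsub>?V\<^esub> v) - v \<in> ?C" using T_smult[OF \<omega>(1), of v] by (simp add: \<omega>(2)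
          B)
      ultimately show "\<exists>\<phi>\<in>?Z. T \<phi> - v \<in> ?C" by blast
    qed
  qed
qed

end

section \<open>Matrices and the trace form\<close>

lemma vector_space_mat_scale: "vector_space (mat_scale (*) :: 'k::field \<Rightarrow> 'k^'n^'n \<Rightarrow> 'k^'n^'n)"
  by unfold_locales (simp_all add: mat_scale_def vec_eq_iff algebra_simps)

definition matrix_unit :: "'n \<times> 'n \<Rightarrow> 'k::field^'n^'n" where
  "matrix_unit l = (\<chi> i j. if i = fst l \<and> j = snd l then 1 else 0)"

lemma matrix_eq_sum_units: "Y = (\<Sum>l\<in>UNIV. mat_scale (*) (Y $ fst l $ snd l) (matrix_unit l ::
    'k::field^'n::finite^'n))"
proof -
  have "(\<Sum>l\<in>UNIV. mat_scale (*) (Y $ fst l $ snd l) (matrix_unit l)) $ i $ j = Y $ i $ j" for i j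
  proof -
    have "(\<Sum>l\<in>UNIV. mat_scale (*) (Y $ fst l $ snd l) (matrix_unit l)) $ i $ j =
        (\<Sum>l\<in>UNIV. if l = (i, j) then Y $ i $ j else 0)"
      unfolding sum_component by (rule sum.cong) (auto simp: mat_scale_def matrix_unit_def
          prod_eq_iff)
    then show ?thesis by simp
  qed
  then show ?thesis by (simp add: vec_eq_iff)
qed

lemma frame_matrix_units:
  "frame (mat_scale (*)) (UNIV :: ('k::field^'n::finite^'n) set) UNIV matrix_unit (\<lambda>l Y. Y $ fst l
      $ snd l)"
proof -
  interpret V: vector_space "mat_scale (*) :: 'k \<Rightarrow> 'k^'n^'n \<Rightarrow> 'k^'n^'n" by (rule
      vector_space_mat_scale)
  show ?thesis
    unfolding frame_def
  proof (intro conjI ballI)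
    fix l :: "'n \<times> 'n"
    show "Vector_Spaces.linear (mat_scale (*)) (*) (\<lambda>Y :: 'k^'n^'n. Y $ fst l $ snd l)"
      by (rule linear_if_compatible[OF vector_space_mat_scale vector_space_field]) (simp_all add:
          mat_scale_def)
  qed (auto intro: matrix_eq_sum_units)
qed

lemma finite_dimensional_matrices: "finite_dimensional (mat_scale (*)) (W ::
    ('k::field^'n::finite^'n) set)"
  by (rule finite_dimensional_subset[OF vector_space_mat_scale
        frame_finite_dimensional[OF vector_space_mat_scale frame_matrix_units]]) simp

lemma matrix_mult_linear:
  fixes X Y :: "'k::field^'n::finite^'n"
  shows "(X + Y) ** Z = X ** Z + Y ** Z" "Z ** (X + Y) = Z ** X + Z ** Y"
    "(X - Y) ** Z = X ** Z - Y ** Z" "Z ** (X - Y) = Z ** X - Z ** Y"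
    "mat_scale (*) c X ** Z = mat_scale (*) c (X ** Z)" "Z ** mat_scale (*) c X = mat_scale (*) c
        (Z ** X)"
    "0 ** Z = 0" "Z ** 0 = 0"
  by (simp_all add: matrix_matrix_mult_def mat_scale_def vec_eq_iff algebra_simps sum.distrib
      sum_subtractf
      sum_distrib_left)

lemma trace_scale: "trace (mat_scale (*) c X) = c * trace (X :: 'k::field^'n::finite^'n)"
  by (simp add: trace_def mat_scale_def sum_distrib_left)

lemma trace_matrix_unit: "trace (Z ** matrix_unit (p, q)) = (Z :: 'k::field^'n::finite^'n) $ q $ p"
proof -
  have "(\<Sum>k\<in>UNIV. Z $ i $ k * matrix_unit (p, q) $ k $ i) = (if i = q then Z $ q $ p else 0)" for i
  proof -
    have "(\<Sum>k\<in>UNIV. Z $ i $ k * matrix_unit (p, q) $ k $ i) = (\<Sum>k\<in>UNIV. if k = p then (if i = q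
        then Z $ q $ p else 0) else 0)"
      by (rule sum.cong) (auto simp: matrix_unit_def)
    then show ?thesis by simp
  qed
  then show ?thesis by (simp add: trace_def matrix_matrix_mult_def)
qed

lemma trace_form_nondegenerate:
  assumes "\<And>X. trace (Z ** X) = 0"
  shows "Z = (0 :: 'k::field^'n::finite^'n)"
  using assms[of "matrix_unit (_, _)"] by (simp add: trace_matrix_unit vec_eq_iff)

lemma functional_is_trace:
  assumes f: "Vector_Spaces.linear (mat_scale (*)) (*) (f :: 'k::field^'n::finite^'n \<Rightarrow> 'k)"
  shows "\<exists>Y. \<forall>X. f X = trace (Y ** X)"
proof -
  let ?Y = "\<chi> q p. f (matrix_unit (p, q))"
  note lf = linear_functional_simps[OF vector_space_mat_scale f]
  have lt: "Vector_Spaces.linear (mat_scale (*)) (*) (\<lambda>X. trace (?Y ** X))"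
    by (rule linear_if_compatible[OF vector_space_mat_scale vector_space_field])
       (simp_all add: matrix_mult_linear trace_add trace_scale)
  note lt = linear_functional_simps[OF vector_space_mat_scale lt]
  have "f X = trace (?Y ** X)" for X
  proof -
    have "f X = f (\<Sum>l\<in>UNIV. mat_scale (*) (X $ fst l $ snd l) (matrix_unit l))"
      using matrix_eq_sum_units[of X] by simp
    also have "\<dots> = (\<Sum>l\<in>UNIV. X $ fst l $ snd l * trace (?Y ** matrix_unit l))"
      unfolding lf(5) lf(2) by (rule sum.cong) (auto simp: trace_matrix_unit)
    also have "\<dots> = trace (?Y ** (\<Sum>l\<in>UNIV. mat_scale (*) (X $ fst l $ snd l) (matrix_unit l)))"
      unfolding lt(5) lt(2) ..
    also have "\<dots> = trace (?Y ** X)" using matrix_eq_sum_units[of X] by simp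
    finally show ?thesis .
  qed
  then show ?thesis by blast
qed

definition End_action :: "('a \<Rightarrow> 'k::field^'n::finite^'n) \<Rightarrow> 'a \<Rightarrow> 'k^'n^'n \<Rightarrow> 'a \<Rightarrow> 'k^'n^'n" where
  "End_action M = (\<lambda>a Y b. M a ** Y ** M b)"

lemma End_bimod_eq: "End_bimod M = bimod (mat_scale (*)) (End_action M)"
  by (simp add: End_bimod_def End_action_def)

abbreviation endomorphisms :: "('a \<Rightarrow> 'k::field^'n::finite^'n) \<Rightarrow> ('k^'n^'n) set" where
  "endomorphisms M \<equiv> {Y. \<forall>a. Y ** M a = M a ** Y}"

context k_algebra
begin

lemma rep_pointsD:
  assumes "M \<in> rep_points sc t"
  shows "M (a + b) = M a + M b" "M (sc c a) = mat_scale t c (M a)" "M (a * b) = M a ** M b" "M 1 =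
      mat 1"
  using assms by (auto simp: rep_points_def)

lemma End_action_bimodule:
  assumes "M \<in> rep_points sc (*)"
  shows "bimodule_action (mat_scale (*)) (End_action M)"
  unfolding bimodule_action_def bilinear_on_def End_action_def
  using vector_space_mat_scale
  by (auto simp: rep_pointsD[OF assms] matrix_mult_linear matrix_mul_assoc)

text \<open>
  Under the trace form the commutators are the orthogonal complement of the endomorphisms of
  \<open>M\<close>, so the coinvariants of \<open>End(M)\<close> are dual to the endomorphism algebra. The map \<open>\<pi>\<close>
  takes a matrix to the functional that it induces on the endomorphisms; transposing a frame of
  the endomorphisms gives one of the image of \<open>\<pi>\<close> with the same trace, hence the same dimension.
\<close>

lemma coinvariants_dual:
  assumes M: "M \<in> rep_points sc (*)"
  obtains \<pi> :: "'k^'n^'n \<Rightarrow> 'k^'n::finite^'n \<Rightarrow> 'k" and I :: "('k^'n^'n) set" and w \<phi> u \<psi>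
  where "Vector_Spaces.linear (mat_scale (*)) (fun_scale (*)) \<pi>"
    "\<forall>v. \<pi> v = 0 \<longleftrightarrow> v \<in> commutators (mat_scale (*)) (End_action M)"
    "frame (mat_scale (*)) (endomorphisms M) I w \<phi>"
    "frame (fun_scale (*)) (range \<pi>) I u \<psi>"
    "(\<Sum>l\<in>I. \<phi> l (w l)) = (\<Sum>l\<in>I. \<psi> l (u l))"
proof -
  let ?C = "commutators (mat_scale (*)) (End_action M)"
  interpret V: vector_space "mat_scale (*) :: 'k \<Rightarrow> 'k^'n^'n \<Rightarrow> _" by (rule vector_space_mat_scale)
  interpret F: vector_space "fun_scale (*) :: 'k \<Rightarrow> ('k^'n^'n \<Rightarrow> 'k) \<Rightarrow> _"
    by (rule vector_space_fun_scale[OF vector_space_field])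
  have E1: "M 1 = mat 1" by (rule rep_pointsD(4)[OF M])
  define \<pi> where "\<pi> v = (\<lambda>Y. if Y \<in> endomorphisms M then trace (Y ** v) else 0)" for v :: "'k^'n^'n"
  have lin: "Vector_Spaces.linear (mat_scale (*)) (fun_scale (*)) \<pi>"
    by (rule linear_if_compatible[OF V.vector_space_axioms F.vector_space_axioms])
       (auto simp: \<pi>_def fun_eq_iff matrix_mult_linear trace_add trace_scale)
  have comm: "trace (Y ** (M a ** X - X ** M a)) = trace ((Y ** M a - M a ** Y) ** X)" for Y a X
  proof -
    have "trace (Y ** (X ** M a)) = trace (M a ** Y ** X)"
      by (metis matrix_mul_assoc trace_mul_sym)
    then show ?thesis by (simp add: matrix_mult_linear trace_sub matrix_mul_assoc)
  qed
  have ker1: "\<pi> v = 0" if "v \<in> ?C" for v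
  proof
    interpret l: Vector_Spaces.linear "mat_scale (*)" "fun_scale (*)" \<pi> by (rule lin)
    fix Y
    have "\<pi> v = 0" using that unfolding commutators_def
    proof (induction rule: V.span_induct_alt)
      case base then show ?case by (rule l.zero)
    next
      case (step c x y)
      have "\<pi> x = 0"
        using step(1) comm by (auto simp: \<pi>_def End_action_def E1 fun_eq_iff matrix_mult_linear
            trace_0 trace_def)
      then show ?case using step(2) by (simp add: l.add l.scale)
    qed
    then show "\<pi> v Y = 0 Y" by simp
  qed
  have ker2: "v \<in> ?C" if v: "\<pi> v = 0" for v
  proof (rule ccontr)
    assume "v \<notin> ?C"
    moreover have "V.subspace ?C" unfolding commutators_def by (rule V.subspace_span)
    ultimately obtain f where f: "Vector_Spaces.linear (mat_scale (*)) (*) f" "\<And>x. x \<in> ?C \<Longrightarrow> f x =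
        0" "f v = 1"
      using separating_functional[OF V.vector_space_axioms] by blast
    obtain Y where Y: "\<And>X. f X = trace (Y ** X)" using functional_is_trace[OF f(1)] by blast
    have "Y ** M a - M a ** Y = 0" for a
    proof (rule trace_form_nondegenerate)
      fix X
      have "M a ** X - X ** M a \<in> ?C"
        unfolding commutators_def
        by (rule V.span_base, intro CollectI exI[of _ a] exI[of _ X]) (simp add: End_action_def E1)
      then show "trace ((Y ** M a - M a ** Y) ** X) = 0" using f(2) Y comm by metis
    qed
    then have "Y \<in> endomorphisms M" by simp
    then have "\<pi> v Y = 1" using f(3) Y by (simp add: \<pi>_def)
    then show False using v by simp
  qed
  have subE: "V.subspace (endomorphisms M)"
    by (rule subspace_if_closed[OF V.vector_space_axioms]) (simp_all add: matrix_mult_linear)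
  obtain I and w :: "'k^'n^'n \<Rightarrow> 'k^'n^'n" and \<phi> where fr: "frame (mat_scale (*)) (endomorphisms M)
      I w \<phi>"
    using frame_exists[OF V.vector_space_axioms finite_dimensional_matrices subE] by blast
  have "\<forall>l\<in>I. \<exists>v. \<forall>X. \<phi> l X = trace (v ** X)"
    using functional_is_trace frame_linear[OF V.vector_space_axioms fr] by blast
  then obtain v where v: "\<And>l X. l \<in> I \<Longrightarrow> \<phi> l X = trace (v l ** X)" by metis
  have wE: "w l \<in> endomorphisms M" if "l \<in> I" for l using frame_mem[OF V.vector_space_axioms fr
      that] .
  have tr: "\<pi> (v l) (w l) = \<phi> l (w l)" if "l \<in> I" for l
    using wE[OF that] v[OF that] trace_mul_sym[of "w l" "v l"] by (simp add: \<pi>_def)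
  have fr': "frame (fun_scale (*)) (range \<pi>) I (\<lambda>l. \<pi> (v l)) (\<lambda>l g. g (w l))"
    unfolding frame_def
  proof (intro conjI ballI)
    interpret l: Vector_Spaces.linear "mat_scale (*)" "fun_scale (*)" \<pi> by (rule lin)
    show "finite I" by (rule frame_finite[OF V.vector_space_axioms fr])
    show "F.subspace (range \<pi>)" by (rule l.subspace_image[OF V.subspace_UNIV])
    show "Vector_Spaces.linear (fun_scale (*)) (*) (\<lambda>g :: _ \<Rightarrow> 'k. g (w l))" for l
      by (rule linear_if_compatible[OF F.vector_space_axioms vector_space_field]) simp_all
    fix g assume "g \<in> range \<pi>"
    then obtain x where x: "g = \<pi> x" by blast
    show "g = (\<Sum>l\<in>I. fun_scale (*) (g (w l)) (\<pi> (v l)))"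
    proof
      fix Y
      show "g Y = (\<Sum>l\<in>I. fun_scale (*) (g (w l)) (\<pi> (v l))) Y"
      proof (cases "Y \<in> endomorphisms M")
        case True
        have lt: "Vector_Spaces.linear (mat_scale (*)) (*) (\<lambda>Z. trace (Z ** x))"
          by (rule linear_if_compatible[OF V.vector_space_axioms vector_space_field])
             (simp_all add: matrix_mult_linear trace_add trace_scale)
        have "g Y = trace ((\<Sum>l\<in>I. mat_scale (*) (\<phi> l Y) (w l)) ** x)"
          using frame_expand[OF V.vector_space_axioms fr True] True by (simp add: x \<pi>_def)
        also have "\<dots> = (\<Sum>l\<in>I. \<phi> l Y * trace (w l ** x))"
          unfolding linear_functional_simps(5)[OF V.vector_space_axioms lt]
            linear_functional_simps(2)[OF V.vector_space_axioms lt] ..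
        also have "\<dots> = (\<Sum>l\<in>I. g (w l) * \<pi> (v l) Y)"
        proof (rule sum.cong)
          fix l assume l: "l \<in> I"
          show "\<phi> l Y * trace (w l ** x) = g (w l) * \<pi> (v l) Y"
            using True wE[OF l] v[OF l, of Y] trace_mul_sym[of Y "v l"] by (simp add: x \<pi>_def)
        qed simp
        finally show ?thesis by (simp add: sum_fun_apply)
      next
        case False
        then have z: "\<pi> u Y = 0" for u unfolding \<pi>_def by (simp only: if_False)
        show ?thesis by (simp add: x z sum_fun_apply)
      qed
    qed
  qed auto
  have tr': "(\<Sum>l\<in>I. \<phi> l (w l)) = (\<Sum>l\<in>I. \<pi> (v l) (w l))" using tr by simp
  show ?thesis by (rule that[OF lin _ fr fr' tr']) (use ker1 ker2 in blast)
qed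

text \<open>The trace of the operator by which \<open>t\<close> acts on \<open>End(M)\<close>.\<close>

definition env_trace :: "('a \<Rightarrow> 'k^'n::finite^'n) \<Rightarrow> ('a \<times> 'a \<Rightarrow>\<^sub>0 'k) set \<Rightarrow> 'k" where
  "env_trace M t = (\<Sum>l\<in>UNIV. (t \<odot>\<^bsub>End_bimod M\<^esub> matrix_unit l) $ fst l $ snd l)"

lemma env_trace_tensor:
  assumes "M \<in> rep_points sc (*)"
  shows "env_trace M (tensor sc a b) = trace (M a) * trace (M b)"
proof -
  have 1: "(X ** matrix_unit (p, q)) $ i $ j = (if j = q then X $ i $ p else 0)" for X ::
      "'k^'n^'n" and p q i j
  proof -
    have "(\<Sum>k\<in>UNIV. X $ i $ k * matrix_unit (p, q) $ k $ j) = (\<Sum>k\<in>UNIV. if k = p then (if j = q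
        then X $ i $ p else 0) else 0)"
      by (rule sum.cong) (auto simp: matrix_unit_def)
    then show ?thesis by (simp add: matrix_matrix_mult_def)
  qed
  have "(X ** matrix_unit (p, q) ** Y) $ p $ q = X $ p $ p * Y $ q $ q" for X Y :: "'k^'n^'n" and
      p q
  proof -
    have "(X ** matrix_unit (p, q) ** Y) $ p $ q = (\<Sum>k\<in>UNIV. (X ** matrix_unit (p, q)) $ p $ k * Y
        $ k $ q)"
      by (simp add: matrix_matrix_mult_def[of "X ** matrix_unit (p, q)"])
    also have "\<dots> = (\<Sum>k\<in>UNIV. if k = q then X $ p $ p * Y $ q $ q else 0)"
      by (rule sum.cong) (auto simp: 1)
    finally show ?thesis by simp
  qed
  then have "env_trace M (tensor sc a b) = (\<Sum>l\<in>UNIV. case l of (p, q) \<Rightarrow> M a $ p $ p * M b $ q $ q)"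
    by (simp add: env_trace_def End_bimod_eq tensor_smult[OF End_action_bimodule[OF assms]])
       (auto simp: End_action_def intro!: sum.cong)
  also have "\<dots> = (\<Sum>p\<in>UNIV. \<Sum>q\<in>UNIV. M a $ p $ p * M b $ q $ q)"
    unfolding UNIV_Times_UNIV[symmetric] by (rule sum.cartesian_product[symmetric])
  also have "\<dots> = trace (M a) * trace (M b)" by (simp add: trace_def sum_product)
  finally show ?thesis .
qed

lemma env_trace_add:
  assumes "M \<in> rep_points sc (*)" "t \<in> carrier E" "u \<in> carrier E"
  shows "env_trace M (t \<oplus>\<^bsub>E\<^esub> u) = env_trace M t + env_trace M u"
  using left_module.smult_l_distr[OF left_module_bimod[OF End_action_bimodule[OF assms(1)]]
      assms(2,3)]
  by (simp add: env_trace_def End_bimod_eq sum.distrib)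

lemma hom_End_frame:
  assumes M: "M \<in> rep_points sc (*)" and db: "dual_basis E Q I b f"
    and p: "p \<in> lmod_hom E Q Q" "\<And>x. x \<in> carrier Q \<Longrightarrow> p (p x) = p x"
  obtains w \<phi> where "frame (fun_scale (mat_scale (*)))
      {\<psi> \<in> lmod_hom E Q (End_bimod M). \<forall>x\<in>carrier Q. \<psi> (p x) = \<psi> x} (I \<times> (UNIV :: ('n::finite \<times>
          'n) set)) w \<phi>"
    "(\<Sum>l\<in>I \<times> (UNIV :: ('n \<times> 'n) set). \<phi> l (w l)) = (\<Sum>i\<in>I. env_trace (M :: 'a \<Rightarrow> 'k^'n^'n) (f i (p
        (b i))))"
proof -
  note fr = hom_frame[OF End_action_bimodule[OF M] db p frame_matrix_units, folded End_bimod_eq]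
  show ?thesis
    by (rule that[OF fr], assumption) (unfold env_trace_def sum.cartesian_product
        case_prod_unfold, rule refl)
qed

end

section \<open>The dimension formula\<close>

context cy2_resolution
begin

lemma bimod_coboundary_cocycle:
  assumes act: "bimodule_action s act"
  shows "(\<lambda>\<psi> x. \<psi> (d i x)) ` lmod_hom E (P i) (bimod s act) \<subseteq> bimod_cocycles s act P d (Suc i)"
proof clarify
  fix \<psi> assume \<psi>: "\<psi> \<in> lmod_hom E (P i) (bimod s act)"
  have "d i (d (Suc i) x) = \<zero>\<^bsub>P i\<^esub>" if "x \<in> carrier (P (Suc (Suc i)))" for x
    using res(7)[of i] that by (auto simp: syzygy_def)
  then show "(\<lambda>x. \<psi> (d i x)) \<in> bimod_cocycles s act P d (Suc i)"
    using lmod_hom_comp[OF res(1) left_module_bimod[OF act] res(3) \<psi>] hom_bimod_zero[OF act res(1)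
        \<psi>]
    by (simp add: bimod_cocycles_def)
qed

text \<open>
  The cochains are the homomorphisms from a fixed finitely generated projective module, that is, the
  image of an idempotent on a power of \<open>End(M)\<close>. Their dimension is the trace of that idempotent,
  which depends on \<open>M\<close> only through the traces of fixed elements \<open>t j\<close>.
\<close>

lemma hom_trace_formula:
  shows "\<exists>(J :: 'f set) t. finite J \<and> (\<forall>j\<in>J. t j \<in> carrier E) \<and>
      (\<forall>M\<in>rep_points sc (*). \<exists>w \<phi>. frame (fun_scale (mat_scale (*)))
          (lmod_hom E (P i) (End_bimod (M :: 'a \<Rightarrow> 'k^'n::finite^'n))) (J \<times> (UNIV :: ('n \<times> 'n)
              set)) w \<phi> \<and>
         (\<Sum>l\<in>J \<times> UNIV. \<phi> l (w l)) = (\<Sum>j\<in>J. env_trace M (t j)))"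
proof -
  obtain J and b :: "'f \<Rightarrow> 'f" and f where db: "dual_basis E (P i) J b f" using res(2) by blast
  note D = dual_basisD[OF db]
  let ?p = "\<lambda>x. if x \<in> carrier (P i) then x else \<zero>\<^bsub>P i\<^esub>"
  have p: "?p \<in> lmod_hom E (P i) (P i)" by (rule lmod_hom_id[OF res(1)])
  have "\<exists>w \<phi>. frame (fun_scale (mat_scale (*)))
          (lmod_hom E (P i) (End_bimod M)) (J \<times> (UNIV :: ('n \<times> 'n) set)) w \<phi> \<and>
         (\<Sum>l\<in>J \<times> UNIV. \<phi> l (w l)) = (\<Sum>j\<in>J. env_trace M (f j (b j)))"
    if M: "M \<in> rep_points sc (*)" for M :: "'a \<Rightarrow> 'k^'n^'n"
  proof -
    obtain w \<phi> where 1: "frame (fun_scale (mat_scale (*)))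
      {\<psi> \<in> lmod_hom E (P i) (End_bimod M). \<forall>x\<in>carrier (P i). \<psi> (?p x) = \<psi> x} (J \<times> (UNIV :: ('n \<times>
          'n) set)) w \<phi>"
      and 2: "(\<Sum>l\<in>J \<times> (UNIV :: ('n \<times> 'n) set). \<phi> l (w l)) = (\<Sum>i\<in>J. env_trace M (f i (?p (b i))))"
      by (rule hom_End_frame[OF M db p]) auto
    have "{\<psi> \<in> lmod_hom E (P i) (End_bimod M). \<forall>x\<in>carrier (P i). \<psi> (?p x) = \<psi> x} = lmod_hom E (P
        i) (End_bimod M)"
      by auto
    moreover have "(\<Sum>i\<in>J. env_trace M (f i (?p (b i)))) = (\<Sum>i\<in>J. env_trace M (f i (b i)))"
      using D(3) by (intro sum.cong) auto
    ultimately show ?thesis using 1 2 by auto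
  qed
  moreover have "f j (b j) \<in> carrier E" if "j \<in> J" for j
    using lmod_homD(1)[OF D(4)[OF that] D(3)[OF that]] by simp
  ultimately show ?thesis by (intro exI[of _ J] exI[of _ "\<lambda>j. f j (b j)"] conjI ballI D(2))
qed

text \<open>
  The two-cocycles are also the homomorphisms from a projective module, namely from the complement
  of the image of \<open>P 3\<close> in \<open>P 2\<close>.
\<close>

lemma cocycle_trace_formula:
  shows "\<exists>(J :: 'f set) t. finite J \<and> (\<forall>j\<in>J. t j \<in> carrier E) \<and>
      (\<forall>M\<in>rep_points sc (*). \<exists>w \<phi>. frame (fun_scale (mat_scale (*)))
          (bimod_cocycles (mat_scale (*)) (End_action (M :: 'a \<Rightarrow> 'k^'n::finite^'n)) P d (Suc (Suc
              0)))
          (J \<times> (UNIV :: ('n \<times> 'n) set)) w \<phi> \<and>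
         (\<Sum>l\<in>J \<times> UNIV. \<phi> l (w l)) = (\<Sum>j\<in>J. env_trace M (t j)))"
proof -
  let ?Q = "P (Suc (Suc 0))"
  obtain J and b :: "'f \<Rightarrow> 'f" and f where db: "dual_basis E ?Q J b f" using res(2) by blast
  note D = dual_basisD[OF db]
  obtain p where p: "p \<in> lmod_hom E ?Q ?Q"
    and pd: "\<forall>x\<in>carrier (P (Suc (Suc (Suc 0)))). p (d (Suc (Suc 0)) x) = \<zero>\<^bsub>?Q\<^esub>"
    and px: "\<forall>x\<in>carrier ?Q. \<exists>y\<in>carrier (P (Suc (Suc (Suc 0)))). p x = x \<ominus>\<^bsub>?Q\<^esub> d (Suc (Suc 0)) y"
    by (rule complement_projection)
  have pp: "p (p x) = p x" for x by (rule cocycle_factors[OF res(1) p _ p px]) (use pd in blast)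
  have "\<exists>w \<phi>. frame (fun_scale (mat_scale (*)))
          (bimod_cocycles (mat_scale (*)) (End_action M) P d (Suc (Suc 0)))
          (J \<times> (UNIV :: ('n \<times> 'n) set)) w \<phi> \<and>
         (\<Sum>l\<in>J \<times> UNIV. \<phi> l (w l)) = (\<Sum>j\<in>J. env_trace M (f j (p (b j))))"
    if M: "M \<in> rep_points sc (*)" for M :: "'a \<Rightarrow> 'k^'n^'n"
  proof -
    note act = End_action_bimodule[OF M]
    obtain w \<phi> where 1: "frame (fun_scale (mat_scale (*)))
      {\<psi> \<in> lmod_hom E ?Q (End_bimod M). \<forall>x\<in>carrier ?Q. \<psi> (p x) = \<psi> x} (J \<times> (UNIV :: ('n \<times> 'n)
          set)) w \<phi>"
      and 2: "(\<Sum>l\<in>J \<times> (UNIV :: ('n \<times> 'n) set). \<phi> l (w l)) = (\<Sum>i\<in>J. env_trace M (f i (p (b i))))"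
      by (rule hom_End_frame[OF M db p pp])
    have "\<psi> (d (Suc (Suc 0)) x) = 0" if "\<psi> \<in> lmod_hom E ?Q (bimod (mat_scale (*)) (End_action M))"
      "\<forall>x\<in>carrier ?Q. \<psi> (p x) = \<psi> x" "x \<in> carrier (P (Suc (Suc (Suc 0))))" for \<psi> x
      using that pd lmod_homD(1)[OF res(3) that(3)] hom_bimod_zero[OF act res(1) that(1)] by metis
    moreover have "\<psi> (p x) = \<psi> x" if "\<psi> \<in> bimod_cocycles (mat_scale (*)) (End_action M) P d (Suc
        (Suc 0))" for \<psi> x
      using that by (intro cocycle_factors[OF left_module_bimod[OF act] _ _ p px]) (auto simp:
          bimod_cocycles_def)
    ultimately have "{\<psi> \<in> lmod_hom E ?Q (End_bimod M). \<forall>x\<in>carrier ?Q. \<psi> (p x) = \<psi> x} =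
        bimod_cocycles (mat_scale (*)) (End_action M) P d (Suc (Suc 0))"
      by (auto simp: bimod_cocycles_def End_bimod_eq)
    then show ?thesis using 1 2 by auto
  qed
  moreover have "f j (p (b j)) \<in> carrier E" if "j \<in> J" for j
    using lmod_homD(1)[OF D(4)[OF that] lmod_homD(1)[OF p D(3)[OF that]]] by simp
  ultimately show ?thesis by (intro exI[of _ J] exI[of _ "\<lambda>j. f j (p (b j))"] conjI ballI D(2))
qed

end

text \<open>
  With \<open>c0\<close>, \<open>c1\<close> the dimensions of the cochains and \<open>z2\<close> that of the two-cocycles, the Euler
  characteristic \<open>c0 - c1 + z2\<close> enters through the exact sequence of derivations, through
  rank-nullity for the differential, and through duality, which turns the second cohomology into
  the endomorphisms of \<open>M\<close>.
\<close>

lemma dimension_formula: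
  fixes sc :: "'k::field_char_0 \<Rightarrow> 'a::{ring,monoid_mult} \<Rightarrow> 'a" and M :: "'a \<Rightarrow> 'k^'n::finite^'n"
  assumes cy: "cy2_resolution sc P d e" and M: "M \<in> rep_points sc (*)"
  defines "act \<equiv> End_action M" and "s \<equiv> mat_scale (*)"
  shows "vector_space.dim (fun_scale s) (k_algebra.derivations sc s act) +
     vector_space.dim (fun_scale s) (lmod_hom (env_alg sc) (P 0) (End_bimod M)) +
     vector_space.dim (fun_scale s) (k_algebra.bimod_cocycles sc s act P d (Suc (Suc 0))) =
     vector_space.dim s (UNIV :: ('k^'n^'n) set) +
     vector_space.dim (fun_scale s) (lmod_hom (env_alg sc) (P (Suc 0)) (End_bimod M)) + End_dim M"
    and "finite_dimensional (fun_scale s) (k_algebra.derivations sc s act)"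
proof -
  interpret cy2_resolution sc P d e by fact
  have act: "bimodule_action s act" unfolding s_def act_def by (rule End_action_bimodule[OF M])
  have eq: "End_bimod M = bimod s act" by (simp add: End_bimod_eq s_def act_def)
  have vs: "vector_space s" unfolding s_def by (rule vector_space_mat_scale)
  interpret V: vector_space s by (rule vs)
  interpret F: vector_space "fun_scale s :: 'k \<Rightarrow> ('b \<Rightarrow> 'k^'n^'n) \<Rightarrow> _" by (rule
      vector_space_fun_scale[OF vs])
  let ?C = "\<lambda>i. lmod_hom E (P i) (bimod s act)" and ?Z = "bimod_cocycles s act P d"
  let ?B = "(\<lambda>\<psi> x. \<psi> (d (Suc 0) x)) ` ?C (Suc 0)"
  have finC: "finite_dimensional (fun_scale s) (?C i)" for i
  proof -
    obtain J :: "'b set" and w \<phi> where "frame (fun_scale s) (?C i) (J \<times> (UNIV :: ('n \<times> 'n) set)) w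
        \<phi>"
      using hom_trace_formula[where 'n = 'n, of i] M unfolding s_def[symmetric] eq[symmetric] by
          blast
    then show ?thesis by (rule frame_finite_dimensional[OF F.vector_space_axioms])
  qed
  have finZ: "finite_dimensional (fun_scale s) (?Z i)" for i
    by (rule finite_dimensional_subset[OF F.vector_space_axioms finC]) (auto simp:
        bimod_cocycles_def)
  have finV: "finite_dimensional s (UNIV :: ('k^'n^'n) set)" unfolding s_def by (rule
      finite_dimensional_matrices)
  note subZ = bimod_cocycles_subspace[OF act] and subC = hom_bimod_subspace[OF act]
  have k: "k_algebra sc" by (rule k_algebra_axioms)
  have I: "F.dim (?C 0) + vector_space.dim (fun_scale s) (derivations s act) = F.dim (?Z (Suc 0))
      + V.dim UNIV"
    using dim_derivations(2)[OF k act resolution finV finC finZ] by simp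
  show "finite_dimensional (fun_scale s) (derivations s act)"
    by (rule dim_derivations(1)[OF k act resolution finV finC finZ])
  have II: "F.dim (?C (Suc 0)) = F.dim (?Z (Suc 0)) + F.dim ?B"
  proof -
    have lin: "Vector_Spaces.linear (fun_scale s) (fun_scale s) (\<lambda>(\<psi> :: 'b \<Rightarrow> 'k^'n^'n) x. \<psi> (d
        (Suc 0) x))"
      by (rule linear_if_compatible[OF F.vector_space_axioms F.vector_space_axioms]) (simp_all
          add: fun_eq_iff)
    have "{\<psi> \<in> ?C (Suc 0). (\<lambda>x. \<psi> (d (Suc 0) x)) = 0} = ?Z (Suc 0)"
      using lmod_homD(4)[OF res(3)] hom_bimod_zero[OF act res(1)]
      by (auto simp: bimod_cocycles_def fun_eq_iff)
    then show ?thesis using rank_nullity(1)[OF lin subC finC] by simp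
  qed
  have III: "F.dim (?Z (Suc (Suc 0))) = F.dim ?B + End_dim M"
  proof -
    obtain T where T: "Vector_Spaces.linear (fun_scale s) s T"
      "\<forall>\<phi>\<in>?Z (Suc (Suc 0)). T \<phi> \<in> commutators s act \<longleftrightarrow> \<phi> \<in> ?B"
      "\<forall>v. \<exists>\<phi>\<in>?Z (Suc (Suc 0)). T \<phi> - v \<in> commutators s act"
      by (rule second_cohomology[OF act])
    obtain \<pi> :: "'k^'n^'n \<Rightarrow> 'k^'n^'n \<Rightarrow> 'k" and I :: "('k^'n^'n) set" and w \<phi> u \<psi>
      where \<pi>: "Vector_Spaces.linear s (fun_scale (*)) \<pi>" "\<forall>v. \<pi> v = 0 \<longleftrightarrow> v \<in> commutators s act"
        and fr: "frame s (endomorphisms M) I w \<phi>" "frame (fun_scale (*)) (range \<pi>) I u \<psi>"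
          "(\<Sum>l\<in>I. \<phi> l (w l)) = (\<Sum>l\<in>I. \<psi> l (u l))"
      unfolding s_def act_def by (rule coinvariants_dual[OF M])
    interpret \<pi>: Vector_Spaces.linear s "fun_scale (*)" \<pi> by (rule \<pi>(1))
    note vf = vector_space_fun_scale[OF vector_space_field]
    have lin: "Vector_Spaces.linear (fun_scale s) (fun_scale (*)) (\<lambda>\<phi>. \<pi> (T \<phi>))"
      using Vector_Spaces.linear_compose[OF T(1) \<pi>(1)] by (simp add: comp_def)
    have ker: "{\<phi> \<in> ?Z (Suc (Suc 0)). \<pi> (T \<phi>) = 0} = ?B"
      using T(2) \<pi>(2) bimod_coboundary_cocycle[OF act, of "Suc 0"] by blast
    have img: "(\<lambda>\<phi>. \<pi> (T \<phi>)) ` ?Z (Suc (Suc 0)) = range \<pi>"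
    proof (intro equalityI subsetI)
      fix g assume "g \<in> range \<pi>"
      then obtain v where v: "g = \<pi> v" by blast
      obtain \<phi> where \<phi>: "\<phi> \<in> ?Z (Suc (Suc 0))" "T \<phi> - v \<in> commutators s act" using T(3) by blast
      have "\<pi> (T \<phi> - v) = 0" using \<pi>(2) \<phi>(2) by blast
      then have "\<pi> (T \<phi>) = g" by (simp add: \<pi>.diff v)
      then show "g \<in> (\<lambda>\<phi>. \<pi> (T \<phi>)) ` ?Z (Suc (Suc 0))" using \<phi>(1) by blast
    qed blast
    have "(of_nat (vector_space.dim (fun_scale (*)) (range \<pi>)) :: 'k) = of_nat (V.dim
        (endomorphisms M))"
      using dim_eq_frame_trace[OF vf fr(2)] dim_eq_frame_trace[OF vs fr(1)] fr(3) by simp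
    then have "vector_space.dim (fun_scale (*)) (range \<pi>) = End_dim M"
      using of_nat_eq_iff by (simp add: End_dim_def s_def)
    then show ?thesis using rank_nullity(1)[OF lin subZ finZ] by (simp add: ker img)
  qed
  show "vector_space.dim (fun_scale s) (derivations s act) + F.dim (lmod_hom E (P 0) (End_bimod
      M)) +
     F.dim (?Z (Suc (Suc 0))) = V.dim (UNIV :: ('k^'n^'n) set) +
     F.dim (lmod_hom E (P (Suc 0)) (End_bimod M)) + End_dim M"
    using I II III by (simp add: eq)
qed

section \<open>Dual numbers\<close>

datatype 'a dual = Dual (re: 'a) (eps: 'a)

instantiation dual :: (comm_ring_1) comm_ring_1
begin

definition "0 = Dual 0 0"
definition "1 = Dual 1 0"
definition "x + y = Dual (re x + re y) (eps x + eps y)"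
definition "- x = Dual (- re x) (- eps x)"
definition "x - y = Dual (re x - re y) (eps x - eps y)"
definition "x * y = Dual (re x * re y) (re x * eps y + eps x * re y)"

instance
  by standard
     (auto simp: zero_dual_def one_dual_def plus_dual_def uminus_dual_def minus_dual_def
         times_dual_def algebra_simps)

end

lemma dual_simps [simp]:
  "re 0 = 0" "eps 0 = 0" "re 1 = 1" "eps 1 = 0"
  "re (x + y) = re x + re y" "eps (x + y) = eps x + eps y"
  "re (x - y) = re x - re y" "eps (x - y) = eps x - eps y"
  "re (x * y) = re x * re y" "eps (x * y) = re x * eps y + eps x * re y"
  by (simp_all add: zero_dual_def one_dual_def plus_dual_def minus_dual_def times_dual_def)

lemma dual_sum [simp]: "re (sum f A) = (\<Sum>a\<in>A. re (f a))" "eps (sum f A) = (\<Sum>a\<in>A. eps (f a))"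
  by (induction A rule: infinite_finite_induct) simp_all

definition dual_scale :: "'k::comm_ring_1 \<Rightarrow> 'k dual \<Rightarrow> 'k dual" where
  "dual_scale c x = Dual (c * re x) (c * eps x)"

definition dual_point :: "('a \<Rightarrow> 'k::comm_ring_1^'n^'n) \<Rightarrow> ('a \<Rightarrow> 'k^'n^'n) \<Rightarrow> 'a \<Rightarrow> 'k dual^'n^'n" where
  "dual_point M D a = (\<chi> i j. Dual (M a $ i $ j) (D a $ i $ j))"

section \<open>Evaluation of coordinate functions\<close>

definition monomial_value :: "('a \<Rightarrow> 'b::comm_ring_1^'n^'n) \<Rightarrow> ('a \<times> 'n \<times> 'n \<Rightarrow>\<^sub>0 nat) \<Rightarrow> 'b" where
  "monomial_value M m = (\<Prod>v\<in>Poly_Mapping.keys m. (case v of (a, i, j) \<Rightarrow> M a $ i $ j) ^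
      Poly_Mapping.lookup m v)"

lemma eval_poly_alt: "eval_poly t M p = lin_ext t (monomial_value M) p"
  by (simp add: eval_poly_def monomial_value_def[abs_def])

lemma monomial_value_superset:
  assumes "finite A" "Poly_Mapping.keys m \<subseteq> A"
  shows "monomial_value M m = (\<Prod>v\<in>A. (case v of (a, i, j) \<Rightarrow> M a $ i $ j) ^ Poly_Mapping.lookup m v)"
  unfolding monomial_value_def using assms
  by (intro prod.mono_neutral_left) (auto simp: in_keys_iff)

lemma monomial_value_add: "monomial_value M (m + m') = monomial_value M m * monomial_value M m'"
proof -
  let ?A = "Poly_Mapping.keys m \<union> Poly_Mapping.keys m'"
  have "finite ?A" "Poly_Mapping.keys (m + m') \<subseteq> ?A" by (auto simp: keys_add)
  then show ?thesis
    by (simp add: monomial_value_superset[of ?A] lookup_add power_add prod.distrib)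
qed

locale scalar_algebra = vector_space t
  for t :: "'k::field \<Rightarrow> 'b::comm_ring_1 \<Rightarrow> 'b" +
  assumes scalar_mult: "t c x * y = t c (x * y)"
begin

lemma eval_add: "eval_poly t M (p + q) = eval_poly t M p + eval_poly t M q"
  and eval_diff: "eval_poly t M (p - q) = eval_poly t M p - eval_poly t M q"
  and eval_zero: "eval_poly t M 0 = 0"
  and eval_single: "eval_poly t M (Poly_Mapping.single m c) = t c (monomial_value M m)"
  and eval_sum: "eval_poly t M (sum f A) = (\<Sum>a\<in>A. eval_poly t M (f a))"
  unfolding eval_poly_alt
  by (simp_all only: lin_ext_add[OF vector_space_axioms] lin_ext_diff[OF vector_space_axioms]
      lin_ext_zero[OF vector_space_axioms] lin_ext_single[OF vector_space_axioms] lin_ext_sum[OF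
          vector_space_axioms])

lemma eval_const: "eval_poly t M (const_poly c) = t c 1"
  by (simp add: const_poly_def eval_single monomial_value_def)

lemma eval_one: "eval_poly t M 1 = 1"
  using eval_const[of M 1] by (simp add: const_poly_def)

lemma eval_entry: "eval_poly t M (entry a i j) = M a $ i $ j"
  by (simp add: entry_def eval_single monomial_value_def)

lemma eval_mult: "eval_poly t M (p * q) = eval_poly t M p * eval_poly t M q"
proof (induction p rule: poly_mapping_add_induct)
  fix m c
  show "eval_poly t M (Poly_Mapping.single m c * q) = eval_poly t M (Poly_Mapping.single m c) *
      eval_poly t M q"
  proof (induction q rule: poly_mapping_add_induct)
    fix m' c'
    show "eval_poly t M (Poly_Mapping.single m c * Poly_Mapping.single m' c') =
        eval_poly t M (Poly_Mapping.single m c) * eval_poly t M (Poly_Mapping.single m' c')"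
      using scalar_mult[of c "monomial_value M m"] scalar_mult[of c' "monomial_value M m'"
          "monomial_value M m"]
      by (simp add: mult_single eval_single monomial_value_add mult.commute[of "monomial_value M
          m"])
  qed (simp add: eval_add distrib_left)
qed (simp add: eval_add distrib_right)

end

lemma scalar_algebra_field: "scalar_algebra ((*) :: 'k::field \<Rightarrow> 'k \<Rightarrow> 'k)"
  by unfold_locales (simp_all add: algebra_simps)

lemma scalar_algebra_dual: "scalar_algebra (dual_scale :: 'k::field \<Rightarrow> _)"
  by unfold_locales
     (simp_all add: dual_scale_def plus_dual_def times_dual_def algebra_simps)

interpretation ev: scalar_algebra "(*) :: 'k::field \<Rightarrow> 'k \<Rightarrow> 'k" by (rule scalar_algebra_field)
interpretation dual: scalar_algebra "dual_scale :: 'k::field \<Rightarrow> 'k dual \<Rightarrow> _" by (rule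
    scalar_algebra_dual)

lemma rep_poly_ring_simps:
  "carrier rep_poly_ring = UNIV" "p \<otimes>\<^bsub>rep_poly_ring\<^esub> q = p * q" "\<one>\<^bsub>rep_poly_ring\<^esub> = 1"
  "\<zero>\<^bsub>rep_poly_ring\<^esub> = 0" "p \<oplus>\<^bsub>rep_poly_ring\<^esub> q = p + q"
  by (simp_all add: rep_poly_ring_def)

lemma ring_rep_poly_ring: "ring (rep_poly_ring :: ('a, 'n, 'k::field) rep_poly ring)"
proof (rule ringI)
  show "abelian_group (rep_poly_ring :: ('a, 'n, 'k) rep_poly ring)"
    by (rule abelian_groupI) (auto simp: rep_poly_ring_simps algebra_simps intro: exI[of _ "- _"])
  show "Group.monoid (rep_poly_ring :: ('a, 'n, 'k) rep_poly ring)"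
    by (rule monoidI) (auto simp: rep_poly_ring_simps mult.assoc)
qed (auto simp: rep_poly_ring_simps algebra_simps)

lemma const_poly_hom:
  "const_poly (c + d) = const_poly c + const_poly d" "const_poly (c - d) = const_poly c -
      const_poly d"
  "const_poly (c * d) = const_poly c * const_poly d" "const_poly 0 = 0" "const_poly 1 = 1"
  by (simp_all add: const_poly_def single_add single_diff mult_single)

lemma const_poly_mult_single: "const_poly c * Poly_Mapping.single m a = Poly_Mapping.single m (c *
    a)"
  by (simp add: const_poly_def mult_single)

definition rep_class :: "('k::field \<Rightarrow> 'a::{ring,monoid_mult} \<Rightarrow> 'a) \<Rightarrow> ('a, 'n::finite, 'k) rep_poly
    \<Rightarrow> ('a, 'n, 'k) rep_poly set" where
  "rep_class sc p = rep_ideal sc +>\<^bsub>rep_poly_ring\<^esub> p"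

lemma rep_ideal_ideal: "ideal (rep_ideal sc) rep_poly_ring"
proof -
  interpret ring rep_poly_ring by (rule ring_rep_poly_ring)
  show ?thesis unfolding rep_ideal_def by (rule genideal_ideal) (simp add: rep_poly_ring_simps)
qed

lemma rep_ideal_generators:
  fixes sc :: "'k::field \<Rightarrow> 'a::{ring,monoid_mult} \<Rightarrow> 'a" and i j :: "'n::finite"
  shows "entry (a + b) i j - entry a i j - entry b i j \<in> rep_ideal sc"
  "entry (sc c a) i j - const_poly c * entry a i j \<in> rep_ideal sc"
  "entry (a * b) i j - (\<Sum>l\<in>UNIV. entry a i l * entry b l j) \<in> rep_ideal sc"
  "entry 1 i j - (if i = j then 1 else 0) \<in> rep_ideal sc"
proof -
  interpret ring "rep_poly_ring :: ('a, 'n, 'k) rep_poly ring" by (rule ring_rep_poly_ring)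
  note g = subsetD[OF genideal_self]
  show "entry (a + b) i j - entry a i j - entry b i j \<in> rep_ideal sc"
    "entry (sc c a) i j - const_poly c * entry a i j \<in> rep_ideal sc"
    "entry (a * b) i j - (\<Sum>l\<in>UNIV. entry a i l * entry b l j) \<in> rep_ideal sc"
    "entry 1 i j - (if i = j then 1 else 0) \<in> rep_ideal sc"
    unfolding rep_ideal_def by (rule g, simp add: rep_poly_ring_simps, blast)+
qed

lemma (in scalar_algebra) eval_rep_ideal:
  fixes M :: "'a::{ring,monoid_mult} \<Rightarrow> 'b^'n::finite^'n"
  assumes "M \<in> rep_points sc t" "p \<in> rep_ideal sc"
  shows "eval_poly t M p = 0"
proof -
  interpret R: ring "rep_poly_ring :: ('a, 'n, 'k) rep_poly ring" by (rule ring_rep_poly_ring)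
  have neg: "\<ominus>\<^bsub>rep_poly_ring\<^esub> p = - p" for p :: "('a, 'n, 'k) rep_poly"
    by (rule R.minus_equality) (auto simp: rep_poly_ring_simps)
  let ?K = "{p :: ('a, 'n, 'k) rep_poly. eval_poly t M p = 0}"
  have "ideal ?K rep_poly_ring"
  proof (rule idealI[OF ring_rep_poly_ring])
    show "subgroup ?K (add_monoid rep_poly_ring)"
      by (rule R.add.subgroupI)
         (use eval_zero eval_diff[of M 0] in \<open>auto simp: rep_poly_ring_simps eval_add neg[unfolded
             a_inv_def] a_inv_def[symmetric] neg\<close>)
  qed (auto simp: rep_poly_ring_simps eval_mult)
  moreover have "{entry (a + b) i j - entry a i j - entry b i j | a b i j. True} \<union>
      {entry (sc c a) i j - const_poly c * entry a i j | c a i j. True} \<union>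
      {entry (a * b) i j - (\<Sum>l\<in>UNIV. entry a i l * entry b l j) | a b i j. True} \<union>
      {entry 1 i j - (if i = j then 1 else 0) | i j. True} \<subseteq> ?K"
    using assms(1) scalar_mult[of _ 1]
    by (auto simp: rep_points_def eval_diff eval_entry eval_mult eval_sum eval_const eval_one
        eval_zero mat_scale_def
        matrix_matrix_mult_def mat_def)
  ultimately have "rep_ideal sc \<subseteq> ?K" unfolding rep_ideal_def by (rule R.genideal_minimal)
  then show ?thesis using assms(2) by blast
qed

lemma rep_class_eq: "rep_class sc p = {i + p | i. i \<in> rep_ideal sc}"
  by (auto simp: rep_class_def a_r_coset_def' rep_poly_ring_simps)

lemma coord_ring_ops:
  "carrier (coord_ring sc) = range (rep_class sc)"
  "rep_class sc p \<oplus>\<^bsub>coord_ring sc\<^esub> rep_class sc q = rep_class sc (p + q)"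
  "rep_class sc p \<otimes>\<^bsub>coord_ring sc\<^esub> rep_class sc q = rep_class sc (p * q)"
proof -
  note h = ideal.rcos_ring_hom[OF rep_ideal_ideal[of sc]]
  show "carrier (coord_ring sc) = range (rep_class sc)"
    by (auto simp: rep_class_def coord_ring_def FactRing_def A_RCOSETS_def' a_r_coset_def'
        rep_poly_ring_simps)
  show "rep_class sc p \<oplus>\<^bsub>coord_ring sc\<^esub> rep_class sc q = rep_class sc (p + q)"
    "rep_class sc p \<otimes>\<^bsub>coord_ring sc\<^esub> rep_class sc q = rep_class sc (p * q)"
    using ring_hom_add[OF h, of p q] ring_hom_mult[OF h, of p q]
    by (simp_all add: rep_class_def coord_ring_def rep_poly_ring_simps)
qed

lemma rep_class_cong: "p - q \<in> rep_ideal sc \<Longrightarrow> rep_class sc p = rep_class sc q"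
proof -
  interpret I: ideal "rep_ideal sc" rep_poly_ring by (rule rep_ideal_ideal)
  assume a: "p - q \<in> rep_ideal sc"
  have "p \<in> rep_class sc q" unfolding rep_class_eq using a by (intro CollectI exI[of _ "p - q"])
      simp
  then show ?thesis
    unfolding rep_class_def
    by (intro I.a_repr_independence[symmetric, OF _ _ I.a_subgroup]) (simp_all add:
        rep_poly_ring_simps)
qed

lemma some_representative:
  "\<exists>i\<in>rep_ideal sc. (SOME q. q \<in> rep_class sc p) = i + p"
proof -
  interpret I: ideal "rep_ideal sc" rep_poly_ring by (rule rep_ideal_ideal)
  have "p \<in> rep_class sc p"
    unfolding rep_class_eq using additive_subgroup.zero_closed[OF I.is_additive_subgroup] by (auto
        simp: rep_poly_ring_simps intro: exI[of _ 0])
  then have "(SOME q. q \<in> rep_class sc p) \<in> rep_class sc p" by (rule someI)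
  then show ?thesis by (auto simp: rep_class_eq)
qed

lemma eval_at_class:
  assumes "M \<in> rep_points sc (*)"
  shows "eval_at (*) M (rep_class sc p) = eval_poly (*) M p"
  using some_representative[of sc p] ev.eval_rep_ideal[OF assms]
  by (auto simp: eval_at_def ev.eval_add)

lemma mem_max_ideal:
  assumes "M \<in> rep_points sc (*)"
  shows "f \<in> max_ideal_at sc M \<longleftrightarrow> (\<exists>p. f = rep_class sc p \<and> eval_poly (*) M p = 0)"
  by (auto simp: max_ideal_at_def coord_ring_ops eval_at_class[OF assms])

section \<open>Tangent vectors are derivations\<close>

text \<open>The function \<open>p - p(M)\<close>, as an element of the maximal ideal at \<open>M\<close>.\<close>

definition centred :: "('k::field \<Rightarrow> 'a::{ring,monoid_mult} \<Rightarrow> 'a) \<Rightarrow> ('a \<Rightarrow> 'k^'n::finite^'n) \<Rightarrow>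
    ('a, 'n, 'k) rep_poly \<Rightarrow> ('a, 'n, 'k) rep_poly set" where
  "centred sc M p = rep_class sc (p - const_poly (eval_poly (*) M p))"

lemma centred_mem: "M \<in> rep_points sc (*) \<Longrightarrow> centred sc M p \<in> max_ideal_at sc M"
  by (auto simp: mem_max_ideal centred_def ev.eval_diff ev.eval_const)

lemma tangent_spaceD:
  assumes "\<phi> \<in> tangent_space sc M"
  shows "f \<in> max_ideal_at sc M \<Longrightarrow> g \<in> max_ideal_at sc M \<Longrightarrow> \<phi> (f \<oplus>\<^bsub>coord_ring sc\<^esub> g) = \<phi> f + \<phi> g"
    "f \<in> max_ideal_at sc M \<Longrightarrow> \<phi> (rep_class sc (const_poly c) \<otimes>\<^bsub>coord_ring sc\<^esub> f) = c * \<phi> f"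
    "f \<in> max_ideal_at sc M \<Longrightarrow> g \<in> max_ideal_at sc M \<Longrightarrow> \<phi> (f \<otimes>\<^bsub>coord_ring sc\<^esub> g) = 0"
    "f \<notin> max_ideal_at sc M \<Longrightarrow> \<phi> f = 0"
  using assms by (auto simp: tangent_space_def Let_def rep_class_def intro: ideal_prod.prod)

text \<open>
  A tangent vector extends to a derivation of the coordinate ring at \<open>M\<close> that is zero on
  constants.
\<close>

lemma tangent_leibniz:
  assumes M: "M \<in> rep_points sc (*)" and \<phi>: "\<phi> \<in> tangent_space sc M"
  shows "\<phi> (centred sc M (p + q)) = \<phi> (centred sc M p) + \<phi> (centred sc M q)"
    "\<phi> (centred sc M (const_poly c)) = 0"
    "\<phi> (centred sc M (p * q)) =
        eval_poly (*) M p * \<phi> (centred sc M q) + eval_poly (*) M q * \<phi> (centred sc M p)"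
    "p - q \<in> rep_ideal sc \<Longrightarrow> \<phi> (centred sc M p) = \<phi> (centred sc M q)"
proof -
  note c = centred_mem[OF M] and D = tangent_spaceD[OF \<phi>]
  let ?e = "eval_poly (*) M"
  have add: "\<phi> (rep_class sc (p + q)) = \<phi> (rep_class sc p) + \<phi> (rep_class sc q)"
    if "?e p = 0" "?e q = 0" for p q
    using D(1)[of "rep_class sc p" "rep_class sc q"] that by (auto simp: mem_max_ideal[OF M]
        coord_ring_ops)
  have scale: "\<phi> (rep_class sc (const_poly c * p)) = c * \<phi> (rep_class sc p)" if "?e p = 0" for c p
    using D(2)[of "rep_class sc p" c] that by (auto simp: mem_max_ideal[OF M] coord_ring_ops)
  have mult: "\<phi> (rep_class sc (p * q)) = 0" if "?e p = 0" "?e q = 0" for p q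
    using D(3)[of "rep_class sc p" "rep_class sc q"] that by (auto simp: mem_max_ideal[OF M]
        coord_ring_ops)
  have z: "?e (p - const_poly (?e p)) = 0" for p by (simp add: ev.eval_diff ev.eval_const)
  show "\<phi> (centred sc M (p + q)) = \<phi> (centred sc M p) + \<phi> (centred sc M q)"
    using add[OF z[of p] z[of q]] by (simp add: centred_def ev.eval_add const_poly_hom
        algebra_simps)
  have "\<phi> (rep_class sc 0) = 0" using scale[of 0 0] by (simp add: ev.eval_zero)
  then show "\<phi> (centred sc M (const_poly c)) = 0" by (simp add: centred_def ev.eval_const)
  let ?p = "p - const_poly (?e p)" and ?q = "q - const_poly (?e q)"
  have "p * q - const_poly (?e (p * q)) =
      ?p * ?q + (const_poly (?e p) * ?q + const_poly (?e q) * ?p)"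
    by (simp add: ev.eval_mult const_poly_hom algebra_simps)
  then have "\<phi> (centred sc M (p * q)) =
      \<phi> (rep_class sc (?p * ?q)) + (\<phi> (rep_class sc (const_poly (?e p) * ?q)) + \<phi> (rep_class sc
          (const_poly (?e q) * ?p)))"
    using add[of "?p * ?q" "const_poly (?e p) * ?q + const_poly (?e q) * ?p"]
      add[of "const_poly (?e p) * ?q" "const_poly (?e q) * ?p"] z
    by (simp add: centred_def ev.eval_mult ev.eval_add)
  then show "\<phi> (centred sc M (p * q)) =
        ?e p * \<phi> (centred sc M q) + ?e q * \<phi> (centred sc M p)"
    using mult[OF z[of p] z[of q]] scale[OF z[of q]] scale[OF z[of p]] by (simp add: centred_def)
  assume I: "p - q \<in> rep_ideal sc"
  then have "?e p = ?e q" using ev.eval_rep_ideal[OF M I] by (simp add: ev.eval_diff)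
  then show "\<phi> (centred sc M p) = \<phi> (centred sc M q)"
    using rep_class_cong[of "p - const_poly (?e q)" "q - const_poly (?e q)" sc] I by (simp add:
        centred_def)
qed

text \<open>
  By the Leibniz rule, agreement on the matrix entries propagates to all monomials.
\<close>

lemma tangent_determined:
  fixes sc :: "'k::field \<Rightarrow> 'a::{ring,monoid_mult} \<Rightarrow> 'a" and M :: "'a \<Rightarrow> 'k^'n::finite^'n"
  assumes M: "M \<in> rep_points sc (*)" and \<phi>: "\<phi> \<in> tangent_space sc M" and \<psi>: "\<psi> \<in> tangent_space sc M"
    and eq: "\<And>a i j. \<phi> (centred sc M (entry a i j)) = \<psi> (centred sc M (entry a i j))"
  shows "\<phi> = \<psi>"
proof -
  note L = tangent_leibniz[OF M \<phi>] and L' = tangent_leibniz[OF M \<psi>]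
  have mono: "\<phi> (centred sc M (Poly_Mapping.single m 1)) = \<psi> (centred sc M (Poly_Mapping.single m
      1))" for m
  proof (induction m rule: poly_mapping_add_induct)
    fix v :: "'a \<times> 'n \<times> 'n" and k :: nat
    obtain a i j where v: "v = (a, i, j)" by (cases v) auto
    show "\<phi> (centred sc M (Poly_Mapping.single (Poly_Mapping.single v k) 1)) =
        \<psi> (centred sc M (Poly_Mapping.single (Poly_Mapping.single v k) 1))"
    proof (induction k)
      case 0
      show ?case using L(2)[of 1] L'(2)[of 1] by (simp add: const_poly_def)
    next
      case (Suc k)
      have "Poly_Mapping.single (Poly_Mapping.single v (Suc k)) 1 =
          entry a i j * Poly_Mapping.single (Poly_Mapping.single v k) (1 :: 'k)"
        by (simp add: entry_def v mult_single single_add[symmetric])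
      then show ?case using Suc by (simp add: L(3) L'(3) eq)
    qed
  next
    fix m m' :: "'a \<times> 'n \<times> 'n \<Rightarrow>\<^sub>0 nat"
    assume IH: "\<phi> (centred sc M (Poly_Mapping.single m 1)) = \<psi> (centred sc M (Poly_Mapping.single
        m 1))"
      "\<phi> (centred sc M (Poly_Mapping.single m' 1)) = \<psi> (centred sc M (Poly_Mapping.single m' 1))"
    have "Poly_Mapping.single (m + m') (1 :: 'k) = Poly_Mapping.single m 1 * Poly_Mapping.single
        m' 1"
      by (simp add: mult_single)
    then show "\<phi> (centred sc M (Poly_Mapping.single (m + m') 1)) = \<psi> (centred sc M
        (Poly_Mapping.single (m + m') 1))"
      using IH by (simp add: L(3) L'(3))
  qed
  have all: "\<phi> (centred sc M p) = \<psi> (centred sc M p)" for p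
  proof (induction p rule: poly_mapping_add_induct)
    fix m :: "'a \<times> 'n \<times> 'n \<Rightarrow>\<^sub>0 nat" and c :: 'k
    have "Poly_Mapping.single m c = const_poly c * Poly_Mapping.single m 1" by (simp add:
        const_poly_mult_single)
    then show "\<phi> (centred sc M (Poly_Mapping.single m c)) = \<psi> (centred sc M (Poly_Mapping.single m
        c))"
      by (simp add: L L' mono)
  qed (simp add: L(1) L'(1))
  show ?thesis
  proof
    fix f
    show "\<phi> f = \<psi> f"
    proof (cases "f \<in> max_ideal_at sc M")
      case True
      then obtain p where "f = rep_class sc p" "eval_poly (*) M p = 0" using mem_max_ideal[OF M]
          by blast
      then show ?thesis using all[of p] by (simp add: centred_def const_poly_hom)
    qed (simp add: tangent_spaceD(4)[OF \<phi>] tangent_spaceD(4)[OF \<psi>])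
  qed
qed

text \<open>The derivative of \<open>p\<close> at \<open>M\<close> in the direction \<open>D\<close>, read off from the value at \<open>M + \<epsilon> D\<close>.\<close>

definition directional :: "('a \<Rightarrow> 'k::field^'n::finite^'n) \<Rightarrow> ('a \<Rightarrow> 'k^'n^'n) \<Rightarrow> ('a, 'n, 'k)
    rep_poly \<Rightarrow> 'k" where
  "directional M D p = eps (eval_poly dual_scale (dual_point M D) p)"

lemma re_dual_eval:
  fixes M :: "'a \<Rightarrow> 'k::field^'n::finite^'n"
  shows "re (eval_poly dual_scale (dual_point M D) p) = eval_poly (*) M p"
proof (induction p rule: poly_mapping_add_induct)
  fix m :: "'a \<times> 'n \<times> 'n \<Rightarrow>\<^sub>0 nat" and c :: 'k
  have "re (monomial_value (dual_point M D) m) = monomial_value M m"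
  proof -
    have pw: "re (x ^ n) = re x ^ n" for x :: "'k dual" and n by (induction n) simp_all
    have pr: "re (prod f A) = (\<Prod>a\<in>A. re (f a))" for f :: "'z \<Rightarrow> 'k dual" and A
      by (induction A rule: infinite_finite_induct) simp_all
    show ?thesis
      unfolding monomial_value_def pr by (rule prod.cong) (auto simp: pw dual_point_def)
  qed
  then show "re (eval_poly dual_scale (dual_point M D) (Poly_Mapping.single m c)) =
      eval_poly (*) M (Poly_Mapping.single m c)"
    by (simp add: dual.eval_single ev.eval_single dual_scale_def)
qed (simp add: dual.eval_add ev.eval_add)

lemma directional_rules:
  "directional M D (p + q) = directional M D p + directional M D q"
  "directional M D (p - q) = directional M D p - directional M D q"
  "directional M D (p * q) = eval_poly (*) M p * directional M D q + directional M D p * eval_poly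
      (*) M q"
  "directional M D (const_poly c) = 0" "directional M D (entry a i j) = D a $ i $ j"
  by (simp_all add: directional_def dual.eval_add dual.eval_diff dual.eval_mult dual.eval_const
      dual.eval_entry
      re_dual_eval dual_scale_def dual_point_def)

lemma directional_linear:
  fixes M :: "'a \<Rightarrow> 'k::field^'n::finite^'n"
  shows "directional M (D + D') p = directional M D p + directional M D' p"
  "directional M (fun_scale (mat_scale (*)) c D) p = c * directional M D p"
proof -
  have mono: "directional M (D + D') (Poly_Mapping.single m 1) =
        directional M D (Poly_Mapping.single m 1) + directional M D' (Poly_Mapping.single m 1) \<and>
      directional M (fun_scale (mat_scale (*)) c D) (Poly_Mapping.single m 1) = c * directional M
          D (Poly_Mapping.single m 1)"
    for m
  proof (induction m rule: poly_mapping_add_induct)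
    fix v :: "'a \<times> 'n \<times> 'n" and k :: nat
    obtain a i j where v: "v = (a, i, j)" by (cases v) auto
    let ?s = "\<lambda>k. Poly_Mapping.single (Poly_Mapping.single v k) (1 :: 'k)"
    show "directional M (D + D') (?s k) = directional M D (?s k) + directional M D' (?s k) \<and>
      directional M (fun_scale (mat_scale (*)) c D) (?s k) = c * directional M D (?s k)"
    proof (induction k)
      case 0
      have "?s 0 = const_poly 1" by (simp add: const_poly_def)
      then show ?case by (simp only: directional_rules) simp
    next
      case (Suc k)
      have "?s (Suc k) = entry a i j * ?s k"
        by (simp add: entry_def v mult_single single_add[symmetric])
      then show ?case using Suc by (simp only: directional_rules) (simp add: mat_scale_def
          algebra_simps)
    qed
  next
    fix m m' :: "'a \<times> 'n \<times> 'n \<Rightarrow>\<^sub>0 nat"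
    let ?s = "\<lambda>m. Poly_Mapping.single m (1 :: 'k)"
    assume IH: "directional M (D + D') (?s m) = directional M D (?s m) + directional M D' (?s m) \<and>
      directional M (fun_scale (mat_scale (*)) c D) (?s m) = c * directional M D (?s m)"
      "directional M (D + D') (?s m') = directional M D (?s m') + directional M D' (?s m') \<and>
      directional M (fun_scale (mat_scale (*)) c D) (?s m') = c * directional M D (?s m')"
    have "?s (m + m') = ?s m * ?s m'" by (simp add: mult_single)
    then show "directional M (D + D') (?s (m + m')) = directional M D (?s (m + m')) + directional
        M D' (?s (m + m')) \<and>
      directional M (fun_scale (mat_scale (*)) c D) (?s (m + m')) = c * directional M D (?s (m +
          m'))"
      using IH by (simp only: directional_rules) (simp add: algebra_simps)
  qed
  have "directional M (D + D') p = directional M D p + directional M D' p \<and>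
      directional M (fun_scale (mat_scale (*)) c D) p = c * directional M D p"
  proof (induction p rule: poly_mapping_add_induct)
    fix m :: "'a \<times> 'n \<times> 'n \<Rightarrow>\<^sub>0 nat" and x :: 'k
    have *: "Poly_Mapping.single m x = const_poly x * Poly_Mapping.single m 1" by (simp add:
        const_poly_mult_single)
    show "directional M (D + D') (Poly_Mapping.single m x) = directional M D (Poly_Mapping.single
        m x) + directional M D' (Poly_Mapping.single m x) \<and>
      directional M (fun_scale (mat_scale (*)) c D) (Poly_Mapping.single m x) = c * directional M
          D (Poly_Mapping.single m x)"
      unfolding * using mono[of m] by (simp only: directional_rules) (simp add: algebra_simps)
  qed (auto simp: directional_rules(1) algebra_simps)
  then show "directional M (D + D') p = directional M D p + directional M D' p"
    "directional M (fun_scale (mat_scale (*)) c D) p = c * directional M D p" by auto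
qed

lemma dual_point_rep_point:
  fixes M :: "'a::{ring,monoid_mult} \<Rightarrow> 'k::field^'n::finite^'n"
  assumes k: "k_algebra sc" and M: "M \<in> rep_points sc (*)"
    and D: "D \<in> k_algebra.derivations sc (mat_scale (*)) (End_action M)"
  shows "dual_point M D \<in> rep_points sc dual_scale"
proof -
  interpret k_algebra sc by fact
  note Md = rep_pointsD[OF M]
  have Dd: "D (a + b) = D a + D b" "D (sc c a) = mat_scale (*) c (D a)" "D (a * b) = M a ** D b +
      D a ** M b" for a b c
    using D by (auto simp: derivations_def End_action_def Md)
  have "D 1 = 0" using Dd(3)[of 1 1] by (simp add: Md)
  then show ?thesis
    unfolding rep_points_def
    by (auto simp: Dd Md dual_point_def vec_eq_iff mat_scale_def dual_scale_def plus_dual_def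
        matrix_matrix_mult_def
        mat_def one_dual_def zero_dual_def dual.expand sum.distrib)
qed

text \<open>
  The derivations at \<open>M\<close> are the directions \<open>D\<close> for which \<open>M + \<epsilon> D\<close> is again a representation,
  hence the tangent vectors.
\<close>

lemma tangent_dim_eq_derivations:
  fixes M :: "'a::{ring,monoid_mult} \<Rightarrow> 'k::field_char_0^'n::finite^'n"
  assumes k: "k_algebra sc" and M: "M \<in> rep_points sc (*)"
    and fin: "finite_dimensional (fun_scale (mat_scale (*))) (k_algebra.derivations sc (mat_scale
        (*)) (End_action M))"
  shows "tangent_dim sc M =
    vector_space.dim (fun_scale (mat_scale (*))) (k_algebra.derivations sc (mat_scale (*))
        (End_action M))"
proof -
  interpret k_algebra sc by fact
  let ?Der = "derivations (mat_scale (*)) (End_action M)"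
  note vf = vector_space_fun_scale[OF vector_space_mat_scale] and vt = vector_space_fun_scale[OF
      vector_space_field]
  interpret F: vector_space "fun_scale (mat_scale (*)) :: 'k \<Rightarrow> ('a \<Rightarrow> 'k^'n^'n) \<Rightarrow> _" by (rule vf)
  interpret V: vector_space "mat_scale (*) :: 'k \<Rightarrow> 'k^'n^'n \<Rightarrow> _" by (rule vector_space_mat_scale)
  note B = act_linear[OF End_action_bimodule[OF M]]
  have rep: "\<exists>p. f = rep_class sc p \<and> eval_poly (*) M p = 0" if "f \<in> max_ideal_at sc M" for f
    using that by (simp only: mem_max_ideal[OF M])
  have mem: "rep_class sc p \<in> max_ideal_at sc M" if "eval_poly (*) M p = 0" for p
    using that by (auto simp only: mem_max_ideal[OF M])
  define \<Xi> where "\<Xi> D = (\<lambda>f. if f \<in> max_ideal_at sc M then directional M D (SOME p. p \<in> f) else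
      0)" for D
  have lin: "Vector_Spaces.linear (fun_scale (mat_scale (*))) (fun_scale (*)) \<Xi>"
  proof (rule linear_if_compatible[OF vf vt])
    show "\<Xi> (x + y) = \<Xi> x + \<Xi> y" for x y by (simp add: \<Xi>_def fun_eq_iff directional_linear(1))
    show "\<Xi> (fun_scale (mat_scale (*)) c x) = fun_scale (*) c (\<Xi> x)" for c x
      by (simp add: \<Xi>_def fun_eq_iff directional_linear(2))
  qed
  have sub: "F.subspace ?Der"
    by (rule subspace_if_closed[OF vf]) (auto simp: derivations_def B V.scale_right_distrib
        V.scale_left_commute)
  have ideal0: "directional M D p = 0" if "D \<in> ?Der" "p \<in> rep_ideal sc" for D p
    using dual.eval_rep_ideal[OF dual_point_rep_point[OF k M that(1)] that(2)] by (simp add: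
        directional_def)
  have \<Xi>_class: "\<Xi> D (rep_class sc p) = directional M D p" if D: "D \<in> ?Der" and p: "eval_poly (*)
      M p = 0" for D p
  proof -
    obtain i where i: "i \<in> rep_ideal sc" "(SOME q. q \<in> rep_class sc p) = i + p"
      using some_representative by blast
    have "rep_class sc p \<in> max_ideal_at sc M" by (rule mem[OF p])
    then show ?thesis by (simp add: \<Xi>_def i(2) directional_rules ideal0[OF D i(1)])
  qed
  have into: "\<Xi> D \<in> tangent_space sc M" if D: "D \<in> ?Der" for D
  proof -
    have prod: "f \<in> max_ideal_at sc M \<and> \<Xi> D f = 0"
      if "f \<in> ideal_prod (coord_ring sc) (max_ideal_at sc M) (max_ideal_at sc M)" for f
      using that
    proof (induction rule: ideal_prod.induct)
      case (prod f g)
      then obtain p q where pq: "f = rep_class sc p" "eval_poly (*) M p = 0" "g = rep_class sc q"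
          "eval_poly (*) M q = 0"
        using rep[OF prod(1)] rep[OF prod(2)] by blast
      then have "f \<otimes>\<^bsub>coord_ring sc\<^esub> g = rep_class sc (p * q)" "eval_poly (*) M (p * q) = 0"
        by (simp_all add: coord_ring_ops ev.eval_mult)
      then show ?case
        using \<Xi>_class[OF D, of "p * q"] mem[of "p * q"] pq(2,4) by (simp add: directional_rules)
    next
      case (sum f g)
      then obtain p q where pq: "f = rep_class sc p" "eval_poly (*) M p = 0" "g = rep_class sc q"
          "eval_poly (*) M q = 0"
        using rep[of f] rep[of g] sum by blast
      then have "f \<oplus>\<^bsub>coord_ring sc\<^esub> g = rep_class sc (p + q)" "eval_poly (*) M (p + q) = 0"
        by (simp_all add: coord_ring_ops ev.eval_add)
      moreover have "\<Xi> D (rep_class sc (p + q)) = \<Xi> D f + \<Xi> D g"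
        using \<Xi>_class[OF D, of "p + q"] \<Xi>_class[OF D, of p] \<Xi>_class[OF D, of q] pq
        by (simp add: directional_rules ev.eval_add)
      ultimately show ?case using sum mem[of "p + q"] by simp
    qed
    have add: "\<Xi> D (f \<oplus>\<^bsub>coord_ring sc\<^esub> g) = \<Xi> D f + \<Xi> D g"
      if fg: "f \<in> max_ideal_at sc M" "g \<in> max_ideal_at sc M" for f g
    proof -
      obtain p q where "f = rep_class sc p" "eval_poly (*) M p = 0" "g = rep_class sc q"
          "eval_poly (*) M q = 0"
        using rep[OF fg(1)] rep[OF fg(2)] by blast
      then show ?thesis
        using \<Xi>_class[OF D, of "p + q"] \<Xi>_class[OF D, of p] \<Xi>_class[OF D, of q]
        by (simp add: coord_ring_ops ev.eval_add directional_rules)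
    qed
    have scale: "\<Xi> D (rep_class sc (const_poly c) \<otimes>\<^bsub>coord_ring sc\<^esub> f) = c * \<Xi> D f"
      if f: "f \<in> max_ideal_at sc M" for c f
    proof -
      obtain p where "f = rep_class sc p" "eval_poly (*) M p = 0" using rep[OF f] by blast
      then show ?thesis
        using \<Xi>_class[OF D, of "const_poly c * p"] \<Xi>_class[OF D, of p]
        by (simp add: coord_ring_ops ev.eval_mult ev.eval_const directional_rules)
    qed
    show ?thesis
      unfolding tangent_space_def Let_def
      using prod add scale by (auto simp: rep_class_def[symmetric]) (simp add: \<Xi>_def)
  qed
  have \<Xi>_entry: "\<Xi> D (centred sc M (entry a i j)) = D a $ i $ j" if D: "D \<in> ?Der" for D a i j
    unfolding centred_def
    by (subst \<Xi>_class[OF D]) (simp_all add: ev.eval_diff ev.eval_const directional_rules)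
  have onto: "\<phi> \<in> \<Xi> ` ?Der" if \<phi>: "\<phi> \<in> tangent_space sc M" for \<phi>
  proof -
    note L = tangent_leibniz[OF M \<phi>]
    define D where "D a = (\<chi> i j. \<phi> (centred sc M (entry a i j)))" for a
    have sum: "\<phi> (centred sc M (\<Sum>l\<in>A. g l)) = (\<Sum>l\<in>A. \<phi> (centred sc M (g l)))" for g and A :: "'n
        set"
      using L(2)[of 0] by (induction A rule: infinite_finite_induct) (simp_all add: L(1)
          const_poly_hom)
    have 1: "\<phi> (centred sc M (entry (a + b) i j)) = \<phi> (centred sc M (entry a i j)) + \<phi> (centred sc
        M (entry b i j))"
      for a b i j
      using L(4)[of "entry (a + b) i j" "entry a i j + entry b i j"] rep_ideal_generators(1)[of a
          b i j sc]
      by (simp add: L(1) algebra_simps)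
    have 2: "\<phi> (centred sc M (entry (sc c a) i j)) = c * \<phi> (centred sc M (entry a i j))" for c a i j
      using L(4)[OF rep_ideal_generators(2)[where sc = sc]] by (simp add: L(2,3) ev.eval_const)
    have 3: "\<phi> (centred sc M (entry (a * b) i j)) =
        (\<Sum>l\<in>UNIV. M a $ i $ l * \<phi> (centred sc M (entry b l j)) + M b $ l $ j * \<phi> (centred sc M
            (entry a i l)))"
      for a b i j
      using L(4)[OF rep_ideal_generators(3)[where sc = sc]] by (simp add: sum L(3) ev.eval_entry)
    have "D (a + b) = D a + D b" "D (sc c a) = mat_scale (*) c (D a)" "D (a * b) = M a ** D b + D
        a ** M b" for a b c
      by (simp_all add: D_def 1 2 3 vec_eq_iff mat_scale_def matrix_matrix_mult_def sum.distrib
          mult.commute)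
    then have D: "D \<in> ?Der"
      by (simp add: derivations_def End_action_def rep_pointsD[OF M])
    have "\<phi> = \<Xi> D"
      by (rule tangent_determined[OF M \<phi> into[OF D]]) (simp add: \<Xi>_entry[OF D] D_def)
    then show ?thesis using D by blast
  qed
  have "D = 0" if "D \<in> ?Der" "\<Xi> D = 0" for D
    using \<Xi>_entry[OF that(1)] that(2) by (simp add: vec_eq_iff fun_eq_iff)
  moreover have "\<Xi> 0 = 0"
  proof -
    interpret l: Vector_Spaces.linear "fun_scale (mat_scale (*))" "fun_scale (*)" \<Xi> by (rule lin)
    show ?thesis by (rule l.zero)
  qed
  ultimately have "{D \<in> ?Der. \<Xi> D = 0} = {0}" using F.subspace_0[OF sub] by auto
  moreover have "F.dim {0} = 0"
    using F.dim_eq_card[of "{}" "{0}"] F.independent_empty F.span_insert_0[of "{}"] by simp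
  moreover have "\<Xi> ` ?Der = tangent_space sc M" using into onto by blast
  ultimately show ?thesis using rank_nullity(1)[OF lin sub fin] by (simp add: tangent_dim_def)
qed

section \<open>Regular functions on irreducible sets\<close>

definition regular_function :: "('k::field \<Rightarrow> 'a::{ring,monoid_mult} \<Rightarrow> 'a) \<Rightarrow> (('a \<Rightarrow>
    'k^'n::finite^'n) \<Rightarrow> 'k) \<Rightarrow> bool" where
  "regular_function sc g \<longleftrightarrow> (\<exists>p. \<forall>M\<in>rep_points sc (*). g M = eval_poly (*) M p)"

lemma (in k_algebra) env_trace_regular:
  assumes "t \<in> carrier E"
  shows "regular_function sc (\<lambda>M :: 'a \<Rightarrow> 'k^'n::finite^'n. env_trace M t)"
  using assms
proof (induction t rule: env_induct)
  case (tensor a b)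
  have "env_trace M (tensor sc a b) = eval_poly (*) M ((\<Sum>i\<in>UNIV. entry a i i) * (\<Sum>i\<in>UNIV. entry b
      i i))"
    if "M \<in> rep_points sc (*)" for M :: "'a \<Rightarrow> 'k^'n^'n"
    by (simp add: env_trace_tensor[OF that] ev.eval_mult ev.eval_sum ev.eval_entry trace_def)
  then show ?case unfolding regular_function_def by blast
next
  case (add t u)
  then obtain p q where "\<forall>M\<in>rep_points sc (*). env_trace (M :: 'a \<Rightarrow> 'k^'n^'n) t = eval_poly (*) M p"
    "\<forall>M\<in>rep_points sc (*). env_trace (M :: 'a \<Rightarrow> 'k^'n^'n) u = eval_poly (*) M q"
    unfolding regular_function_def by blast
  then have "\<forall>M\<in>rep_points sc (*). env_trace (M :: 'a \<Rightarrow> 'k^'n^'n) (t \<oplus>\<^bsub>E\<^esub> u) = eval_poly (*) M (p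
      + q)"
    using add(1,2) by (simp add: env_trace_add ev.eval_add)
  then show ?case unfolding regular_function_def by blast
qed

lemma regular_function_sum:
  assumes "finite J" "\<And>j. j \<in> J \<Longrightarrow> regular_function sc (g j)"
  shows "regular_function sc (\<lambda>M. \<Sum>j\<in>J. g j M)"
proof -
  have "\<forall>j\<in>J. \<exists>p. \<forall>M\<in>rep_points sc (*). g j M = eval_poly (*) M p"
    using assms(2) by (auto simp: regular_function_def)
  then obtain p where p: "\<And>j M. j \<in> J \<Longrightarrow> M \<in> rep_points sc (*) \<Longrightarrow> g j M = eval_poly (*) M (p j)" by
      metis
  then have "\<forall>M\<in>rep_points sc (*). (\<Sum>j\<in>J. g j M) = eval_poly (*) M (\<Sum>j\<in>J. p j)"
    by (simp add: ev.eval_sum)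
  then show ?thesis unfolding regular_function_def by blast
qed

lemma topspace_rep_topology: "topspace (rep_topology sc) = rep_points sc (*)"
proof -
  have "M \<in> rep_points sc (*) \<Longrightarrow> eval_at (*) M (rep_class sc 1) \<noteq> 0" for M
    by (simp add: eval_at_class ev.eval_one)
  then show ?thesis
    by (auto simp: rep_topology_def coord_ring_ops)
qed

lemma closed_zero_set:
  "closedin (rep_topology sc) {M \<in> rep_points sc (*). eval_poly (*) M p = 0}"
proof -
  have "openin (rep_topology sc) {M \<in> rep_points sc (*). eval_at (*) M (rep_class sc p) \<noteq> 0}"
    unfolding rep_topology_def
    by (rule topology_generated_by_Basis) (auto simp: coord_ring_ops)
  moreover have "topspace (rep_topology sc) - {M \<in> rep_points sc (*). eval_poly (*) M p = 0} =
      {M \<in> rep_points sc (*). eval_at (*) M (rep_class sc p) \<noteq> 0}"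
    by (auto simp: topspace_rep_topology eval_at_class)
  ultimately show ?thesis by (auto simp: closedin_def topspace_rep_topology)
qed

lemma irreducible_in_finite_union:
  assumes "irreducible_in T Z" "finite I" "\<And>i. i \<in> I \<Longrightarrow> closedin T (C i)" "Z \<subseteq> (\<Union>i\<in>I. C i)"
  shows "\<exists>i\<in>I. Z \<subseteq> C i"
  using assms(2-4)
proof (induction I rule: finite_induct)
  case empty
  then show ?case using assms(1) by (auto simp: irreducible_in_def)
next
  case (insert i I)
  have "closedin T (\<Union>i\<in>I. C i)" using insert by (intro closedin_Union) auto
  moreover have "closedin T (C i)" "Z \<subseteq> C i \<union> (\<Union>i\<in>I. C i)" using insert by auto
  ultimately have "Z \<subseteq> C i \<or> Z \<subseteq> (\<Union>i\<in>I. C i)" using assms(1) unfolding irreducible_in_def by blast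
  then show ?case using insert by auto
qed

text \<open>A regular function with finitely many values is constant: its fibres are closed.\<close>

lemma bounded_regular_function_constant:
  fixes Z :: "('a::{ring,monoid_mult} \<Rightarrow> 'k::field_char_0^'n::finite^'n) set"
  assumes Z: "irreducible_in (rep_topology sc) Z" and g: "regular_function sc g"
    and h: "\<And>M. M \<in> rep_points sc (*) \<Longrightarrow> of_nat (h M) = g M" "\<And>M. M \<in> rep_points sc (*) \<Longrightarrow> h M \<le> N"
  shows "\<exists>c. \<forall>M\<in>Z. h M = c"
proof -
  obtain p where p: "\<And>M. M \<in> rep_points sc (*) \<Longrightarrow> g M = eval_poly (*) M p"
    using g by (auto simp: regular_function_def)
  have ZR: "Z \<subseteq> rep_points sc (*)" using Z by (auto simp: irreducible_in_def topspace_rep_topology)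
  have val: "eval_poly (*) M (p - const_poly (of_nat c)) = 0 \<longleftrightarrow> h M = c" if "M \<in> rep_points sc (*)"
      for M c
  proof -
    have "eval_poly (*) M (p - const_poly (of_nat c)) = of_nat (h M) - of_nat c"
      using h(1)[OF that] p[OF that] by (simp add: ev.eval_diff ev.eval_const)
    then show ?thesis by simp
  qed
  have "\<exists>c\<in>{..N}. Z \<subseteq> {M \<in> rep_points sc (*). eval_poly (*) M (p - const_poly (of_nat c)) = 0}"
  proof (rule irreducible_in_finite_union[OF Z])
    show "Z \<subseteq> (\<Union>c\<in>{..N}. {M \<in> rep_points sc (*). eval_poly (*) M (p - const_poly (of_nat c)) = 0})"
      using ZR h(2) val by auto
  qed (auto intro: closed_zero_set)
  then show ?thesis using val ZR by blast
qed

text \<open>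
  A dimension that is given by a trace formula is a regular function, and the size of the frame
  bounds it.
\<close>

lemma trace_dimension_constant:
  fixes Z :: "('a::{ring,monoid_mult} \<Rightarrow> 'k::field_char_0^'n::finite^'n) set" and s :: "'k \<Rightarrow>
      'v::ab_group_add \<Rightarrow> 'v"
  assumes k: "k_algebra sc" and Z: "irreducible_in (rep_topology sc) Z" and vs: "vector_space s"
    and tr: "\<exists>(J :: 'j set) t. finite J \<and> (\<forall>j\<in>J. t j \<in> carrier (env_alg sc)) \<and>
      (\<forall>M\<in>rep_points sc (*). \<exists>w \<phi>. frame s (W M) (J \<times> (UNIV :: ('n \<times> 'n) set)) w \<phi> \<and>
         (\<Sum>l\<in>J \<times> UNIV. \<phi> l (w l)) = (\<Sum>j\<in>J. k_algebra.env_trace M (t j)))"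
  shows "\<exists>c. \<forall>M\<in>Z. vector_space.dim s (W M) = c"
proof -
  interpret k_algebra sc by fact
  obtain J :: "'j set" and t where J: "finite J" "\<And>j. j \<in> J \<Longrightarrow> t j \<in> carrier E"
    and fr: "\<And>M. M \<in> rep_points sc (*) \<Longrightarrow> \<exists>w \<phi>. frame s (W M) (J \<times> (UNIV :: ('n \<times> 'n) set)) w \<phi> \<and>
         (\<Sum>l\<in>J \<times> UNIV. \<phi> l (w l)) = (\<Sum>j\<in>J. env_trace M (t j))"
    using tr by blast
  show ?thesis
  proof (rule bounded_regular_function_constant[OF Z])
    show "regular_function sc (\<lambda>M :: 'a \<Rightarrow> 'k^'n^'n. \<Sum>j\<in>J. env_trace M (t j))"
      by (intro regular_function_sum env_trace_regular J)
    fix M :: "'a \<Rightarrow> 'k^'n^'n" assume "M \<in> rep_points sc (*)"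
    then obtain w \<phi> where f: "frame s (W M) (J \<times> (UNIV :: ('n \<times> 'n) set)) w \<phi>"
      "(\<Sum>l\<in>J \<times> UNIV. \<phi> l (w l)) = (\<Sum>j\<in>J. env_trace M (t j))" using fr by blast
    show "of_nat (vector_space.dim s (W M)) = (\<Sum>j\<in>J. env_trace M (t j))"
      using dim_eq_frame_trace[OF vs f(1)] f(2) by simp
    show "vector_space.dim s (W M) \<le> card (J \<times> (UNIV :: ('n \<times> 'n) set))"
      by (rule frame_dim_le[OF vs f(1)])
  qed
qed

section \<open>Tangent spaces along an irreducible component\<close>

theorem theorem5p2:
  fixes sc :: "'k::{alg_closed_field,field_char_0} \<Rightarrow> 'a::{ring,monoid_mult} \<Rightarrow> 'a"
    and F :: "nat \<Rightarrow> (('a \<times> 'a \<Rightarrow>\<^sub>0 'k) set, 'f) module"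
    and d :: "nat \<Rightarrow> 'f \<Rightarrow> 'f"
    and e :: "'f \<Rightarrow> 'a"
    and Z :: "('a \<Rightarrow> 'k^'n::finite^'n) set"
  assumes "k_algebra sc"
    and "finitely_generated_algebra sc"
    and "calabi_yau_2 sc"
    and "fg_projective_resolution (env_alg sc) (diagonal_bimod sc) F d e"
    and "\<And>i. i \<in> {0, 1, 2} \<Longrightarrow>
           locally_constant (rep_topology sc :: ('a \<Rightarrow> 'k^'n^'n) topology) (hom_End_dim sc (F i))"
    and "irreducible_component (rep_topology sc) Z"
  shows "\<exists>g :: nat \<Rightarrow> nat. strict_mono_on (End_dim ` Z) g \<and>
           (\<forall>M\<in>Z. tangent_dim sc M = g (End_dim M))"
proof -
  interpret k_algebra sc by fact
  obtain P :: "nat \<Rightarrow> (('a \<times> 'a \<Rightarrow>\<^sub>0 'k) set, nat \<Rightarrow> ('a \<times> 'a \<Rightarrow>\<^sub>0 'k) set) module" and \<delta> \<epsilon>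
    where cy: "cy2_resolution sc P \<delta> \<epsilon>"
    by (rule calabi_yau_2_resolution[OF assms(3)])
  interpret cy2_resolution sc P \<delta> \<epsilon> by (rule cy)
  have Z: "irreducible_in (rep_topology sc) Z" using assms(6) by (simp add:
      irreducible_component_def)
  have ZR: "Z \<subseteq> rep_points sc (*)" using Z by (auto simp: irreducible_in_def topspace_rep_topology)
  note vf = vector_space_fun_scale[OF vector_space_mat_scale]
  let ?dim = "vector_space.dim (fun_scale (mat_scale (*)))"
  obtain c0 where c0: "\<And>M. M \<in> Z \<Longrightarrow> ?dim (lmod_hom E (P 0) (End_bimod M)) = c0"
    using trace_dimension_constant[OF assms(1) Z vf hom_trace_formula] by blast
  obtain c1 where c1: "\<And>M. M \<in> Z \<Longrightarrow> ?dim (lmod_hom E (P (Suc 0)) (End_bimod M)) = c1"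
    using trace_dimension_constant[OF assms(1) Z vf hom_trace_formula] by blast
  obtain z2 where z2: "\<And>M. M \<in> Z \<Longrightarrow>
      ?dim (bimod_cocycles (mat_scale (*)) (End_action M) P \<delta> (Suc (Suc 0))) = z2"
    using trace_dimension_constant[OF assms(1) Z vf cocycle_trace_formula] by blast
  define n2 where "n2 = vector_space.dim (mat_scale (*)) (UNIV :: ('k^'n^'n) set)"
  have key: "tangent_dim sc M + c0 + z2 = n2 + c1 + End_dim M" if "M \<in> Z" for M
  proof -
    have M: "M \<in> rep_points sc (*)" using that ZR by blast
    note df = dimension_formula[OF cy M]
    show ?thesis
      using df(1) tangent_dim_eq_derivations[OF assms(1) M df(2)] c0[OF that] c1[OF that] z2[OF
          that]
      by (simp add: n2_def)
  qed
  \<comment> \<open>The subtraction is exact at the values that occur, so \<open>?g\<close> is a translation there.\<close>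
  let ?g = "\<lambda>h. n2 + c1 + h - (c0 + z2)"
  have "tangent_dim sc M = ?g (End_dim M)" "c0 + z2 \<le> n2 + c1 + End_dim M" if "M \<in> Z" for M
    using key[OF that] by linarith+
  then show ?thesis by (intro exI[of _ ?g]) (force simp: strict_mono_on_def)
qed

end
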